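(* Let $\Omega\subset \mathrm{P}(V)$ be a properly convex open set. Then (1) for any pair $(\xi,\eta)\in\mathrm{Geod}(\Omega)$ such that $\xi$ is strongly extremal, there exist neighbourhoods $U$ of $\xi$ and $U'$ of $\eta$ in $\mathrm{P}(V)$ such that for any biproximal automorphism $g\in\mathrm{Aut}(\Omega)$, if $(x_g^+,x_g^-)\in U\times U'$, then $g$ is rank-one; (2) if $\Gamma\subset\mathrm{Aut}(\Omega)$ is a strongly irreducible discrete subgroup such that $M=\Omega/\Gamma$ is rank-one, then rank-one periodic geodesics are dense in $T^1M_{bip}$ (i.e. the set of rank-one periodic vectors is a dense subset of $T^1M_{bip}$). In particular $T^1M_{bip}$ is not empty.
   Context: $V=\mathbb{R}^{d+1}$ and $\mathrm{P}(V)$ is its projective space. An open set $\Omega\subset\mathrm{P}(V)$ is properly convex if it is convex and bounded in some affine chart; $\mathrm{Aut}(\Omega)\subset\mathrm{PGL}(V)$ is the group of elements preserving $\Omega$. A subgroup of $\mathrm{PGL}(V)$ is strongly irreducible if it preserves no finite union of proper projective subspaces. $\mathrm{Geod}(\Omega)$ is the set of pairs $(x,y)\in\partial\Omega\times\partial\Omega$ with $x\ne y$ such that the projective line through $x$ and $y$ meets $\Omega$. Hilbert metric: for $x,y\in\Omega$, $d_\Omega(x,y)=\frac12\log[a,x,y,b]$, where $a,x,y,b$ are aligned in this order, $a,b\in\partial\Omega$, and $[0,1,t,\infty]=t$. It is induced by a Finsler metric with unit tangent bundle $T^1\Omega$ and projection $\pi:T^1\Omega\to\Omega$. For $v\in T^1\Omega$,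 let $c:\mathbb{R}\to\Omega$ be the isometric parametrisation of the intersection with $\Omega$ of the projective line generated by $v$, with $c'(0)=v$; then $\phi_t v=c'(t)$ defines the geodesic flow, and $\phi_{\pm\infty}v=\lim_{t\to\pm\infty}\pi\phi_tv\in\partial\Omega$. For $\Gamma\subset\mathrm{Aut}(\Omega)$ discrete (not assumed torsion-free), $M=\Omega/\Gamma$, $T^1M=T^1\Omega/\Gamma$, and the flow descends to $T^1M$. An element of $\mathrm{PGL}(V)$ is proximal if a lift to $\mathrm{GL}(V)$ has exactly one complex eigenvalue of maximal modulus and it has multiplicity one; the corresponding eigenline is its attracting fixed point. $g$ is biproximal if $g$ and $g^{-1}$ are both proximal; $x_g^+$ and $x_g^-$ denote the attracting fixed points of $g$ and $g^{-1}$ respectively. The proximal limit set $\Lambda_\Gamma$ is the closure in $\mathrm{P}(V)$ of the set of attracting fixed points of proximal elements of $\Gamma$, and $T^1M_{bip}:=\{v\in T^1\Omega:\phi_{\infty}v,\phi_{-\infty}v\in\Lambda_\Gamma\}/\Gamma\subset T^1M$. A point $\xi\in\partial\Omega$ is smooth if it admits a unique supporting hyperplane (hyperplane containing $\xi$ and disjoint from $\Omega$), and strongly extremal if it is not contained in any non-trivial segment contained in $\partial\Omega$. A periodic vector $v\in T^1M$ is rank-one if for any lift $\tilde v\in T^1\Omega$, $\phi_{\infty}\tilde v$ and $\phi_{-\infty}\tilde v$ are smooth and strongly extremal; a rank-one periodic geodesic is the flow orbit of such a vector. $M$ is rank-one if $T^1M$ contains a rank-one periodic vector. An infinite-order element of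 a discrete subgroup of $\mathrm{Aut}(\Omega)$ (for a biproximal $g\in\mathrm{Aut}(\Omega)$ one may use the discrete group $\langle g\rangle$) is rank-one if it preserves the flow orbit of some $\tilde v\in T^1\Omega$ lifting a rank-one periodic vector. *)

theory Defs
  imports
    "HOL-Analysis.Analysis"
    "HOL-Computational_Algebra.Polynomial"
    "HOL-Algebra.Generated_Groups"
begin

section \<open>Projective space, its tangent bundle, and the projective linear group\<close>

text \<open>
  The vector space is \<open>real^'n\<close>, so that \<open>CARD('n)\<close> is \<open>d + 1\<close>. The three types below are partial
  quotients with the quotient topology: \<open>proj v\<close>, \<open>tvec (p, u)\<close> and \<open>pgl A\<close> are meaningful only
  for \<open>v \<noteq> 0\<close>, \<open>p \<noteq> 0\<close> and \<open>invertible A\<close> respectively.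
\<close>

definition proj_rel :: "real^'n \<Rightarrow> real^'n \<Rightarrow> bool" where
  "proj_rel v w \<longleftrightarrow> v \<noteq> 0 \<and> w \<noteq> 0 \<and> (\<exists>c. c \<noteq> 0 \<and> w = c *\<^sub>R v)"

lemma part_equivp_proj_rel: "part_equivp proj_rel"
proof (rule part_equivpI)
  show "\<exists>x. proj_rel x x"
    by (rule exI[of _ "axis undefined 1"]) (auto simp: proj_rel_def axis_eq_0_iff intro!: exI[of _ 1])
  show "symp proj_rel"
    by (rule sympI) (auto simp: proj_rel_def, metis scaleR_scaleR left_inverse scaleR_one
        inverse_nonzero_iff_nonzero)
  show "transp proj_rel"
    by (rule transpI, unfold proj_rel_def) (metis mult_eq_0_iff scaleR_scaleR)
qed

quotient_type (overloaded) 'n projective = "real^'n" / partial: proj_rel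
  morphisms rep_proj proj
  by (rule part_equivp_proj_rel)

instantiation projective :: (finite) topological_space
begin

definition open_projective :: "'a projective set \<Rightarrow> bool" where
  "open_projective U \<longleftrightarrow> open {v. v \<noteq> 0 \<and> proj v \<in> U}"

instance
proof
  have "{v::real^'a. v \<noteq> 0 \<and> proj v \<in> UNIV} = - {0}" by auto
  then show "open (UNIV :: 'a projective set)"
    unfolding open_projective_def by (simp add: open_delete Compl_eq_Diff_UNIV)
next
  fix S T :: "'a projective set"
  assume "open S" "open T"
  moreover have "{v::real^'a. v \<noteq> 0 \<and> proj v \<in> S \<inter> T}
      = {v. v \<noteq> 0 \<and> proj v \<in> S} \<inter> {v. v \<noteq> 0 \<and> proj v \<in> T}" by auto
  ultimately show "open (S \<inter> T)"
    unfolding open_projective_def by (simp add: open_Int)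
next
  fix K :: "'a projective set set"
  assume "\<forall>S\<in>K. open S"
  moreover have "{v::real^'a. v \<noteq> 0 \<and> proj v \<in> \<Union>K}
      = (\<Union>S\<in>K. {v. v \<noteq> 0 \<and> proj v \<in> S})" by auto
  ultimately show "open (\<Union>K)"
    unfolding open_projective_def by auto
qed

end

lemma proj_eq_iff:
  assumes "v \<noteq> 0" "w \<noteq> 0"
  shows "proj v = proj w \<longleftrightarrow> (\<exists>c. c \<noteq> 0 \<and> w = c *\<^sub>R v)"
proof -
  have refl: "proj_rel x x" if "x \<noteq> 0" for x :: "real^'n"
    using that by (auto simp: proj_rel_def intro!: exI[of _ 1])
  have "proj v = proj w \<longleftrightarrow> proj_rel v w"
    using Quotient3_rel[OF Quotient3_projective, of v w] refl assms by blast
  then show ?thesis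
    using assms by (simp add: proj_rel_def)
qed

lemma proj_cases: obtains v where "v \<noteq> 0" "x = proj v"
proof -
  have "proj_rel (rep_proj x) (rep_proj x)"
    by (rule Quotient3_rep_reflp[OF Quotient3_projective])
  moreover have "x = proj (rep_proj x)"
    by (simp add: Quotient3_abs_rep[OF Quotient3_projective])
  ultimately show ?thesis
    using that by (auto simp: proj_rel_def)
qed

instance projective :: (finite) t2_space
proof
  fix x y :: "'a projective"
  assume "x \<noteq> y"
  obtain v w where v: "v \<noteq> 0" "x = proj v" and w: "w \<noteq> 0" "y = proj w"
    by (metis proj_cases)
  define F where "F z = (v \<bullet> z)\<^sup>2 * (w \<bullet> w) - (w \<bullet> z)\<^sup>2 * (v \<bullet> v)" for z :: "real^'a"
  have cont: "continuous_on UNIV F"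
    unfolding F_def by (intro continuous_intros)
  have F_scale: "F (c *\<^sub>R z) = c\<^sup>2 * F z" for c z
    by (simp add: F_def power_mult_distrib algebra_simps)
  have CS: "(v \<bullet> w)\<^sup>2 < (v \<bullet> v) * (w \<bullet> w)"
  proof -
    have "(v \<bullet> w)\<^sup>2 \<noteq> (v \<bullet> v) * (w \<bullet> w)"
    proof
      assume eq: "(v \<bullet> w)\<^sup>2 = (v \<bullet> v) * (w \<bullet> w)"
      define c where "c = (v \<bullet> w) / (v \<bullet> v)"
      have vv: "v \<bullet> v \<noteq> 0" using v by simp
      have "(w - c *\<^sub>R v) \<bullet> (w - c *\<^sub>R v) = w \<bullet> w - 2 * c * (v \<bullet> w) + c\<^sup>2 * (v \<bullet> v)"
        by (simp add: inner_diff_left inner_diff_right inner_commute power2_eq_square)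
      also have "\<dots> = ((v \<bullet> v) * (w \<bullet> w) - (v \<bullet> w)\<^sup>2) / (v \<bullet> v)"
        using vv by (simp add: c_def field_simps power2_eq_square)
      finally have "w = c *\<^sub>R v" using eq by simp
      moreover from this w have "c \<noteq> 0" by auto
      ultimately show False using proj_eq_iff[of v w] v w \<open>x \<noteq> y\<close> by blast
    qed
    with Cauchy_Schwarz_ineq[of v w] show ?thesis by simp
  qed
  have pos: "F v > 0" "F w < 0"
    using mult_strict_left_mono[OF CS, of "v \<bullet> v"] mult_strict_left_mono[OF CS, of "w \<bullet> w"] v w
    by (auto simp: F_def inner_commute power2_eq_square algebra_simps)
  define U where "U = proj ` {z. z \<noteq> 0 \<and> F z > 0}"
  define W where "W = proj ` {z. z \<noteq> 0 \<and> F z < 0}"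
  have sgn_eq: "z \<noteq> 0 \<Longrightarrow> z' \<noteq> 0 \<Longrightarrow> proj z = proj z' \<Longrightarrow> sgn (F z) = sgn (F z')" for z z'
  proof -
    assume "z \<noteq> 0" "z' \<noteq> 0" "proj z = proj z'"
    then obtain c where "c \<noteq> 0" "z' = c *\<^sub>R z" by (auto simp: proj_eq_iff)
    moreover from this have "sgn (c\<^sup>2) = 1" by (simp only: sgn_1_pos zero_less_power2) simp
    ultimately show ?thesis by (simp only: F_scale sgn_mult mult_1)
  qed
  have preU: "{z. z \<noteq> 0 \<and> proj z \<in> U} = {z. F z > 0}"
    using sgn_eq by (auto simp: U_def F_def) (smt (verit) sgn_1_pos sgn_pos)+
  have preW: "{z. z \<noteq> 0 \<and> proj z \<in> W} = {z. F z < 0}"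
    using sgn_eq by (auto simp: W_def F_def) (smt (verit) sgn_1_neg sgn_neg)+
  have "open U" "open W"
    unfolding open_projective_def preU preW using cont
    by (auto intro!: open_Collect_less continuous_on_const)
  moreover have "x \<in> U" "y \<in> W"
    using v w pos by (auto simp: U_def W_def)
  moreover have "U \<inter> W = {}"
    using sgn_eq by (auto simp: U_def W_def) (smt (verit) sgn_1_neg sgn_1_pos sgn_neg sgn_pos)
  ultimately show "\<exists>U V. open U \<and> open V \<and> x \<in> U \<and> y \<in> V \<and> U \<inter> V = {}" by blast
qed

text \<open>
  The tangent vector to \<open>P(V)\<close> represented by \<open>(p, u)\<close> is the image of the tangent vector \<open>u\<close> at
  \<open>p \<in> V - {0}\<close> under the differential of \<open>V - {0} \<rightarrow> P(V)\<close>, which is onto with kernel spanned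
  by \<open>p\<close>. This identifies \<open>TP(V)\<close> with the following quotient.
\<close>

definition tvec_rel :: "(real^'n) \<times> (real^'n) \<Rightarrow> (real^'n) \<times> (real^'n) \<Rightarrow> bool" where
  "tvec_rel = (\<lambda>(p, u) (p', u'). p \<noteq> 0 \<and> p' \<noteq> 0 \<and>
     (\<exists>c m. c \<noteq> 0 \<and> p' = c *\<^sub>R p \<and> u' = c *\<^sub>R u + m *\<^sub>R p))"

lemma part_equivp_tvec_rel: "part_equivp tvec_rel"
proof (rule part_equivpI)
  have "tvec_rel (axis undefined 1, 0) (axis undefined 1, 0)"
    unfolding tvec_rel_def by (auto simp: axis_eq_0_iff intro: exI[of _ "1::real"])
  then show "\<exists>x. tvec_rel x x" by blast
  show "symp tvec_rel"
  proof (rule sympI, clarify)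
    fix p u p' u' :: "real^'n"
    assume "tvec_rel (p, u) (p', u')"
    then obtain c m where *: "p \<noteq> 0" "p' \<noteq> 0" "c \<noteq> 0" "p' = c *\<^sub>R p" "u' = c *\<^sub>R u + m *\<^sub>R p"
      by (auto simp: tvec_rel_def)
    have "p = inverse c *\<^sub>R p'" "u = inverse c *\<^sub>R u' + (- m / c^2) *\<^sub>R p'"
      using *(3) by (auto simp: *(4,5) scaleR_add_right power2_eq_square divide_inverse)
    then show "tvec_rel (p', u') (p, u)"
      unfolding tvec_rel_def using *(1-3)
      by (auto intro!: exI[of _ "inverse c"] exI[of _ "- m / c^2"])
  qed
  show "transp tvec_rel"
  proof (rule transpI, clarify)
    fix p u p' u' p'' u'' :: "real^'n"
    assume "tvec_rel (p, u) (p', u')" "tvec_rel (p', u') (p'', u'')"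
    then obtain c m c' m' where *: "p \<noteq> 0" "p'' \<noteq> 0" "c \<noteq> 0" "c' \<noteq> 0"
      "p' = c *\<^sub>R p" "u' = c *\<^sub>R u + m *\<^sub>R p" "p'' = c' *\<^sub>R p'" "u'' = c' *\<^sub>R u' + m' *\<^sub>R p'"
      by (auto simp: tvec_rel_def)
    have "p'' = (c' * c) *\<^sub>R p" "u'' = (c' * c) *\<^sub>R u + (c' * m + m' * c) *\<^sub>R p"
      by (auto simp: *(5-8) algebra_simps)
    then show "tvec_rel (p, u) (p'', u'')"
      unfolding tvec_rel_def using *(1-4)
      by (auto intro!: exI[of _ "c' * c"] exI[of _ "c' * m + m' * c"])
  qed
qed

quotient_type (overloaded) 'n ptangent = "(real^'n) \<times> (real^'n)" / partial: tvec_rel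
  morphisms rep_tvec tvec
  by (rule part_equivp_tvec_rel)

instantiation ptangent :: (finite) topological_space
begin

definition open_ptangent :: "'a ptangent set \<Rightarrow> bool" where
  "open_ptangent U \<longleftrightarrow> open {(p, u). p \<noteq> 0 \<and> tvec (p, u) \<in> U}"

instance
proof
  have "{(p::real^'a, u::real^'a). p \<noteq> 0 \<and> tvec (p, u) \<in> UNIV} = (- {0}) \<times> UNIV" by auto
  then show "open (UNIV :: 'a ptangent set)"
    unfolding open_ptangent_def by (simp add: open_Times open_delete Compl_eq_Diff_UNIV)
next
  fix S T :: "'a ptangent set"
  assume "open S" "open T"
  moreover have "{(p::real^'a, u). p \<noteq> 0 \<and> tvec (p, u) \<in> S \<inter> T}
      = {(p, u). p \<noteq> 0 \<and> tvec (p, u) \<in> S} \<inter> {(p, u). p \<noteq> 0 \<and> tvec (p, u) \<in> T}" by auto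
  ultimately show "open (S \<inter> T)"
    unfolding open_ptangent_def by (simp add: open_Int)
next
  fix K :: "'a ptangent set set"
  assume "\<forall>S\<in>K. open S"
  moreover have "{(p::real^'a, u). p \<noteq> 0 \<and> tvec (p, u) \<in> \<Union>K}
      = (\<Union>S\<in>K. {(p, u). p \<noteq> 0 \<and> tvec (p, u) \<in> S})" by auto
  ultimately show "open (\<Union>K)"
    unfolding open_ptangent_def by auto
qed

end

definition pgl_rel :: "real^'n^'n \<Rightarrow> real^'n^'n \<Rightarrow> bool" where
  "pgl_rel A B \<longleftrightarrow> invertible A \<and> invertible B \<and> (\<exists>c. c \<noteq> 0 \<and> B = c *\<^sub>R A)"

lemma part_equivp_pgl_rel: "part_equivp pgl_rel"
proof (rule part_equivpI)
  show "\<exists>x. pgl_rel x x"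
    by (rule exI[of _ "mat 1"]) (auto simp: pgl_rel_def invertible_det_nz intro!: exI[of _ 1])
  show "symp pgl_rel"
    by (rule sympI) (auto simp: pgl_rel_def, metis scaleR_scaleR left_inverse scaleR_one
        inverse_nonzero_iff_nonzero)
  show "transp pgl_rel"
    by (rule transpI, unfold pgl_rel_def) (metis mult_eq_0_iff scaleR_scaleR)
qed

quotient_type (overloaded) 'n pgl = "real^'n^'n" / partial: pgl_rel
  morphisms rep_pgl pgl
  by (rule part_equivp_pgl_rel)

instantiation pgl :: (finite) topological_space
begin

definition open_pgl :: "'a pgl set \<Rightarrow> bool" where
  "open_pgl U \<longleftrightarrow> open {A. invertible A \<and> pgl A \<in> U}"

instance
proof
  have "continuous_on UNIV (det :: real^'a^'a \<Rightarrow> real)"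
    unfolding det_def by (intro continuous_intros)
  then have "open ((det :: real^'a^'a \<Rightarrow> real) -` (- {0}))"
    by (intro open_vimage) (auto simp: open_delete Compl_eq_Diff_UNIV)
  moreover have "(det :: real^'a^'a \<Rightarrow> real) -` (- {0}) = {A. invertible A \<and> pgl A \<in> UNIV}"
    by (auto simp: invertible_det_nz)
  ultimately show "open (UNIV :: 'a pgl set)"
    unfolding open_pgl_def by simp
next
  fix S T :: "'a pgl set"
  assume "open S" "open T"
  moreover have "{A::real^'a^'a. invertible A \<and> pgl A \<in> S \<inter> T}
      = {A. invertible A \<and> pgl A \<in> S} \<inter> {A. invertible A \<and> pgl A \<in> T}" by auto
  ultimately show "open (S \<inter> T)"
    unfolding open_pgl_def by (simp add: open_Int)
next
  fix K :: "'a pgl set set"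
  assume "\<forall>S\<in>K. open S"
  moreover have "{A::real^'a^'a. invertible A \<and> pgl A \<in> \<Union>K}
      = (\<Union>S\<in>K. {A. invertible A \<and> pgl A \<in> S})" by auto
  ultimately show "open (\<Union>K)"
    unfolding open_pgl_def by auto
qed

end


lift_definition pgl_mult :: "('n::finite) pgl \<Rightarrow> 'n pgl \<Rightarrow> 'n pgl"
  is "(**) :: real^'n^'n \<Rightarrow> real^'n^'n \<Rightarrow> real^'n^'n"
  by (auto simp: pgl_rel_def invertible_mult matrix_scalar_ac scalar_matrix_assoc,
      metis mult_eq_0_iff)

lift_definition pgl_one :: "('n::finite) pgl" is "mat 1 :: real^'n^'n"
  by (auto simp: pgl_rel_def invertible_det_nz intro!: exI[of _ 1])

lemma invertible_vector_nonzero: "invertible (A :: real^'n^'n) \<Longrightarrow> v \<noteq> 0 \<Longrightarrow> A *v v \<noteq> 0"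
  by (metis invertible_def matrix_vector_mul_assoc matrix_vector_mul_lid matrix_vector_mult_0_right)

lift_definition pgl_act :: "('n::finite) pgl \<Rightarrow> 'n projective \<Rightarrow> 'n projective"
  is "(*v) :: real^'n^'n \<Rightarrow> real^'n \<Rightarrow> real^'n"
proof -
  fix A B :: "real^'n^'n" and v w :: "real^'n"
  assume "pgl_rel A B" "proj_rel v w"
  then obtain a c where *: "invertible A" "invertible B" "v \<noteq> 0" "w \<noteq> 0"
      "a \<noteq> 0" "c \<noteq> 0" "B = a *\<^sub>R A" "w = c *\<^sub>R v"
    by (auto simp: pgl_rel_def proj_rel_def)
  have "B *v w = (a * c) *\<^sub>R (A *v v)"
    by (simp add: *(7,8) scaleR_matrix_vector_assoc matrix_vector_mult_scaleR mult.commute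
        flip: scaleR_matrix_vector_assoc)
  then show "proj_rel (A *v v) (B *v w)"
    unfolding proj_rel_def using * invertible_vector_nonzero by (metis mult_eq_0_iff)
qed

lift_definition pgl_tact :: "('n::finite) pgl \<Rightarrow> 'n ptangent \<Rightarrow> 'n ptangent"
  is "\<lambda>(A :: real^'n^'n) (p, u). (A *v p, A *v u)"
proof clarify
  fix A B :: "real^'n^'n" and p u p' u' :: "real^'n"
  assume "pgl_rel A B" "tvec_rel (p, u) (p', u')"
  then obtain a c m where *: "invertible A" "invertible B" "p \<noteq> 0" "p' \<noteq> 0"
      "a \<noteq> 0" "c \<noteq> 0" "B = a *\<^sub>R A" "p' = c *\<^sub>R p" "u' = c *\<^sub>R u + m *\<^sub>R p"
    by (auto simp: pgl_rel_def tvec_rel_def)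
  have "B *v p' = (a * c) *\<^sub>R (A *v p)"
    "B *v u' = (a * c) *\<^sub>R (A *v u) + (a * m) *\<^sub>R (A *v p)"
    by (simp_all add: *(7-9) matrix_vector_mult_scaleR matrix_vector_right_distrib scaleR_add_right
        mult.commute flip: scaleR_matrix_vector_assoc)
  moreover have "A *v p \<noteq> 0" "B *v p' \<noteq> 0" "a * c \<noteq> 0"
    using *(1-6) invertible_vector_nonzero[of A p] invertible_vector_nonzero[of B p'] by simp_all
  ultimately show "tvec_rel (A *v p, A *v u) (B *v p', B *v u')"
    unfolding tvec_rel_def prod.case by blast
qed

lift_definition tbase :: "('n::finite) ptangent \<Rightarrow> 'n projective"
  is "fst :: (real^'n) \<times> (real^'n) \<Rightarrow> real^'n"
  by (auto simp: tvec_rel_def proj_rel_def)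

lift_definition tplane :: "('n::finite) ptangent \<Rightarrow> (real^'n) set"
  is "\<lambda>(p :: real^'n, u). span {p, u}"
proof clarify
  fix p u p' u' :: "real^'n"
  assume "tvec_rel (p, u) (p', u')"
  then obtain c m where *: "c \<noteq> 0" "p' = c *\<^sub>R p" "u' = c *\<^sub>R u + m *\<^sub>R p"
    by (auto simp: tvec_rel_def)
  have inv: "p = inverse c *\<^sub>R p'" "u = inverse c *\<^sub>R u' + (- m / c^2) *\<^sub>R p'"
    using *(1) by (auto simp: *(2,3) scaleR_add_right power2_eq_square divide_inverse)
  have 1: "a *\<^sub>R x + b *\<^sub>R y \<in> span {y, x}" "b *\<^sub>R y \<in> span {y, x}" for a b and x y :: "real^'n"
    by (intro span_add span_scale span_base; simp)+
  have "{p', u'} \<subseteq> span {p, u}"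
    unfolding *(2,3) using 1 by blast
  moreover have "{p, u} \<subseteq> span {p', u'}"
    using 1 inv by (metis empty_subsetI insert_subset)
  ultimately show "span {p, u} = span {p', u'}"
    by (simp add: span_eq)
qed

text \<open>\<open>PGL(V)\<close>, acting on \<open>P(V)\<close> by \<open>pgl_act\<close> and on \<open>TP(V)\<close> by \<open>pgl_tact\<close>.\<close>

definition PGL :: "('n::finite) pgl monoid" where
  "PGL = \<lparr>carrier = UNIV, mult = pgl_mult, one = pgl_one\<rparr>"

lemma pgl_cases: obtains A where "invertible A" "g = pgl A"
proof -
  have "pgl_rel (rep_pgl g) (rep_pgl g)"
    by (rule Quotient3_rep_reflp[OF Quotient3_pgl])
  moreover have "g = pgl (rep_pgl g)"
    by (simp add: Quotient3_abs_rep[OF Quotient3_pgl])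
  ultimately show ?thesis
    using that by (auto simp: pgl_rel_def)
qed

lemma group_PGL: "group (PGL :: ('n::finite) pgl monoid)"
proof (rule groupI)
  fix x y z :: "'n pgl"
  show "x \<otimes>\<^bsub>PGL\<^esub> y \<otimes>\<^bsub>PGL\<^esub> z = x \<otimes>\<^bsub>PGL\<^esub> (y \<otimes>\<^bsub>PGL\<^esub> z)"
    unfolding PGL_def by (simp, transfer)
      (auto simp: pgl_rel_def matrix_mul_assoc invertible_mult intro!: exI[of _ "1::real"])
  show "\<one>\<^bsub>PGL\<^esub> \<otimes>\<^bsub>PGL\<^esub> x = x"
    unfolding PGL_def by (simp, transfer) auto
  obtain A where A: "invertible A" "x = pgl A" by (rule pgl_cases)
  then obtain B where B: "B ** A = mat 1" "A ** B = mat 1"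
    by (auto simp: invertible_def)
  then have "invertible B" by (auto simp: invertible_def)
  then have "pgl_rel A A" "pgl_rel B B"
    using A by (auto simp: pgl_rel_def intro!: exI[of _ "1::real"])
  then have "pgl_mult (pgl B) x = pgl_one"
    by (simp add: A(2) pgl_mult.abs_eq B pgl_one.abs_eq)
  then show "\<exists>y\<in>carrier PGL. y \<otimes>\<^bsub>PGL\<^esub> x = \<one>\<^bsub>PGL\<^esub>"
    by (auto simp: PGL_def)
qed (auto simp: PGL_def)

definition projset :: "(real^'n) set \<Rightarrow> ('n::finite) projective set" where
  "projset W = proj ` (W - {0})"

definition projective_subspace :: "('n::finite) projective set \<Rightarrow> bool" where
  "projective_subspace S \<longleftrightarrow> (\<exists>W. subspace W \<and> S = projset W)"

definition projective_hyperplane :: "('n::finite) projective set \<Rightarrow> bool" where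
  "projective_hyperplane H \<longleftrightarrow> (\<exists>W. subspace W \<and> dim W + 1 = CARD('n) \<and> H = projset W)"

definition proj_line :: "('n::finite) projective \<Rightarrow> 'n projective \<Rightarrow> 'n projective set" where
  "proj_line x y = projset (span {rep_proj x, rep_proj y})"


section \<open>Convexity in projective space\<close>

text \<open>The affine chart given by a linear form \<open>w \<bullet> _\<close> is identified with its level set \<open>w \<bullet> v = 1\<close>.\<close>

definition properly_convex :: "('n::finite) projective set \<Rightarrow> bool" where
  "properly_convex \<Omega> \<longleftrightarrow> (\<exists>w. w \<noteq> 0 \<and> (\<forall>v. v \<noteq> 0 \<and> proj v \<in> \<Omega> \<longrightarrow> w \<bullet> v \<noteq> 0) \<and>
     convex {v. w \<bullet> v = 1 \<and> proj v \<in> \<Omega>} \<and> bounded {v. w \<bullet> v = 1 \<and> proj v \<in> \<Omega>})"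

definition Aut :: "('n::finite) projective set \<Rightarrow> 'n pgl set" where
  "Aut \<Omega> = {g. pgl_act g ` \<Omega> = \<Omega>}"

definition Geod :: "('n::finite) projective set \<Rightarrow> ('n projective \<times> 'n projective) set" where
  "Geod \<Omega> = {(x, y). x \<in> frontier \<Omega> \<and> y \<in> frontier \<Omega> \<and> x \<noteq> y \<and> proj_line x y \<inter> \<Omega> \<noteq> {}}"

definition supporting_hyperplane ::
    "('n::finite) projective set \<Rightarrow> 'n projective \<Rightarrow> 'n projective set \<Rightarrow> bool" where
  "supporting_hyperplane \<Omega> \<xi> H \<longleftrightarrow> projective_hyperplane H \<and> \<xi> \<in> H \<and> H \<inter> \<Omega> = {}"

definition smooth_point :: "('n::finite) projective set \<Rightarrow> 'n projective \<Rightarrow> bool" where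
  "smooth_point \<Omega> \<xi> \<longleftrightarrow> \<xi> \<in> frontier \<Omega> \<and> (\<exists>!H. supporting_hyperplane \<Omega> \<xi> H)"

text \<open>
  One of the two closed segments joining \<open>proj p\<close> and \<open>proj q\<close>; the other one is
  \<open>proj_segment p (- q)\<close>. It is non-trivial if its endpoints are distinct.
\<close>

definition proj_segment :: "real^'n \<Rightarrow> real^'n \<Rightarrow> ('n::finite) projective set" where
  "proj_segment p q = proj ` closed_segment p q"

definition strongly_extremal :: "('n::finite) projective set \<Rightarrow> 'n projective \<Rightarrow> bool" where
  "strongly_extremal \<Omega> \<xi> \<longleftrightarrow> \<xi> \<in> frontier \<Omega> \<and>
     \<not> (\<exists>p q. p \<noteq> 0 \<and> q \<noteq> 0 \<and> proj p \<noteq> proj q \<and>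
          \<xi> \<in> proj_segment p q \<and> proj_segment p q \<subseteq> frontier \<Omega>)"


section \<open>Hilbert metric and geodesic flow\<close>

text \<open>
  The cross-ratio \<open>[a, x, y, b]\<close> is the coordinate of \<open>y\<close> in the projective coordinate on the line
  for which \<open>a\<close>, \<open>x\<close>, \<open>b\<close> are \<open>0\<close>, \<open>1\<close>, \<open>\<infinity>\<close>.
\<close>

definition cross_ratio ::
    "('n::finite) projective \<Rightarrow> 'n projective \<Rightarrow> 'n projective \<Rightarrow> 'n projective \<Rightarrow> real" where
  "cross_ratio a x y b = (THE t. \<exists>p q. p \<noteq> 0 \<and> q \<noteq> 0 \<and> proj p \<noteq> proj q \<and>
     a = proj p \<and> x = proj (p + q) \<and> y = proj (p + t *\<^sub>R q) \<and> b = proj q)"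

definition aligned_in_order ::
    "('n::finite) projective \<Rightarrow> 'n projective \<Rightarrow> 'n projective \<Rightarrow> 'n projective \<Rightarrow> bool" where
  "aligned_in_order a x y b \<longleftrightarrow> (\<exists>p q s t. p \<noteq> 0 \<and> q \<noteq> 0 \<and> proj p \<noteq> proj q \<and> 0 < s \<and> s \<le> t \<and>
     a = proj p \<and> x = proj (p + s *\<^sub>R q) \<and> y = proj (p + t *\<^sub>R q) \<and> b = proj q)"

definition hilbert_dist ::
    "('n::finite) projective set \<Rightarrow> 'n projective \<Rightarrow> 'n projective \<Rightarrow> real" where
  "hilbert_dist \<Omega> x y = (if x = y then 0 else
     (THE r. \<exists>a\<in>frontier \<Omega>. \<exists>b\<in>frontier \<Omega>.
        aligned_in_order a x y b \<and> r = ln (cross_ratio a x y b) / 2))"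

text \<open>The Finsler metric inducing \<open>hilbert_dist\<close>, evaluated on a tangent vector.\<close>

definition finsler_norm :: "('n::finite) projective set \<Rightarrow> 'n ptangent \<Rightarrow> real" where
  "finsler_norm \<Omega> v = (THE r. \<exists>p u. p \<noteq> 0 \<and> v = tvec (p, u) \<and>
     ((\<lambda>t. hilbert_dist \<Omega> (proj p) (proj (p + t *\<^sub>R u)) / t) \<longlongrightarrow> r) (at_right 0))"

definition T1 :: "('n::finite) projective set \<Rightarrow> 'n ptangent set" where
  "T1 \<Omega> = {v. tbase v \<in> \<Omega> \<and> finsler_norm \<Omega> v = 1}"

text \<open>
  \<open>w\<close> is the velocity \<open>c'(t)\<close>. The lift \<open>\<gamma>\<close> only needs to be differentiable at \<open>t\<close>, so asking for
  a lift defined on all of \<open>\<real>\<close> is no restriction.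
\<close>

definition has_velocity ::
    "(real \<Rightarrow> ('n::finite) projective) \<Rightarrow> real \<Rightarrow> 'n ptangent \<Rightarrow> bool" where
  "has_velocity c t w \<longleftrightarrow> (\<exists>\<gamma> u. (\<forall>s. \<gamma> s \<noteq> 0 \<and> c s = proj (\<gamma> s)) \<and>
     (\<gamma> has_vector_derivative u) (at t) \<and> w = tvec (\<gamma> t, u))"

text \<open>\<open>c\<close> is the isometric parametrisation of the geodesic of \<open>\<Omega>\<close> generated by \<open>v\<close>.\<close>

definition geodesic_param ::
    "('n::finite) projective set \<Rightarrow> 'n ptangent \<Rightarrow> (real \<Rightarrow> 'n projective) \<Rightarrow> bool" where
  "geodesic_param \<Omega> v c \<longleftrightarrow> range c = projset (tplane v) \<inter> \<Omega> \<and>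
     (\<forall>s t. hilbert_dist \<Omega> (c s) (c t) = \<bar>s - t\<bar>) \<and> has_velocity c 0 v"

definition flow :: "('n::finite) projective set \<Rightarrow> real \<Rightarrow> 'n ptangent \<Rightarrow> 'n ptangent" where
  "flow \<Omega> t v = (THE w. \<exists>c. geodesic_param \<Omega> v c \<and> has_velocity c t w)"

definition flow_orbit :: "('n::finite) projective set \<Rightarrow> 'n ptangent \<Rightarrow> 'n ptangent set" where
  "flow_orbit \<Omega> v = range (\<lambda>t. flow \<Omega> t v)"

definition forward_end :: "('n::finite) projective set \<Rightarrow> 'n ptangent \<Rightarrow> 'n projective" where
  "forward_end \<Omega> v = Lim at_top (\<lambda>t. tbase (flow \<Omega> t v))"

definition backward_end :: "('n::finite) projective set \<Rightarrow> 'n ptangent \<Rightarrow> 'n projective" where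
  "backward_end \<Omega> v = Lim at_bot (\<lambda>t. tbase (flow \<Omega> t v))"


section \<open>Proximality, discrete groups and their limit sets\<close>

definition charpoly :: "complex^'n^'n \<Rightarrow> complex poly" where
  "charpoly A = det (\<chi> i j. [: - A $ i $ j, if i = j then 1 else 0 :])"

definition dominant_eigenvalue :: "real^'n^'n \<Rightarrow> complex \<Rightarrow> bool" where
  "dominant_eigenvalue A z \<longleftrightarrow> (let P = charpoly (\<chi> i j. complex_of_real (A $ i $ j)) in
     Polynomial.order z P = 1 \<and> (\<forall>y. poly P y = 0 \<and> y \<noteq> z \<longrightarrow> cmod y < cmod z))"

definition proximal :: "('n::finite) pgl \<Rightarrow> bool" where
  "proximal g \<longleftrightarrow> (\<exists>A z. invertible A \<and> g = pgl A \<and> dominant_eigenvalue A z)"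

text \<open>The dominant eigenvalue is real, since its conjugate is an eigenvalue of the same modulus.\<close>

definition attracting_fixed_point :: "('n::finite) pgl \<Rightarrow> 'n projective" where
  "attracting_fixed_point g = (THE x. \<exists>A r v. invertible A \<and> g = pgl A \<and>
     dominant_eigenvalue A (complex_of_real r) \<and> v \<noteq> 0 \<and> A *v v = r *\<^sub>R v \<and> x = proj v)"

definition biproximal :: "('n::finite) pgl \<Rightarrow> bool" where
  "biproximal g \<longleftrightarrow> proximal g \<and> proximal (inv\<^bsub>PGL\<^esub> g)"

definition limit_set :: "('n::finite) pgl set \<Rightarrow> 'n projective set" where
  "limit_set \<Gamma> = closure {attracting_fixed_point g | g. g \<in> \<Gamma> \<and> proximal g}"

definition discrete_aut_group :: "('n::finite) projective set \<Rightarrow> 'n pgl set \<Rightarrow> bool" where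
  "discrete_aut_group \<Omega> \<Gamma> \<longleftrightarrow> subgroup \<Gamma> PGL \<and> \<Gamma> \<subseteq> Aut \<Omega> \<and> discrete \<Gamma>"

text \<open>The empty union and the empty subspace, which every group preserves, have to be excluded.\<close>

definition strongly_irreducible :: "('n::finite) pgl set \<Rightarrow> bool" where
  "strongly_irreducible \<Gamma> \<longleftrightarrow> \<not> (\<exists>F. finite F \<and> F \<noteq> {} \<and>
     (\<forall>S\<in>F. projective_subspace S \<and> S \<noteq> {} \<and> S \<noteq> UNIV) \<and>
     (\<forall>g\<in>\<Gamma>. pgl_act g ` \<Union>F = \<Union>F))"


section \<open>The quotient \<open>T\<^sup>1M\<close> and rank-one vectors\<close>

text \<open>
  A point of \<open>T\<^sup>1M = T\<^sup>1\<Omega>/\<Gamma>\<close> is a \<open>\<Gamma>\<close>-orbit in \<open>T1 \<Omega>\<close>; its elements are its lifts. The geodesic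
  flow of \<open>T\<^sup>1M\<close> maps an orbit \<open>X\<close> to \<open>flow \<Omega> t ` X\<close>.
\<close>

definition orbit :: "('n::finite) pgl set \<Rightarrow> 'n ptangent \<Rightarrow> 'n ptangent set" where
  "orbit \<Gamma> v = (\<lambda>g. pgl_tact g v) ` \<Gamma>"

definition T1M :: "('n::finite) projective set \<Rightarrow> 'n pgl set \<Rightarrow> 'n ptangent set set" where
  "T1M \<Omega> \<Gamma> = orbit \<Gamma> ` T1 \<Omega>"

definition T1M_topology ::
    "('n::finite) projective set \<Rightarrow> 'n pgl set \<Rightarrow> 'n ptangent set topology" where
  "T1M_topology \<Omega> \<Gamma> = topology (\<lambda>W. W \<subseteq> T1M \<Omega> \<Gamma> \<and>
     openin (top_of_set (T1 \<Omega>)) {v \<in> T1 \<Omega>. orbit \<Gamma> v \<in> W})"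

lemma openin_T1M_topology:
  "openin (T1M_topology \<Omega> \<Gamma>) W \<longleftrightarrow> W \<subseteq> T1M \<Omega> \<Gamma> \<and>
     openin (top_of_set (T1 \<Omega>)) {v \<in> T1 \<Omega>. orbit \<Gamma> v \<in> W}"
proof -
  have "istopology (\<lambda>W. W \<subseteq> T1M \<Omega> \<Gamma> \<and>
     openin (top_of_set (T1 \<Omega>)) {v \<in> T1 \<Omega>. orbit \<Gamma> v \<in> W})"
    unfolding istopology_def
  proof (intro conjI allI impI)
    fix S T
    assume S: "S \<subseteq> T1M \<Omega> \<Gamma> \<and> openin (top_of_set (T1 \<Omega>)) {v \<in> T1 \<Omega>. orbit \<Gamma> v \<in> S}"
      and T: "T \<subseteq> T1M \<Omega> \<Gamma> \<and> openin (top_of_set (T1 \<Omega>)) {v \<in> T1 \<Omega>. orbit \<Gamma> v \<in> T}"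
    then show "S \<inter> T \<subseteq> T1M \<Omega> \<Gamma>" by blast
    have "{v \<in> T1 \<Omega>. orbit \<Gamma> v \<in> S \<inter> T} = {v \<in> T1 \<Omega>. orbit \<Gamma> v \<in> S} \<inter> {v \<in> T1 \<Omega>. orbit \<Gamma> v \<in> T}"
      by blast
    with S T show "openin (top_of_set (T1 \<Omega>)) {v \<in> T1 \<Omega>. orbit \<Gamma> v \<in> S \<inter> T}"
      by (simp add: openin_Int)
  next
    fix K
    assume K: "\<forall>S\<in>K. S \<subseteq> T1M \<Omega> \<Gamma> \<and> openin (top_of_set (T1 \<Omega>)) {v \<in> T1 \<Omega>. orbit \<Gamma> v \<in> S}"
    then show "\<Union>K \<subseteq> T1M \<Omega> \<Gamma>" by blast
    have "{v \<in> T1 \<Omega>. orbit \<Gamma> v \<in> \<Union>K} = (\<Union>S\<in>K. {v \<in> T1 \<Omega>. orbit \<Gamma> v \<in> S})" by blast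
    with K show "openin (top_of_set (T1 \<Omega>)) {v \<in> T1 \<Omega>. orbit \<Gamma> v \<in> \<Union>K}"
      by (auto intro!: openin_Union)
  qed
  then show ?thesis
    unfolding T1M_topology_def by (simp add: topology_inverse')
qed

lemma quotient_map_T1M: "quotient_map (top_of_set (T1 \<Omega>)) (T1M_topology \<Omega> \<Gamma>) (orbit \<Gamma>)"
proof -
  have "openin (T1M_topology \<Omega> \<Gamma>) (T1M \<Omega> \<Gamma>)"
    by (auto simp: openin_T1M_topology T1M_def intro!: openin_subtopology_self[THEN back_subst[of "openin _"]])
  then have "topspace (T1M_topology \<Omega> \<Gamma>) = T1M \<Omega> \<Gamma>"
    by (metis openin_T1M_topology openin_subset openin_topspace subset_antisym)
  then show ?thesis
    by (auto simp: quotient_map_def openin_T1M_topology T1M_def)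
qed

definition T1M_bip :: "('n::finite) projective set \<Rightarrow> 'n pgl set \<Rightarrow> 'n ptangent set set" where
  "T1M_bip \<Omega> \<Gamma> = orbit \<Gamma> `
     {v \<in> T1 \<Omega>. forward_end \<Omega> v \<in> limit_set \<Gamma> \<and> backward_end \<Omega> v \<in> limit_set \<Gamma>}"

definition periodic_vector ::
    "('n::finite) projective set \<Rightarrow> 'n pgl set \<Rightarrow> 'n ptangent set \<Rightarrow> bool" where
  "periodic_vector \<Omega> \<Gamma> X \<longleftrightarrow> X \<in> T1M \<Omega> \<Gamma> \<and> (\<exists>t>0. flow \<Omega> t ` X = X)"

definition rank_one_periodic_vector ::
    "('n::finite) projective set \<Rightarrow> 'n pgl set \<Rightarrow> 'n ptangent set \<Rightarrow> bool" where
  "rank_one_periodic_vector \<Omega> \<Gamma> X \<longleftrightarrow> periodic_vector \<Omega> \<Gamma> X \<and>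
     (\<forall>v\<in>X. smooth_point \<Omega> (forward_end \<Omega> v) \<and> strongly_extremal \<Omega> (forward_end \<Omega> v) \<and>
            smooth_point \<Omega> (backward_end \<Omega> v) \<and> strongly_extremal \<Omega> (backward_end \<Omega> v))"

definition rank_one_manifold :: "('n::finite) projective set \<Rightarrow> 'n pgl set \<Rightarrow> bool" where
  "rank_one_manifold \<Omega> \<Gamma> \<longleftrightarrow> (\<exists>X. rank_one_periodic_vector \<Omega> \<Gamma> X)"

definition rank_one_element ::
    "('n::finite) projective set \<Rightarrow> 'n pgl set \<Rightarrow> 'n pgl \<Rightarrow> bool" where
  "rank_one_element \<Omega> \<Gamma> g \<longleftrightarrow> discrete_aut_group \<Omega> \<Gamma> \<and> g \<in> \<Gamma> \<and>
     (\<forall>n::nat. n > 0 \<longrightarrow> g [^]\<^bsub>PGL\<^esub> n \<noteq> \<one>\<^bsub>PGL\<^esub>) \<and>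
     (\<exists>v\<in>T1 \<Omega>. rank_one_periodic_vector \<Omega> \<Gamma> (orbit \<Gamma> v) \<and>
        pgl_tact g ` flow_orbit \<Omega> v = flow_orbit \<Omega> v)"

end

theory Submission
  imports Defs "HOL-Computational_Algebra.Fundamental_Theorem_Algebra"
begin

text \<open>
  Lift the domain to an open convex cone \<open>C\<close> whose closure \<open>K\<close> contains no line. A unit tangent
  vector is then a pair \<open>(a, b)\<close> of points of \<open>K - C\<close> with \<open>a + b \<in> C\<close>, up to a common factor, and
  the geodesic flow replaces \<open>(a, b)\<close> by \<open>(exp (- t) a, exp t b)\<close>. Proximality of \<open>A\<close> means that
  \<open>A\<^sup>n / r\<^sup>n\<close> converges to a projection \<open>x \<otimes> e\<close> of rank one.

  Let \<open>x\<close>, \<open>y\<close> be the attracting points of an automorphism \<open>A\<close> and of its inverse, \<open>x + y \<in> C\<close>, and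
  let \<open>V\<^sub>0\<close> be the invariant complement of the plane they span. A second supporting functional at
  \<open>x\<close>, transported by \<open>A\<^sup>n\<close> and renormalised, would converge to a nonzero functional that is
  nonnegative on \<open>K\<close> and vanishes at the interior point \<open>x + y\<close>; so \<open>x\<close> is smooth. In the same way
  \<open>x\<close> is strongly extremal as soon as \<open>V\<^sub>0 \<inter> K = 0\<close>. A nonzero \<open>v\<close> in that intersection satisfies
  \<open>x + t v \<notin> C\<close> and \<open>y + t v \<notin> C\<close> for all \<open>t \<ge> 0\<close>, which by compactness is impossible for \<open>(x, y)\<close>
  close to a geodesic pair whose first point is strongly extremal. This is part (1).

  For part (2) let \<open>g\<close> be rank-one with fixed points \<open>b\<^sub>0\<close>, \<open>a\<^sub>0\<close>. By strong irreducibility the endpoints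
  of a vector of \<open>T\<^sup>1M\<^sub>b\<^sub>i\<^sub>p\<close> are approximated by \<open>h\<^sub>1 b\<^sub>0\<close> and \<open>h\<^sub>2 a\<^sub>0\<close>, and for a suitable
  \<open>f\<close> the elements \<open>h\<^sub>1 g\<^sup>n h\<^sub>1\<^sup>-\<^sup>1 f h\<^sub>2 g\<^sup>n h\<^sub>2\<^sup>-\<^sup>1\<close> and their inverses converge, up to scaling,
  to matrices of rank one with images \<open>h\<^sub>1 b\<^sub>0\<close> and \<open>h\<^sub>2 a\<^sub>0\<close>. For large \<open>n\<close> they are biproximal with
  fixed points close to these, hence rank-one by part (1).
\<close>

subsection \<open>Powers of matrices and spectral radius\<close>

text \<open>Two asymmetries shape the argument. In part (1) only one endpoint is assumed strongly
  extremal, yet both fixed points have to be; the criterion \<open>V\<^sub>0 \<inter> K = 0\<close>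
  is symmetric in the two points, which is why the proof goes through it. In part (2) strong
  irreducibility yields an \<open>f\<close> for one nonvanishing condition, while the product and
  its inverse require four. Two of them hold because \<open>h\<^sub>1 b\<^sub>0\<close> and
  \<open>h\<^sub>2 a\<^sub>0\<close> are distinct points, and the last one follows from the first: a
  vector of \<open>K\<close> killed by a functional that supports \<open>K\<close> at an extremal
  point is a multiple of that point.

  Proximality, defined by the complex characteristic polynomial, is translated once in both
  directions into convergence of powers. This form survives perturbation: a matrix near a projection
  of rank one and its transpose both have eigenvectors by Brouwer's theorem, and the second provides
  the invariant complement. A rank-one periodic vector, in turn, is known only through the flow, so
  the proximality of the element that translates its geodesic has to be derived from the regularity
  of the endpoints.\<close>

primrec mpow :: "'a::semiring_1^'n^'n \<Rightarrow> nat \<Rightarrow> 'a^'n^'n" where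
  "mpow A 0 = mat 1"
| "mpow A (Suc n) = A ** mpow A n"

lemma mpow_Suc_vec: "mpow A (Suc n) *v v = A *v (mpow A n *v v)"
  by (simp add: matrix_vector_mul_assoc)

lemma mpow_vec_shift: "mpow A n *v (A *v v) = A *v (mpow A n *v v)"
proof (induction n)
  case (Suc n)
  have "mpow A (Suc n) *v (A *v v) = A *v (mpow A n *v (A *v v))"
    by (simp only: mpow_Suc_vec)
  then show ?case
    using Suc by (simp only: mpow_Suc_vec)
qed simp

text \<open>Once \<open>d\<close> is small, the recurrence contracts towards a fixed point as small
  as desired, and the excess over it decays like \<open>q ^ m\<close>.\<close>

lemma tendsto_zero_contraction_recurrence:
  fixes a d :: "nat \<Rightarrow> real"
  assumes a: "\<And>n. 0 \<le> a n" and q: "0 \<le> q" "q < 1"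
    and rec: "\<And>n. a (Suc n) \<le> q * a n + d n" and d: "d \<longlonglongrightarrow> 0"
  shows "a \<longlonglongrightarrow> 0"
proof (rule LIMSEQ_I)
  fix e :: real assume e: "e > 0"
  \<comment> \<open>Chosen so that \<open>e / 2\<close> is the fixed point of
    \<open>t \<mapsto> q * t + h\<close>.\<close>
  define h where "h = (1 - q) * (e / 2)"
  have h: "h > 0" using e q by (simp add: h_def)
  obtain N where N: "\<And>n. n \<ge> N \<Longrightarrow> \<bar>d n\<bar> < h"
    using LIMSEQ_D[OF d h] by auto
  have step: "a (N + m) \<le> q ^ m * a N + e / 2" for m
  proof (induction m)
    case 0 then show ?case using e by simp
  next
    case (Suc m)
    have "a (N + Suc m) \<le> q * a (N + m) + h"
      using rec[of "N + m"] N[of "N + m"] by auto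
    also have "\<dots> \<le> q * (q ^ m * a N + e / 2) + h"
      using Suc q by (simp add: mult_left_mono)
    also have "\<dots> = q ^ Suc m * a N + e / 2" by (simp add: h_def field_simps)
    finally show ?case .
  qed
  have "(\<lambda>m. q ^ m * a N) \<longlonglongrightarrow> 0"
    using tendsto_mult_right[OF LIMSEQ_realpow_zero[OF q], of "a N"] by simp
  then obtain K where K: "\<And>m. m \<ge> K \<Longrightarrow> \<bar>q ^ m * a N\<bar> < e / 2"
    using LIMSEQ_D[of _ 0 "e/2"] e by fastforce
  have "norm (a n - 0) < e" if "n \<ge> N + K" for n
  proof -
    have K': "K \<le> n - N" and nN: "N + (n - N) = n" using that by auto
    have "a n \<le> q ^ (n - N) * a N + e / 2" using step[of "n - N"] unfolding nN .
    then have "a n < e" using K[OF K'] abs_ge_self[of "q ^ (n - N) * a N"] by linarith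
    then show ?thesis using a[of n] by simp
  qed
  then show "\<exists>n0. \<forall>n\<ge>n0. norm (a n - 0) < e" by blast
qed

section \<open>Annihilating polynomials of a vector, and eigenvalues\<close>

definition poly_vec :: "'a::field^'n^'n \<Rightarrow> 'a^'n \<Rightarrow> 'a poly \<Rightarrow> 'a^'n" where
  "poly_vec B v p = fold_coeffs (\<lambda>a w. a *s v + B *v w) p 0"

lemma poly_vec_0 [simp]: "poly_vec B v 0 = 0"
  by (simp add: poly_vec_def)

lemma poly_vec_pCons [simp]: "poly_vec B v (pCons a p) = a *s v + B *v poly_vec B v p"
  by (cases "p = 0 \<and> a = 0") (auto simp: poly_vec_def)

lemma poly_vec_add: "poly_vec B v (p + q) = poly_vec B v p + poly_vec B v q"
proof (induction p arbitrary: q)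
  case (pCons a p)
  then show ?case
    by (cases q) (simp add: matrix_vector_right_distrib vector_sadd_rdistrib algebra_simps)
qed simp

lemma poly_vec_smult: "poly_vec B v (smult c p) = c *s poly_vec B v p"
  by (induction p) (simp_all add: vector_add_ldistrib vector_scalar_commute)

lemma poly_vec_monom: "poly_vec B v (monom 1 n) = mpow B n *v v"
  by (induction n) (simp_all add: monom_0 monom_Suc mpow_Suc_vec del: mpow.simps(2))

lemma poly_vec_linear_factor:
  "poly_vec B v ([:-z, 1:] * q) = B *v poly_vec B v q - z *s poly_vec B v q"
proof -
  have "[:-z, 1:] * q = smult (-z) q + pCons 0 q" by simp
  then show ?thesis
    by (simp only: poly_vec_add poly_vec_smult poly_vec_pCons) (simp add: vec_eq_iff)
qed

text \<open>In finite dimension the vectors \<open>B^i v\<close> cannot all be independent of their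
  predecessors; the first dependence, read as a polynomial, kills \<open>v\<close>.\<close>

lemma exists_annihilating_poly:
  fixes B :: "'a::field^'n^'n"
  shows "\<exists>p. p \<noteq> 0 \<and> poly_vec B v p = 0"
proof -
  define S where "S n = (\<lambda>i. mpow B i *v v) ` {..<n}" for n
  have "\<exists>n. mpow B n *v v \<in> vec.span (S n)"
  proof (rule ccontr)
    assume "\<not> ?thesis"
    then have no: "mpow B n *v v \<notin> vec.span (S n)" for n by blast
    have SS: "S (Suc n) = insert (mpow B n *v v) (S n)" for n
      by (auto simp: S_def lessThan_Suc)
    have "vec.independent (S n) \<and> card (S n) = n" for n
    proof (induction n)
      case 0 then show ?case by (simp add: S_def vec.independent_empty)
    next
      case (Suc n)
      have "mpow B n *v v \<notin> S n" using no vec.span_base by blast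
      moreover have "finite (S n)" by (simp add: S_def)
      ultimately show ?case
        using Suc no[of n] by (simp add: SS vec.independent_insertI)
    qed
    then have "card (S (Suc CARD('n))) \<le> vec.dim (UNIV :: ('a^'n) set)"
      by (intro vec.independent_card_le_dim) auto
    with \<open>\<And>n. vec.independent (S n) \<and> card (S n) = n\<close> show False
      by (metis Suc_n_not_le_n vec_dim_card)
  qed
  then obtain n where n: "mpow B n *v v \<in> vec.span (S n)" by blast
  \<comment> \<open>The vectors \<open>q(B) v\<close> with \<open>q\<close> of degree below
    \<open>n\<close>, expressed by coefficients so that \<open>n = 0\<close> correctly leaves only
    \<open>q = 0\<close>.\<close>
  define W where "W = {poly_vec B v q | q. \<forall>i\<ge>n. coeff q i = 0}"
  have "vec.subspace W"
  proof (rule vec.subspaceI)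
    show "0 \<in> W" unfolding W_def by (intro CollectI exI[of _ 0]) simp
    show "x + y \<in> W" if "x \<in> W" "y \<in> W" for x y
    proof -
      obtain p q where "x = poly_vec B v p" "y = poly_vec B v q"
        "\<forall>i\<ge>n. coeff p i = 0" "\<forall>i\<ge>n. coeff q i = 0"
        using \<open>x \<in> W\<close> \<open>y \<in> W\<close> unfolding W_def by blast
      then show ?thesis unfolding W_def
        by (auto simp: poly_vec_add intro!: exI[of _ "p + q"])
    qed
    show "c *s x \<in> W" if "x \<in> W" for c x
    proof -
      obtain p where "x = poly_vec B v p" "\<forall>i\<ge>n. coeff p i = 0"
        using \<open>x \<in> W\<close> unfolding W_def by blast
      then show ?thesis unfolding W_def
        by (auto simp: poly_vec_smult intro!: exI[of _ "smult c p"])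
    qed
  qed
  moreover have "S n \<subseteq> W"
  proof
    fix x assume "x \<in> S n"
    then obtain i where "i < n" "x = mpow B i *v v" by (auto simp: S_def)
    then show "x \<in> W"
      unfolding W_def by (auto simp: poly_vec_monom intro!: exI[of _ "monom 1 i"])
  qed
  ultimately have "vec.span (S n) \<subseteq> W" by (simp add: vec.span_minimal)
  then obtain q where q: "mpow B n *v v = poly_vec B v q" "\<forall>i\<ge>n. coeff q i = 0"
    using n unfolding W_def by blast
  define p where "p = monom 1 n + smult (-1) q"
  have "poly_vec B v p = 0"
    unfolding p_def poly_vec_add poly_vec_smult poly_vec_monom q(1) by (simp add: vec_eq_iff)
  moreover have "coeff p n \<noteq> 0" using q(2) by (simp add: p_def)
  ultimately have "p \<noteq> 0 \<and> poly_vec B v p = 0" by auto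
  then show ?thesis by blast
qed

text \<open>Take an annihilating polynomial of least degree. Splitting off a factor
  \<open>X - z\<close> leaves a cofactor that no longer kills \<open>v\<close>, and its value at
  \<open>v\<close> is an eigenvector for \<open>z\<close>.\<close>

lemma exists_annihilating_poly_eigenvalue_roots:
  fixes B :: "'a::field^'n^'n"
  shows "\<exists>p. p \<noteq> 0 \<and> poly_vec B v p = 0 \<and>
    (\<forall>z. poly p z = 0 \<longrightarrow> (\<exists>w. w \<noteq> 0 \<and> B *v w = z *s w))"
proof -
  obtain p where p: "p \<noteq> 0 \<and> poly_vec B v p = 0"
    and least: "\<And>q. degree q < degree p \<Longrightarrow> \<not> (q \<noteq> 0 \<and> poly_vec B v q = 0)"
    using exists_annihilating_poly[of B v] ex_has_least_nat[of "\<lambda>p. p \<noteq> 0 \<and> poly_vec B v p = 0" _ degree]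
    by (metis leD)
  have "\<exists>w. w \<noteq> 0 \<and> B *v w = z *s w" if "poly p z = 0" for z
  proof -
    obtain q where q: "p = [:-z, 1:] * q" using \<open>poly p z = 0\<close> by (auto simp: poly_eq_0_iff_dvd)
    then have "q \<noteq> 0" using p by auto
    then have "degree q < degree p" unfolding q by (subst degree_mult_eq) auto
    then have "poly_vec B v q \<noteq> 0" using least \<open>q \<noteq> 0\<close> by blast
    moreover have "B *v poly_vec B v q = z *s poly_vec B v q"
      using p unfolding q poly_vec_linear_factor by simp
    ultimately show ?thesis by blast
  qed
  with p show ?thesis by blast
qed

lemma norm_scalar_mult_complex: "norm (c *s (v::complex^'n)) = cmod c * norm v"
  by (simp add: norm_vec_def norm_mult L2_set_right_distrib)

text \<open>
  The space of all \<open>v\<close> with \<open>B\<^sup>n v / \<rho>\<^sup>n \<rightarrow> 0\<close> contains \<open>v\<close> whenever it contains \<open>B v - z v\<close> for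
  some \<open>z\<close> of modulus below \<open>\<rho>\<close>; so the linear factors of an annihilating polynomial can be peeled off.
\<close>

theorem mpow_tendsto_zero:
  fixes B :: "complex^'n^'n"
  assumes rho: "rho > 0" and ev: "\<And>v z. v \<noteq> 0 \<Longrightarrow> B *v v = z *s v \<Longrightarrow> cmod z < rho"
  shows "(\<lambda>n. (1 / rho ^ n) *\<^sub>R (mpow B n *v v)) \<longlonglongrightarrow> 0"
proof -
  define b where "b n v = (1 / rho ^ n) *\<^sub>R (mpow B n *v v)" for n v
  define E where "E v \<longleftrightarrow> (\<lambda>n. b n v) \<longlonglongrightarrow> 0" for v
  have key: "E v" if E: "E (B *v v - z *s v)" and z: "cmod z < rho" for v z
  proof -
    \<comment> \<open>From \<open>rho * b (n+1) v = b n (B v - z v) + z * b n v\<close>: up to a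
      null sequence, each step contracts by \<open>cmod z / rho\<close>.\<close>
    have "norm (b (Suc n) v) \<le> (cmod z / rho) * norm (b n v) + norm (b n (B *v v - z *s v)) / rho" for n
    proof -
      have "rho *\<^sub>R b (Suc n) v = b n (B *v v - z *s v) + z *s b n v"
        using rho
        by (simp add: b_def matrix_vector_mult_diff_distrib mpow_vec_shift mpow_Suc_vec
            vector_scalar_commute del: mpow.simps)
          (simp add: vec_eq_iff algebra_simps)
      then have "norm (rho *\<^sub>R b (Suc n) v) \<le> norm (b n (B *v v - z *s v)) + cmod z * norm (b n v)"
        by (metis norm_triangle_ineq norm_scalar_mult_complex)
      then show ?thesis using rho by (simp add: field_simps)
    qed
    then have "(\<lambda>n. norm (b n v)) \<longlonglongrightarrow> 0"
    proof (rule tendsto_zero_contraction_recurrence[rotated 3])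
      show "(\<lambda>n. norm (b n (B *v v - z *s v)) / rho) \<longlonglongrightarrow> 0"
        using tendsto_divide[OF tendsto_norm[OF E[unfolded E_def]] tendsto_const[of rho]] rho by simp
    qed (use rho z in auto)
    then show ?thesis unfolding E_def by (rule tendsto_norm_zero_cancel)
  qed
  obtain p where "p \<noteq> 0" and pv: "poly_vec B v p = 0"
    and roots: "\<forall>z. poly p z = 0 \<longrightarrow> (\<exists>w. w \<noteq> 0 \<and> B *v w = z *s w)"
    using exists_annihilating_poly_eigenvalue_roots[of B v] by blast
  have "\<forall>z. poly p z = 0 \<longrightarrow> cmod z < rho" using roots ev by blast
  moreover have "E (poly_vec B v p)"
    unfolding pv E_def b_def by simp
  ultimately have "E v"
    using \<open>p \<noteq> 0\<close>
  proof (induction "degree p" arbitrary: p)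
    case 0
    then obtain c where c: "p = [:c:]" "c \<noteq> 0" by (metis degree_eq_zeroE pCons_eq_0_iff)
    then have "E (c *s v)" using 0 by simp
    then have "(\<lambda>n. (1/c) *s b n (c *s v)) \<longlonglongrightarrow> 0"
      unfolding E_def by (auto intro!: vec_tendstoI tendsto_mult_right_zero[of "\<lambda>n. b n (c *s v) $ i" _ "1/c" for i, simplified] dest: tendsto_vec_nth)
    moreover have "(1/c) *s b n (c *s v) = b n v" for n
      using c(2) by (simp add: b_def vector_scalar_commute vec_eq_iff)
    ultimately show ?case by (simp add: E_def)
  next
    case (Suc m)
    then have "\<not> constant (poly p)" by (simp add: constant_degree)
    then obtain z where z: "poly p z = 0" using fundamental_theorem_of_algebra by blast
    then obtain q where q: "p = [:-z, 1:] * q" by (auto simp: poly_eq_0_iff_dvd)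
    then have "q \<noteq> 0" using Suc by auto
    then have "m = degree q" using Suc(2) unfolding q by (subst (asm) degree_mult_eq) auto
    moreover have "E (poly_vec B v q)"
      using Suc.prems(2) key[of "poly_vec B v q" z] Suc.prems(1) z
      unfolding q poly_vec_linear_factor by blast
    ultimately show ?case
      using Suc.hyps(1)[of q] Suc.prems(1) \<open>q \<noteq> 0\<close> unfolding q by auto
  qed
  then show ?thesis by (simp add: E_def b_def)
qed


subsection \<open>Attracting fixed points\<close>

definition outer :: "real^'n \<Rightarrow> real^'n \<Rightarrow> real^'n^'n" where
  "outer x e = (\<chi> i j. x $ i * e $ j)"

lemma outer_mult_vec: "outer x e *v v = (e \<bullet> v) *\<^sub>R x"
  by (simp add: outer_def matrix_vector_mult_def vec_eq_iff inner_vec_def sum_distrib_left mult_ac)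

text \<open>
  \<open>A\<close> is proximal with dominant eigenvalue \<open>r\<close> and attracting point \<open>x\<close>; the kernel of \<open>e\<close> is the
  invariant complement of \<open>x\<close>.
\<close>

definition attracts :: "real^'n^'n \<Rightarrow> real \<Rightarrow> real^'n \<Rightarrow> real^'n \<Rightarrow> bool" where
  "attracts A r x e \<longleftrightarrow> r \<noteq> 0 \<and> e \<bullet> x = 1 \<and> (\<lambda>n. (1 / r ^ n) *\<^sub>R mpow A n) \<longlonglongrightarrow> outer x e"

lemma bounded_bilinear_matrix_vector_mult:
  "bounded_bilinear ((*v) :: real^'n^'m \<Rightarrow> real^'n \<Rightarrow> real^'m)"
  unfolding bilinear_conv_bounded_bilinear[symmetric] bilinear_def
  by (auto intro!: linearI simp: matrix_vector_mult_def vec_eq_iff algebra_simps sum.distrib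
      sum_distrib_left)

lemmas tendsto_matrix_vector_mult [tendsto_intros] =
  bounded_bilinear.tendsto[OF bounded_bilinear_matrix_vector_mult]

lemma scaleR_matrix_vector: "(c *\<^sub>R A) *v v = c *\<^sub>R (A *v (v :: real^'n))"
  by (simp add: scaleR_matrix_vector_assoc)

lemma tendsto_matrixI:
  fixes M :: "'a \<Rightarrow> real^'n^'m"
  assumes "\<And>v. ((\<lambda>n. M n *v v) \<longlongrightarrow> P *v v) F"
  shows "(M \<longlongrightarrow> P) F"
proof (intro vec_tendstoI)
  fix i j
  have "((\<lambda>n. (M n *v axis j 1) $ i) \<longlongrightarrow> (P *v axis j 1) $ i) F"
    by (intro tendsto_vec_nth assms)
  then show "((\<lambda>n. M n $ i $ j) \<longlongrightarrow> P $ i $ j) F"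
    by (simp add: matrix_vector_mul_component inner_axis)
qed

lemma attracts_tendsto:
  assumes "attracts A r x e"
  shows "(\<lambda>n. (1 / r ^ n) *\<^sub>R (mpow A n *v v)) \<longlonglongrightarrow> (e \<bullet> v) *\<^sub>R x"
proof -
  have "(\<lambda>n. (1 / r ^ n) *\<^sub>R mpow A n) \<longlonglongrightarrow> outer x e"
    using assms by (simp add: attracts_def)
  from tendsto_matrix_vector_mult[OF this tendsto_const[of v]] show ?thesis
    by (simp add: scaleR_matrix_vector outer_mult_vec)
qed

lemma attractsI:
  assumes "r \<noteq> 0" "e \<bullet> x = 1"
    "\<And>v. (\<lambda>n. (1 / r ^ n) *\<^sub>R (mpow A n *v v)) \<longlonglongrightarrow> (e \<bullet> v) *\<^sub>R x"
  shows "attracts A r x e"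
  unfolding attracts_def
  using assms by (auto intro!: tendsto_matrixI simp: scaleR_matrix_vector outer_mult_vec)

lemma attracts_nonzero: "attracts A r x e \<Longrightarrow> x \<noteq> 0"
  by (auto simp: attracts_def)

lemma mpow_eigenvector:
  fixes A :: "real^'n^'n"
  assumes "A *v x = r *\<^sub>R x"
  shows "mpow A n *v x = r ^ n *\<^sub>R x"
  using assms
  by (induction n) (simp_all add: mpow_Suc_vec matrix_vector_mult_scaleR mult.commute del: mpow.simps(2))

text \<open>The limit of \<open>A^(n+1) v / r^n\<close> can be computed in three ways: as
  \<open>r\<close> times the limit at \<open>v\<close>, as the image of that limit under
  \<open>A\<close>, and as the limit at \<open>A v\<close>.\<close>

lemma attracts_shift:
  assumes at: "attracts A r x e"
  shows "(e \<bullet> v) *\<^sub>R (A *v x) = (r * (e \<bullet> v)) *\<^sub>R x" "(e \<bullet> (A *v v)) = r * (e \<bullet> v)"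
proof -
  have r: "r \<noteq> 0" using at by (simp add: attracts_def)
  have "(\<lambda>n. (1 / r ^ Suc n) *\<^sub>R (mpow A (Suc n) *v v)) \<longlonglongrightarrow> (e \<bullet> v) *\<^sub>R x"
    by (rule LIMSEQ_Suc[OF attracts_tendsto[OF at]])
  from tendsto_scaleR[OF tendsto_const[of r] this]
  have 1: "(\<lambda>n. (1 / r ^ n) *\<^sub>R (A *v (mpow A n *v v))) \<longlonglongrightarrow> (r * (e \<bullet> v)) *\<^sub>R x"
    using r by (simp add: mpow_Suc_vec del: mpow.simps)
  have 2: "(\<lambda>n. (1 / r ^ n) *\<^sub>R (A *v (mpow A n *v v))) \<longlonglongrightarrow> (e \<bullet> v) *\<^sub>R (A *v x)"
    using tendsto_matrix_vector_mult[OF tendsto_const[of A] attracts_tendsto[OF at, of v]]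
    by (simp add: matrix_vector_mult_scaleR)
  show "(e \<bullet> v) *\<^sub>R (A *v x) = (r * (e \<bullet> v)) *\<^sub>R x"
    by (rule LIMSEQ_unique[OF 2 1])
  have "(\<lambda>n. (1 / r ^ n) *\<^sub>R (A *v (mpow A n *v v))) \<longlonglongrightarrow> (e \<bullet> (A *v v)) *\<^sub>R x"
    using attracts_tendsto[OF at, of "A *v v"] by (simp only: mpow_vec_shift)
  from LIMSEQ_unique[OF this 1] show "(e \<bullet> (A *v v)) = r * (e \<bullet> v)"
    using attracts_nonzero[OF at] by simp
qed

lemma attracts_eigenvector: "attracts A r x e \<Longrightarrow> A *v x = r *\<^sub>R x"
  using attracts_shift(1)[of A r x e x] by (simp add: attracts_def)

lemmas attracts_functional = attracts_shift(2)

lemma attracts_scale_vector: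
  assumes "attracts A r x e" "c \<noteq> 0"
  shows "attracts A r (c *\<^sub>R x) ((1 / c) *\<^sub>R e)"
proof -
  have "outer (c *\<^sub>R x) ((1 / c) *\<^sub>R e) = outer x e"
    using assms(2) by (simp add: outer_def vec_eq_iff)
  then show ?thesis using assms by (simp add: attracts_def)
qed

lemma mpow_scale: "mpow (c *\<^sub>R A) n = c ^ n *\<^sub>R mpow A n" for A :: "real^'n^'n"
  by (induction n)
    (simp_all add: matrix_matrix_mult_def vec_eq_iff sum_distrib_left mult_ac)

lemma attracts_scale_matrix:
  assumes "attracts A r x e" "c \<noteq> 0"
  shows "attracts (c *\<^sub>R A) (c * r) x e"
  using assms by (simp add: attracts_def mpow_scale power_mult_distrib)

lemma power_scale_tendsto_zero:
  fixes y :: "'a::real_normed_vector"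
  assumes "(\<lambda>n. (1 / r ^ n) *\<^sub>R (s ^ n *\<^sub>R y)) \<longlonglongrightarrow> 0" "y \<noteq> 0" "r \<noteq> 0"
  shows "\<bar>s\<bar> < \<bar>r\<bar>"
proof (rule ccontr)
  assume *: "\<not> \<bar>s\<bar> < \<bar>r\<bar>"
  have "norm y \<le> norm ((1 / r ^ n) *\<^sub>R (s ^ n *\<^sub>R y))" for n
    using power_mono[of "\<bar>r\<bar>" "\<bar>s\<bar>" n] * assms(3)
    by (auto simp: power_abs field_simps intro!: mult_left_mono)
  then have "norm y \<le> norm (0::'a)"
    by (intro LIMSEQ_le_const[OF tendsto_norm[OF assms(1)]]) auto
  then show False using assms(2) by simp
qed

text \<open>For \<open>r \<noteq> s\<close> each functional vanishes on the other eigenvector, and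
  then each eigenvalue would have strictly smaller modulus than the other.\<close>

lemma attracts_unique:
  assumes A: "attracts A r x e" and B: "attracts A s y f"
  shows "\<exists>k. k \<noteq> 0 \<and> y = k *\<^sub>R x"
proof -
  note Ax = attracts_eigenvector[OF A] and By = attracts_eigenvector[OF B]
  have x: "x \<noteq> 0" and y: "y \<noteq> 0" using A B attracts_nonzero by blast+
  have r: "r \<noteq> 0" and s: "s \<noteq> 0" using A B by (simp_all add: attracts_def)
  have 1: "(\<lambda>n. (1 / r ^ n) *\<^sub>R (s ^ n *\<^sub>R y)) \<longlonglongrightarrow> (e \<bullet> y) *\<^sub>R x"
    using attracts_tendsto[OF A, of y] by (simp only: mpow_eigenvector[OF By])
  have 2: "(\<lambda>n. (1 / s ^ n) *\<^sub>R (r ^ n *\<^sub>R x)) \<longlonglongrightarrow> (f \<bullet> x) *\<^sub>R y"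
    using attracts_tendsto[OF B, of x] by (simp only: mpow_eigenvector[OF Ax])
  show ?thesis
  proof (cases "r = s")
    case True
    then have "y = (e \<bullet> y) *\<^sub>R x"
      using 1 r by (simp add: LIMSEQ_const_iff)
    then show ?thesis using y by (metis scale_zero_left)
  next
    case False
    have "e \<bullet> y = 0"
      using attracts_functional[OF A, of y] By False by simp
    moreover have "f \<bullet> x = 0"
      using attracts_functional[OF B, of x] Ax False by simp
    ultimately show ?thesis
      using power_scale_tendsto_zero[OF _ y r, of s] power_scale_tendsto_zero[OF _ x s, of r] 1 2 by simp
  qed
qed

subsection \<open>Proximality in terms of the characteristic polynomial\<close>

lemma det_eq_0_iff_kernel:
  fixes M :: "'a::field^'n^'n"
  shows "det M = 0 \<longleftrightarrow> (\<exists>v. v \<noteq> 0 \<and> M *v v = 0)"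
  using invertible_det_nz[of M] invertible_left_inverse[of M] matrix_left_invertible_ker[of M] by blast

lemma poly_det: "poly (det (\<chi> i j. M i j)) z = det (\<chi> i j. poly (M i j) z)"
  for M :: "'n::finite \<Rightarrow> 'n \<Rightarrow> 'a::comm_ring_1 poly"
  by (simp add: det_def poly_sum poly_prod sign_def)

lemma mat_vec: "mat z *v v = z *s (v :: 'a::comm_semiring_1^'n)"
  by (simp add: vec_eq_iff matrix_vector_mult_def mat_def if_distrib[of "\<lambda>x. x * _"] cong: if_cong)

lemma poly_charpoly: "poly (charpoly A) z = det (mat z - A)"
  unfolding charpoly_def poly_det
  by (rule arg_cong[of _ _ det]) (simp add: vec_eq_iff mat_def)

lemma charpoly_root_iff: "poly (charpoly A) z = 0 \<longleftrightarrow> (\<exists>v. v \<noteq> 0 \<and> A *v v = z *s v)"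
proof -
  have "(mat z - A) *v v = 0 \<longleftrightarrow> A *v v = z *s v" for v
    by (auto simp: matrix_vector_mult_diff_rdistrib mat_vec)
  then show ?thesis by (simp add: poly_charpoly det_eq_0_iff_kernel)
qed

text \<open>The matrix of Cramer's rule. With a normalised eigenvector as the new column of
  \<open>mat z - A\<close>, its determinant is the cofactor of \<open>z - r\<close> in the
  characteristic polynomial.\<close>

definition replace_column :: "'a^'n^'n \<Rightarrow> 'n \<Rightarrow> 'a^'n \<Rightarrow> 'a^'n^'n" where
  "replace_column M k x = (\<chi> i j. if j = k then x $ i else M $ i $ j)"

lemma replace_column_vec:
  fixes M :: "'a::comm_ring_1^'n^'n"
  shows "replace_column M k x *v v = v $ k *s x + M *v (v - v $ k *s axis k 1)"
proof -
  have "(\<Sum>j\<in>UNIV. (if j = k then x $ i else M $ i $ j) * v $ j) =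
      v $ k * x $ i + (\<Sum>j\<in>UNIV. M $ i $ j * (v $ j - v $ k * axis k 1 $ j))" for i
    by (subst (1 2) sum.remove[of UNIV k])
      (auto simp: axis_def mult.commute intro!: sum.cong)
  then show ?thesis
    by (simp add: vec_eq_iff replace_column_def matrix_vector_mult_def)
qed

text \<open>
  This splits off the factor \<open>z - r\<close> of the characteristic polynomial without dividing, so that
  simplicity of \<open>r\<close> becomes invertibility of the matrix with the replaced column.
\<close>

lemma det_replace_eigenvector_column:
  fixes A :: "'a::field^'n^'n"
  assumes "A *v x = r *s x" "x $ k = 1"
  shows "det (mat z - A) = (z - r) * det (replace_column (mat z - A) k x)"
proof -
  let ?M = "mat z - A" and ?N = "replace_column (mat z - A) k x"
  have 1: "?M *v x = (z - r) *s x"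
    using assms(1) by (simp add: matrix_vector_mult_diff_rdistrib mat_vec vec_eq_iff algebra_simps)
  have 2: "?N *v ((z - r) *s axis k 1) = (z - r) *s x"
    by (simp add: replace_column_vec)
  have "det ?M = det (replace_column ?M k (?M *v x))"
    using cramer_lemma[of k ?M x] assms(2) by (simp add: replace_column_def)
  also have "replace_column ?M k (?M *v x) = replace_column ?N k (?N *v ((z - r) *s axis k 1))"
    unfolding 1 2 by (simp add: replace_column_def vec_eq_iff)
  also have "det \<dots> = (z - r) * det ?N"
    using cramer_lemma[of k ?N "(z - r) *s axis k 1"]
    unfolding replace_column_def[of _ _ "_ *v _"] by simp
  finally show ?thesis .
qed

text \<open>That the polynomial is nonzero is assumed in the two forms at hand in the applications:
  in one it follows from dominance, in the other from the determinant. The leading coefficient is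
  never computed.\<close>

lemma order_charpoly_eq_1_iff:
  assumes "A *v x = r *s x" "x $ k = 1" "charpoly A \<noteq> 0 \<or> det (replace_column (mat r - A) k x) \<noteq> 0"
  shows "Polynomial.order r (charpoly A) = 1 \<longleftrightarrow> det (replace_column (mat r - A) k x) \<noteq> 0"
proof -
  define Q where "Q = det (\<chi> i j. if j = k then [:x $ i:] else [:- A $ i $ j, if i = j then 1 else 0:])"
  have Q: "poly Q z = det (replace_column (mat z - A) k x)" for z
    unfolding Q_def poly_det
    by (rule arg_cong[of _ _ det]) (auto simp: vec_eq_iff mat_def replace_column_def)
  have P: "charpoly A = [:-r, 1:] * Q"
    by (rule poly_ext)
      (simp add: poly_charpoly det_replace_eigenvector_column[OF assms(1,2)] Q algebra_simps)
  have "charpoly A \<noteq> 0"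
  proof
    assume "charpoly A = 0"
    then have "Q = 0" unfolding P by (metis mult_eq_0_iff pCons_eq_0_iff zero_neq_one)
    then show False using assms(3) \<open>charpoly A = 0\<close> Q[of r] by simp
  qed
  then have "Polynomial.order r (charpoly A) = 1 + Polynomial.order r Q"
    unfolding P by (subst order_mult) (auto simp: order_power_n_n[of r 1, simplified])
  moreover have "Q \<noteq> 0" using \<open>charpoly A \<noteq> 0\<close> P by auto
  ultimately show ?thesis using Q[of r] order_root[of Q r] by auto
qed


text \<open>Deflation: subtracting the rank-one part that belongs to \<open>r\<close> leaves a
  matrix whose eigenvalues all have modulus below \<open>cmod r\<close>, so
  \<open>mpow_tendsto_zero\<close> applies; on the kernel of the dual eigenvector \<open>F\<close>
  both matrices have the same powers.\<close>

lemma dominant_eigenvector_dynamics: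
  fixes A :: "complex^'n^'n"
  assumes Ax: "A *v x = r *s x" and xk: "x $ k = 1" and r: "r \<noteq> 0"
    and N: "det (replace_column (mat r - A) k x) \<noteq> 0"
    and dom: "\<And>v y. v \<noteq> 0 \<Longrightarrow> A *v v = y *s v \<Longrightarrow> y \<noteq> r \<Longrightarrow> cmod y < cmod r"
  shows "\<exists>F. \<forall>v. (\<lambda>n. (1 / r ^ n) *s (mpow A n *v v)) \<longlonglongrightarrow> F v *s x"
proof -
  let ?N = "replace_column (mat r - A) k x"
  obtain N' where N': "N' ** ?N = mat 1"
    using N invertible_det_nz[of ?N] invertible_left_inverse by blast
  then have N'v: "N' *v (?N *v v) = v" for v by (simp add: matrix_vector_mul_assoc)
  \<comment> \<open>By \<open>res\<close> below, \<open>N'\<close> maps the image of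
    \<open>mat r - A\<close> into the vectors whose \<open>k\<close>-th coordinate is 0. Reading off
    this coordinate therefore gives a left eigenvector, normalised by
    \<open>F x = 1\<close>.\<close>
  define F where "F v = (N' *v v) $ k" for v
  have F_add: "F (v + w) = F v + F w" and F_diff: "F (v - w) = F v - F w"
    and F_scale: "F (c *s v) = c * F v" for c v w
    by (simp_all add: F_def matrix_vector_right_distrib matrix_vector_mult_diff_distrib vector_scalar_commute)
  have "?N *v axis k 1 = x" by (simp add: replace_column_vec)
  then have "N' *v x = axis k 1" using N'v by metis
  then have Fx: "F x = 1" by (simp add: F_def)
  have res: "N' *v ((mat r - A) *v v) = v - v $ k *s x" for v
  proof -
    have "?N *v (v - v $ k *s x) = (mat r - A) *v (v - v $ k *s x)"
      using xk by (simp add: replace_column_vec)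
    also have "\<dots> = (mat r - A) *v v"
      using Ax by (simp add: matrix_vector_mult_diff_distrib matrix_vector_mult_diff_rdistrib mat_vec vector_scalar_commute)
    finally show ?thesis using N'v by metis
  qed
  have "F ((mat r - A) *v v) = 0" for v
    unfolding F_def res using xk by simp
  then have FA: "F (A *v v) = r * F v" for v
    by (simp add: matrix_vector_mult_diff_rdistrib mat_vec F_diff F_scale)
  \<comment> \<open>Now \<open>x\<close> has eigenvalue 0, and an eigenvector for any other
    eigenvalue lies in the kernel of \<open>F\<close>, where \<open>B\<close> agrees with
    \<open>A\<close>.\<close>
  define B where "B = A - matrix (\<lambda>v. (r * F v) *s x)"
  have "Vector_Spaces.linear (*s) (*s) (\<lambda>v. (r * F v) *s x)"
    unfolding Vector_Spaces.linear_iff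
    by (auto simp: vec.vector_space_axioms F_add F_scale vec_eq_iff algebra_simps)
  then have B: "B *v v = A *v v - (r * F v) *s x" for v
    unfolding B_def by (simp add: matrix_vector_mult_diff_rdistrib matrix_works)
  have "(\<lambda>n. (1 / cmod r ^ n) *\<^sub>R (mpow B n *v v)) \<longlonglongrightarrow> 0" for v
  proof (rule mpow_tendsto_zero)
    fix v z assume v: "v \<noteq> 0" and Bv: "B *v v = z *s v"
    have "z * F v = F (B *v v)" by (simp only: Bv F_scale)
    also have "\<dots> = 0" by (simp add: B F_diff F_scale FA Fx)
    finally consider "z = 0" | "F v = 0" by auto
    then show "cmod z < cmod r"
    proof cases
      case 2
      then have Av: "A *v v = z *s v" using B Bv by simp
      show ?thesis
      proof (cases "z = r")
        case True
        then have "(mat r - A) *v v = 0" using Av by (simp add: matrix_vector_mult_diff_rdistrib mat_vec)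
        with res[of v] have v': "v = v $ k *s x" by simp
        with 2 have "v $ k = 0" using F_scale[of "v $ k" x] Fx by simp
        with v' v show ?thesis by simp
      qed (use dom[OF v Av] in blast)
    qed (use r in simp)
  qed (use r in simp)
  note lim = this
  have "(\<lambda>n. (1 / r ^ n) *s (mpow A n *v v)) \<longlonglongrightarrow> F v *s x" for v
  proof -
    \<comment> \<open>Removing the \<open>x\<close> component puts \<open>u\<close> into the
      invariant kernel of \<open>F\<close>.\<close>
    define u where "u = v - F v *s x"
    have "F (mpow A n *v u) = 0 \<and> mpow B n *v u = mpow A n *v u" for n
    proof (induction n)
      case 0 then show ?case by (simp add: u_def F_diff F_scale Fx)
    next
      case (Suc n)
      have "F (mpow A (Suc n) *v u) = 0" using Suc by (simp add: mpow_Suc_vec FA del: mpow.simps)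
      moreover have "mpow B (Suc n) *v u = mpow A (Suc n) *v u"
        using Suc B[of "mpow A n *v u"] by (simp only: mpow_Suc_vec) simp
      ultimately show ?case by blast
    qed
    then have BA: "mpow B n *v u = mpow A n *v u" for n by blast
    have "mpow A n *v x = r ^ n *s x" for n
      by (induction n) (simp_all add: mpow_Suc_vec Ax vector_scalar_commute mult.commute del: mpow.simps(2))
    then have split: "(1 / r ^ n) *s (mpow A n *v v) = (1 / r ^ n) *s (mpow B n *v u) + F v *s x" for n
      using r unfolding BA unfolding u_def
      by (simp add: matrix_vector_mult_diff_distrib vector_scalar_commute vec_eq_iff field_simps)
    have "(\<lambda>n. (1 / r ^ n) *s (mpow B n *v u)) \<longlonglongrightarrow> 0"
    proof (rule tendsto_norm_zero_cancel)
      show "(\<lambda>n. norm ((1 / r ^ n) *s (mpow B n *v u))) \<longlonglongrightarrow> 0"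
        using tendsto_norm_zero[OF lim[of u]] by (simp add: norm_scalar_mult_complex norm_divide norm_power)
    qed
    then show ?thesis unfolding split using tendsto_add[OF _ tendsto_const] by fastforce
  qed
  then show ?thesis by blast
qed

section \<open>Passage between real and complex matrices\<close>

definition cmat :: "real^'n^'n \<Rightarrow> complex^'n^'n" where
  "cmat A = (\<chi> i j. complex_of_real (A $ i $ j))"

definition cvec :: "real^'n \<Rightarrow> complex^'n" where
  "cvec v = (\<chi> i. complex_of_real (v $ i))"

lemma cmat_cvec: "cmat A *v cvec v = cvec (A *v v)"
  by (simp add: cmat_def cvec_def matrix_vector_mult_def vec_eq_iff)

lemma mpow_cmat: "mpow (cmat A) n = cmat (mpow A n)"
  by (induction n) (simp_all add: cmat_def matrix_matrix_mult_def mat_def vec_eq_iff)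

lemma dominant_eigenvalue_iff:
  "dominant_eigenvalue A z \<longleftrightarrow> Polynomial.order z (charpoly (cmat A)) = 1 \<and>
    (\<forall>y v. v \<noteq> 0 \<longrightarrow> cmat A *v v = y *s v \<longrightarrow> y \<noteq> z \<longrightarrow> cmod y < cmod z)"
  unfolding dominant_eigenvalue_def Let_def cmat_def[symmetric] charpoly_root_iff by blast

theorem dominant_eigenvalue_imp_attracts:
  assumes inv: "invertible A" and dom: "dominant_eigenvalue A z"
  shows "\<exists>r x e. z = complex_of_real r \<and> attracts A r x e"
proof -
  let ?P = "charpoly (cmat A)"
  have ord: "Polynomial.order z ?P = 1"
    and dom': "\<And>v y. v \<noteq> 0 \<Longrightarrow> cmat A *v v = y *s v \<Longrightarrow> y \<noteq> z \<Longrightarrow> cmod y < cmod z"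
    using dom unfolding dominant_eigenvalue_iff by blast+
  \<comment> \<open>Otherwise every complex number would be an eigenvalue, including one of modulus
    \<open>cmod z + 1\<close>.\<close>
  have "?P \<noteq> 0"
  proof
    assume P0: "?P = 0"
    define y where "y = of_real (cmod z + 1) + (0::complex)"
    have y: "cmod y = cmod z + 1" by (simp add: y_def del: of_real_add)
    then have "y \<noteq> z" by auto
    moreover have "\<exists>v. v \<noteq> 0 \<and> cmat A *v v = y *s v"
      using P0 charpoly_root_iff[of "cmat A" y] by simp
    ultimately show False using dom'[of _ y] y by fastforce
  qed
  have "poly ?P z = 0" using ord order_root[of ?P z] by simp
  then obtain v where v: "v \<noteq> 0" "cmat A *v v = z *s v" unfolding charpoly_root_iff by blast
  define v' where "v' = (\<chi> i. cnj (v $ i))"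
  have "v' \<noteq> 0" using v(1) by (auto simp: v'_def vec_eq_iff)
  moreover have "cmat A *v v' = cnj z *s v'"
  proof -
    have "(cmat A *v v') $ i = cnj ((cmat A *v v) $ i)" for i
      by (simp add: cmat_def v'_def matrix_vector_mult_def)
    then show ?thesis by (simp add: vec_eq_iff v(2)) (simp add: v'_def)
  qed
  ultimately have "cnj z = z" using dom'[of v' "cnj z"] by fastforce
  then obtain r where r: "z = complex_of_real r" by (metis complex_cnj_cancel_iff Reals_cnj_iff Reals_cases)
  obtain k where k: "v $ k \<noteq> 0" using v(1) by (auto simp: vec_eq_iff)
  \<comment> \<open>After division by the coordinate \<open>k\<close> the real part cannot vanish,
    and it is still an eigenvector because \<open>A\<close> and \<open>r\<close> are real.\<close>
  define x where "x = (\<chi> i. Re (v $ i / v $ k))"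
  have Ax: "A *v x = r *\<^sub>R x"
  proof -
    have "(A *v x) $ i = Re ((cmat A *v v) $ i / v $ k)" for i
      by (simp add: cmat_def x_def matrix_vector_mult_def sum_divide_distrib flip: times_divide_eq_right)
    then show ?thesis by (simp add: vec_eq_iff v(2) r) (simp add: x_def flip: times_divide_eq_right)
  qed
  have xk: "x $ k = 1" using k by (simp add: x_def)
  have r0: "r \<noteq> 0"
  proof
    assume "r = 0"
    then have "A *v x = 0" using Ax by simp
    then have "x = 0" using invertible_vector_nonzero[OF inv] by blast
    with xk show False by simp
  qed
  have cx: "cmat A *v cvec x = z *s cvec x"
    unfolding cmat_cvec Ax r by (simp add: cvec_def vec_eq_iff)
  have cxk: "cvec x $ k = 1" using xk by (simp add: cvec_def)
  have N: "det (replace_column (mat z - cmat A) k (cvec x)) \<noteq> 0"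
    using order_charpoly_eq_1_iff[OF cx cxk] ord \<open>?P \<noteq> 0\<close> by blast
  have "z \<noteq> 0" using r0 r by simp
  have "\<exists>F. \<forall>v. (\<lambda>n. (1 / z ^ n) *s (mpow (cmat A) n *v v)) \<longlonglongrightarrow> F v *s cvec x"
    by (rule dominant_eigenvector_dynamics[OF cx cxk \<open>z \<noteq> 0\<close> N dom'])
  then obtain F where F: "\<And>v. (\<lambda>n. (1 / z ^ n) *s (mpow (cmat A) n *v v)) \<longlonglongrightarrow> F v *s cvec x"
    by blast
  define e where "e = (\<chi> j. Re (F (axis j 1)))"
  have lim: "(\<lambda>n. (1 / r ^ n) *\<^sub>R mpow A n) \<longlonglongrightarrow> outer x e"
  proof (intro vec_tendstoI)
    fix i j
    have "(\<lambda>n. Re (((1 / z ^ n) *s (mpow (cmat A) n *v axis j 1)) $ i)) \<longlonglongrightarrow> Re ((F (axis j 1) *s cvec x) $ i)"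
      by (intro tendsto_Re tendsto_vec_nth F)
    moreover have "(mpow (cmat A) n *v axis j 1) $ i = complex_of_real (mpow A n $ i $ j)" for n
      unfolding mpow_cmat by (simp add: cmat_def matrix_vector_mult_def axis_def if_distrib cong: if_cong)
    ultimately show "(\<lambda>n. ((1 / r ^ n) *\<^sub>R mpow A n) $ i $ j) \<longlonglongrightarrow> outer x e $ i $ j"
      by (simp add: r e_def outer_def cvec_def mult.commute flip: of_real_power of_real_divide of_real_mult)
  qed
  \<comment> \<open>On the eigenvector itself the sequence is constant, which gives the
    normalisation \<open>e \<bullet> x = 1\<close>.\<close>
  have "(\<lambda>n. ((1 / r ^ n) *\<^sub>R mpow A n) *v x) \<longlonglongrightarrow> outer x e *v x"
    by (intro tendsto_matrix_vector_mult lim tendsto_const)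
  then have "x = (e \<bullet> x) *\<^sub>R x"
    using r0 by (simp add: scaleR_matrix_vector mpow_eigenvector[OF Ax] outer_mult_vec LIMSEQ_const_iff)
  from arg_cong[OF this, of "\<lambda>v. v $ k"] have "e \<bullet> x = 1" using xk by simp
  then show ?thesis using lim r0 r by (auto simp: attracts_def)
qed

text \<open>The limit extends to complex vectors by linearity. It sends every eigenvector for an
  eigenvalue other than \<open>r\<close> to 0, which bounds that eigenvalue; and if \<open>r\<close>
  were not simple, there would be a nonzero multiple of \<open>x'\<close> with vanishing coordinate
  \<open>k\<close>.\<close>

theorem attracts_imp_dominant_eigenvalue:
  fixes A :: "real^'n^'n"
  assumes at: "attracts A r x e"
  shows "dominant_eigenvalue A (complex_of_real r)"
proof -
  have r: "r \<noteq> 0" using at by (simp add: attracts_def)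
  obtain k where k: "x $ k \<noteq> 0" using attracts_nonzero[OF at] by (auto simp: vec_eq_iff)
  define x' e' where "x' = (1 / x $ k) *\<^sub>R x" and "e' = x $ k *\<^sub>R e"
  have at': "attracts A r x' e'"
    using attracts_scale_vector[OF at, of "1 / x $ k"] k by (simp add: x'_def e'_def)
  have x'k: "x' $ k = 1" using k by (simp add: x'_def)
  define E where "E v = (\<Sum>j\<in>UNIV. complex_of_real (e' $ j) * v $ j)" for v :: "complex^'n"
  have lim: "(\<lambda>n. (1 / complex_of_real r ^ n) *s (mpow (cmat A) n *v v)) \<longlonglongrightarrow> E v *s cvec x'" for v
  proof (rule vec_tendstoI)
    fix i
    have "(\<lambda>n. \<Sum>j\<in>UNIV. complex_of_real (((1 / r ^ n) *\<^sub>R mpow A n) $ i $ j) * v $ j)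
        \<longlonglongrightarrow> (\<Sum>j\<in>UNIV. complex_of_real (outer x' e' $ i $ j) * v $ j)"
      using at' unfolding attracts_def
      by (intro tendsto_sum tendsto_mult tendsto_of_real tendsto_vec_nth tendsto_const) blast
    then show "(\<lambda>n. ((1 / complex_of_real r ^ n) *s (mpow (cmat A) n *v v)) $ i) \<longlonglongrightarrow> (E v *s cvec x') $ i"
      unfolding mpow_cmat by (simp add: cmat_def matrix_vector_mult_def E_def outer_def cvec_def sum_distrib_left
          sum_distrib_right mult_ac)
  qed
  have eig: "cmod y < \<bar>r\<bar>" if v: "v \<noteq> 0" "cmat A *v v = y *s v" and y: "y \<noteq> of_real r" for y v
  proof -
    have pw: "mpow (cmat A) n *v v = y ^ n *s v" for n
      by (induction n) (simp_all add: mpow_Suc_vec v vector_scalar_commute mult.commute del: mpow.simps(2))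
    let ?q = "y / of_real r"
    have l: "(\<lambda>n. ?q ^ n * v $ i) \<longlonglongrightarrow> E v * cvec x' $ i" for i
      using tendsto_vec_nth[OF lim[of v], of i] unfolding pw by (simp add: power_divide)
    \<comment> \<open>The sequence shifted by one has the same limit, so the limit is fixed by the
      factor \<open>?q \<noteq> 1\<close> and must be 0.\<close>
    have "E v * cvec x' $ k = ?q * (E v * cvec x' $ k)"
    proof (rule LIMSEQ_unique[OF LIMSEQ_Suc[OF l[of k]]])
      show "(\<lambda>n. ?q ^ Suc n * v $ k) \<longlonglongrightarrow> ?q * (E v * cvec x' $ k)"
        using tendsto_mult[OF tendsto_const[of ?q] l[of k]] by (simp only: power_Suc mult.assoc)
    qed
    moreover have "?q \<noteq> 1" using y r by simp
    ultimately have "E v * cvec x' $ k = 0" by (metis mult_cancel_right1)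
    then have "E v = 0" using x'k by (simp add: cvec_def)
    moreover obtain i where i: "v $ i \<noteq> 0" using v(1) by (auto simp: vec_eq_iff)
    ultimately have *: "(\<lambda>n. ?q ^ n * v $ i) \<longlonglongrightarrow> 0" using l[of i] by simp
    have "cmod ?q < 1"
    proof (rule ccontr)
      assume "\<not> ?thesis"
      then have "norm (v $ i) \<le> norm (?q ^ n * v $ i)" for n
        using one_le_power[of "cmod ?q" n] by (simp add: norm_mult norm_power mult_le_cancel_right1)
      then have "norm (v $ i) \<le> norm (0::complex)"
        by (intro LIMSEQ_le_const[OF tendsto_norm[OF *]]) auto
      then show False using i by simp
    qed
    then show ?thesis using r by (simp add: norm_divide field_simps)
  qed
  have cx: "cmat A *v cvec x' = of_real r *s cvec x'"
    unfolding cmat_cvec attracts_eigenvector[OF at'] by (simp add: cvec_def vec_eq_iff)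
  have cxk: "cvec x' $ k = 1" using x'k by (simp add: cvec_def)
  have Ex: "E (cvec x') = 1"
    using at' by (simp add: E_def cvec_def attracts_def inner_vec_def flip: of_real_mult of_real_sum)
  have E_lin: "E (v - w) = E v - E w" "E (c *s v) = c * E v" "E (v + w) = E v + E w" for v w c
    by (simp_all add: E_def algebra_simps sum_subtractf sum.distrib sum_distrib_left)
  have EA: "E (cmat A *v v) = of_real r * E v" for v
  proof -
    have "E (cmat A *v v) * cvec x' $ k = of_real r * (E v * cvec x' $ k)"
    proof (rule LIMSEQ_unique)
      show "(\<lambda>n. ((1 / complex_of_real r ^ n) *s (mpow (cmat A) n *v (cmat A *v v))) $ k)
          \<longlonglongrightarrow> E (cmat A *v v) * cvec x' $ k"
        using tendsto_vec_nth[OF lim] by fastforce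
      have "(\<lambda>n. of_real r * ((1 / complex_of_real r ^ Suc n) *s (mpow (cmat A) (Suc n) *v v)) $ k)
          \<longlonglongrightarrow> of_real r * (E v * cvec x' $ k)"
        using tendsto_mult[OF tendsto_const[of "of_real r"] LIMSEQ_Suc[OF tendsto_vec_nth[OF lim[of v], of k]]]
        by (simp only: vector_smult_component)
      then show "(\<lambda>n. ((1 / complex_of_real r ^ n) *s (mpow (cmat A) n *v (cmat A *v v))) $ k)
          \<longlonglongrightarrow> of_real r * (E v * cvec x' $ k)"
        using r unfolding mpow_vec_shift by (simp add: mpow_Suc_vec field_simps del: mpow.simps)
    qed
    then show ?thesis using cxk by simp
  qed
  have "det (replace_column (mat (of_real r) - cmat A) k (cvec x')) \<noteq> 0"
  proof
    assume "det (replace_column (mat (of_real r) - cmat A) k (cvec x')) = 0"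
    then obtain v where v: "v \<noteq> 0"
      and "v $ k *s cvec x' + (mat (of_real r) - cmat A) *v (v - v $ k *s axis k 1) = 0"
      unfolding det_eq_0_iff_kernel replace_column_vec by blast
    note eq = this(2)
    \<comment> \<open>\<open>E\<close> vanishes on the image of
      \<open>mat (of_real r) - cmat A\<close> by \<open>EA\<close> and equals 1 on
      \<open>cvec x'\<close>, so only \<open>v $ k\<close> survives.\<close>
    from arg_cong[OF eq, of E] have vk: "v $ k = 0"
      using E_lin(2)[of 0 0] by (simp add: E_lin Ex matrix_vector_mult_diff_rdistrib mat_vec EA algebra_simps)
    with eq have Av: "cmat A *v v = of_real r *s v"
      by (simp add: matrix_vector_mult_diff_rdistrib mat_vec)
    have "mpow (cmat A) n *v v = of_real r ^ n *s v" for n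
      by (induction n) (simp_all add: mpow_Suc_vec Av vector_scalar_commute mult.commute del: mpow.simps(2))
    then have "v = E v *s cvec x'"
      using lim[of v] r by (simp add: LIMSEQ_const_iff)
    moreover from this have "E v = 0" using vk cxk by (metis mult.right_neutral vector_smult_component)
    ultimately show False using v by simp
  qed
  then have "Polynomial.order (of_real r) (charpoly (cmat A)) = 1"
    using order_charpoly_eq_1_iff[OF cx cxk] by blast
  then show ?thesis
    unfolding dominant_eigenvalue_iff using eig by simp
qed


subsection \<open>Matrices close to a projection of rank one\<close>

text \<open>
  Brouwer's theorem is applied to \<open>v \<mapsto> M v / (e \<bullet> M v)\<close> on a small ball around \<open>x\<close> in the affine
  hyperplane \<open>e \<bullet> v = 1\<close>.
\<close>

lemma eigenvector_near_rank_one: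
  fixes x e :: "real^'n"
  assumes ex: "e \<bullet> x = 1" and eps: "\<epsilon> > 0"
  shows "\<exists>\<delta>>0. \<forall>M. norm (M - outer x e) < \<delta> \<longrightarrow>
    (\<exists>y r. M *v y = r *\<^sub>R y \<and> e \<bullet> y = 1 \<and> norm (y - x) \<le> \<epsilon> \<and> \<bar>r - 1\<bar> \<le> \<epsilon>)"
proof -
  obtain K where K: "K > 0" "\<And>M v. norm ((M::real^'n^'n) *v v) \<le> norm M * norm v * K"
    using bounded_bilinear.pos_bounded[OF bounded_bilinear_matrix_vector_mult] by metis
  define R where "R = norm x + \<epsilon>"
  have R: "R > 0" using eps by (simp add: R_def add_nonneg_pos)
  define L where "L = norm e + 1"
  have L: "L > 0" "norm e \<le> L" "1 \<le> L" by (simp_all add: L_def add_nonneg_pos)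
  define X where "X = norm x + 1"
  have X: "X > 0" "norm x \<le> X" "1 \<le> X" by (simp_all add: X_def add_nonneg_pos)
  \<comment> \<open>\<open>L\<close> and \<open>X\<close> are at least 1, so the one bound on
    \<open>L * \<eta> * X\<close> controls all error terms: \<open>g\<close> stays above 1/2, and
    \<open>G v\<close> stays within \<open>2 * (\<eta> + L * \<eta> * X) \<le> \<epsilon>\<close> of
    \<open>x\<close>.\<close>
  define \<eta> where "\<eta> = min (1/2) \<epsilon> / (4 * L * X)"
  have \<eta>: "\<eta> > 0" using eps L X by (simp add: \<eta>_def)
  have LX: "L * \<eta> \<le> min (1/2) \<epsilon> / 4" "L * \<eta> * X \<le> min (1/2) \<epsilon> / 4" "\<eta> \<le> min (1/2) \<epsilon> / 4"
  proof -
    show *: "L * \<eta> * X \<le> min (1/2) \<epsilon> / 4" using L X by (simp add: \<eta>_def)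
    have "L * \<eta> * 1 \<le> L * \<eta> * X" using L X \<eta> by (intro mult_left_mono) auto
    with * show **: "L * \<eta> \<le> min (1/2) \<epsilon> / 4" by simp
    have "1 * \<eta> \<le> L * \<eta>" using L \<eta> by (intro mult_right_mono) auto
    with ** show "\<eta> \<le> min (1/2) \<epsilon> / 4" by simp
  qed
  have "\<exists>y r. M *v y = r *\<^sub>R y \<and> e \<bullet> y = 1 \<and> norm (y - x) \<le> \<epsilon> \<and> \<bar>r - 1\<bar> \<le> \<epsilon>"
    if M: "norm (M - outer x e) < \<eta> / (R * K)" for M
  proof -
    define D where "D = cball x \<epsilon> \<inter> {v. e \<bullet> v = 1}"
    have near: "norm (M *v v - x) \<le> \<eta>" if "v \<in> D" for v
    proof -
      have "M *v v - x = (M - outer x e) *v v"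
        using that by (simp add: matrix_vector_mult_diff_rdistrib outer_mult_vec D_def)
      moreover have "norm v \<le> R"
        using that norm_triangle_ineq2[of v x] by (simp add: D_def R_def dist_norm norm_minus_commute)
      then have "norm ((M - outer x e) *v v) \<le> \<eta> / (R * K) * R * K"
        using M K R \<eta> by (intro order_trans[OF K(2)] mult_right_mono mult_mono) auto
      ultimately show ?thesis using R K by simp
    qed
    define g where "g v = e \<bullet> (M *v v)" for v
    have g: "\<bar>g v - 1\<bar> \<le> L * \<eta>" if "v \<in> D" for v
    proof -
      have "g v - 1 = e \<bullet> (M *v v - x)" by (simp add: g_def inner_diff_right ex)
      also have "\<bar>\<dots>\<bar> \<le> norm e * norm (M *v v - x)" by (rule Cauchy_Schwarz_ineq2)
      also have "\<dots> \<le> L * \<eta>" using near[OF that] L by (intro mult_mono) auto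
      finally show ?thesis .
    qed
    have gpos: "g v \<ge> 1/2" if "v \<in> D" for v
      using g[OF that] LX(1) by (simp add: min_def split: if_splits)
    define G where "G v = (1 / g v) *\<^sub>R (M *v v)" for v
    have cM: "continuous_on D (\<lambda>v. M *v v)"
      by (intro linear_continuous_on linear_linear[THEN iffD2] matrix_vector_mul_linear)
    have "continuous_on D G"
      unfolding G_def g_def
      by (intro continuous_intros cM) (use gpos in \<open>force simp: g_def\<close>)
    moreover have "G \<in> D \<rightarrow> D"
    proof
      fix v assume v: "v \<in> D"
      then have gv: "g v > 0" using gpos[OF v] by simp
      have "norm (G v - x) = norm ((1 / g v) *\<^sub>R ((M *v v - x) - (g v - 1) *\<^sub>R x))"
        using gv by (simp add: G_def algebra_simps)
      also have "\<dots> \<le> 2 * (norm (M *v v - x) + \<bar>g v - 1\<bar> * norm x)"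
      proof -
        have "norm ((M *v v - x) - (g v - 1) *\<^sub>R x) \<le> norm (M *v v - x) + \<bar>g v - 1\<bar> * norm x"
          by (metis norm_triangle_ineq4 norm_scaleR)
        moreover have "1 / g v \<le> 2" using gpos[OF v] by (simp add: field_simps)
        ultimately show ?thesis
          using gv by (simp only: norm_scaleR) (intro mult_mono; simp)
      qed
      also have "\<dots> \<le> 2 * (\<eta> + L * \<eta> * X)"
        using near[OF v] g[OF v] X L \<eta> by (intro mult_left_mono add_mono mult_mono) auto
      also have "\<dots> \<le> \<epsilon>" using LX eps by (simp add: min_def split: if_splits)
      finally have "G v \<in> cball x \<epsilon>" by (simp add: dist_norm norm_minus_commute)
      moreover have "e \<bullet> G v = 1" using gv by (simp add: G_def g_def)
      ultimately show "G v \<in> D" by (simp add: D_def)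
    qed
    moreover have "compact D" "convex D" "D \<noteq> {}"
    proof -
      show "compact D" unfolding D_def by (intro compact_Int_closed compact_cball closed_hyperplane)
      show "convex D" unfolding D_def by (intro convex_Int convex_cball convex_hyperplane)
      have "x \<in> D" using ex eps by (simp add: D_def)
      then show "D \<noteq> {}" by blast
    qed
    ultimately obtain y where y: "y \<in> D" "G y = y" using brouwer by blast
    have "M *v y = g y *\<^sub>R G y" using gpos[OF y(1)] by (simp add: G_def)
    moreover have "\<bar>g y - 1\<bar> \<le> \<epsilon>" using g[OF y(1)] LX eps by (simp add: min_def split: if_splits)
    ultimately show ?thesis
      using y by (intro exI[of _ y] exI[of _ "g y"]) (simp add: D_def dist_norm norm_minus_commute)
  qed
  then show ?thesis using \<eta> R K by (intro exI[of _ "\<eta> / (R * K)"]) simp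
qed

lemma transpose_outer: "transpose (outer x e) = outer e x"
  by (simp add: transpose_def outer_def vec_eq_iff mult.commute)

lemma norm_transpose: "norm (transpose M) = norm (M :: real^'n^'n)"
  unfolding norm_eq_sqrt_inner inner_vec_def transpose_def
  by (simp, subst sum.swap) simp

lemma tendsto_outer [tendsto_intros]:
  assumes "(f \<longlongrightarrow> a) F" "(g \<longlongrightarrow> b) F"
  shows "((\<lambda>n. outer (f n) (g n)) \<longlongrightarrow> outer a b) F"
  unfolding outer_def using assms by (intro tendsto_intros)

text \<open>\<open>eigenvector_near_rank_one\<close> is applied to the transpose as well: its
  eigenvector \<open>f\<close> gives an invariant complement of \<open>y\<close>, on which
  \<open>M n\<close> agrees with a matrix of small norm. Arguing along bad indices turns all
  smallness conditions into limits.\<close>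

theorem attracts_near_rank_one:
  fixes x e :: "real^'n"
  assumes ex: "e \<bullet> x = 1" and M: "M \<longlonglongrightarrow> outer x e" and eps: "\<epsilon> > 0"
  shows "\<forall>\<^sub>F n in sequentially. \<exists>r y f. attracts (M n) r y f \<and> norm (y - x) < \<epsilon>"
proof (rule ccontr)
  assume neg: "\<not> ?thesis"
  let ?bad = "\<lambda>n. \<not> (\<exists>r y f. attracts (M n) r y f \<and> norm (y - x) < \<epsilon>)"
  define S where "S n y r f s \<longleftrightarrow> M n *v y = r *\<^sub>R y \<and> transpose (M n) *v f = s *\<^sub>R f" for n y r f s
  have "\<exists>n y r f s. ?bad n \<and> norm (M n - outer x e) < h \<and> S n y r f s \<and> norm (y - x) \<le> h \<and> \<bar>r - 1\<bar> \<le> h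
      \<and> norm (f - e) \<le> h" if h: "h > 0" for h
  proof -
    obtain d1 where d1: "d1 > 0" "\<And>M. norm (M - outer x e) < d1 \<Longrightarrow>
      (\<exists>y r. M *v y = r *\<^sub>R y \<and> e \<bullet> y = 1 \<and> norm (y - x) \<le> h \<and> \<bar>r - 1\<bar> \<le> h)"
      using eigenvector_near_rank_one[OF ex h] by blast
    obtain d2 where d2: "d2 > 0" "\<And>M. norm (M - outer e x) < d2 \<Longrightarrow>
      (\<exists>y r. M *v y = r *\<^sub>R y \<and> x \<bullet> y = 1 \<and> norm (y - e) \<le> h \<and> \<bar>r - 1\<bar> \<le> h)"
      using eigenvector_near_rank_one[of x e, OF _ h] ex by (auto simp: inner_commute)
    have "\<forall>\<^sub>F n in sequentially. dist (M n) (outer x e) < min h (min d1 d2)"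
      by (rule tendstoD[OF M]) (use h d1 d2 in simp)
    note ev = this
    have "\<exists>n. ?bad n \<and> dist (M n) (outer x e) < min h (min d1 d2)"
    proof (rule ccontr)
      assume "\<not> ?thesis"
      then have "\<And>n. dist (M n) (outer x e) < min h (min d1 d2) \<Longrightarrow>
          \<exists>r y f. attracts (M n) r y f \<and> norm (y - x) < \<epsilon>" by blast
      with ev have "\<forall>\<^sub>F n in sequentially. \<exists>r y f. attracts (M n) r y f \<and> norm (y - x) < \<epsilon>"
        by (rule eventually_mono)
      with neg show False by simp
    qed
    then obtain n where n: "?bad n" "dist (M n) (outer x e) < min h (min d1 d2)" by blast
    have "transpose (M n) - outer e x = transpose (M n - outer x e)"
      unfolding transpose_outer[of x e, symmetric] by (simp add: transpose_def vec_eq_iff)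
    then have "norm (transpose (M n) - outer e x) < d2"
      using n(2) by (simp add: norm_transpose dist_norm)
    then show ?thesis using n d1(2)[of "M n"] d2(2) unfolding S_def by (fastforce simp: dist_norm)
  qed
  then have "\<forall>k. \<exists>n y r f s. ?bad n \<and> norm (M n - outer x e) < inverse (real (Suc k)) \<and> S n y r f s \<and>
      norm (y - x) \<le> inverse (real (Suc k)) \<and> \<bar>r - 1\<bar> \<le> inverse (real (Suc k)) \<and>
      norm (f - e) \<le> inverse (real (Suc k))" by simp
  then obtain n y r f s where bad: "\<And>k. ?bad (n k)"
    and Mn: "\<And>k. norm (M (n k) - outer x e) < inverse (real (Suc k))"
    and S: "\<And>k. S (n k) (y k) (r k) (f k) (s k)"
    and y: "\<And>k. norm (y k - x) \<le> inverse (real (Suc k))"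
    and r: "\<And>k. \<bar>r k - 1\<bar> \<le> inverse (real (Suc k))"
    and f: "\<And>k. norm (f k - e) \<le> inverse (real (Suc k))"
    by metis
  have conv: "a \<longlonglongrightarrow> l" if "\<And>k. norm (a k - l) \<le> inverse (real (Suc k))"
    for a :: "nat \<Rightarrow> 'b::real_normed_vector" and l
    by (rule LIM_zero_cancel, rule Lim_null_comparison[OF _ LIMSEQ_inverse_real_of_nat])
      (use that in auto)
  have limM: "(\<lambda>k. M (n k)) \<longlonglongrightarrow> outer x e" using Mn by (intro conv) (simp add: less_imp_le)
  have limy: "y \<longlonglongrightarrow> x" by (rule conv[OF y])
  have limr: "r \<longlonglongrightarrow> 1" using r by (intro conv) simp
  have limf: "f \<longlonglongrightarrow> e" by (rule conv[OF f])
  have limfy: "(\<lambda>k. f k \<bullet> y k) \<longlonglongrightarrow> 1" using tendsto_inner[OF limf limy] ex by simp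
  \<comment> \<open>Where \<open>f k \<bullet> y k \<noteq> 0\<close>, this makes
    \<open>outer (y k) (f' k)\<close> the projection onto \<open>y k\<close> along the kernel of
    \<open>f k\<close>.\<close>
  define f' where "f' k = (1 / (f k \<bullet> y k)) *\<^sub>R f k" for k
  have limf': "f' \<longlonglongrightarrow> e"
    unfolding f'_def using tendsto_scaleR[OF tendsto_divide[OF tendsto_const[of 1] limfy] limf] by simp
  define B where "B k = M (n k) - r k *\<^sub>R outer (y k) (f' k)" for k
  have "B \<longlonglongrightarrow> outer x e - 1 *\<^sub>R outer x e"
    unfolding B_def by (intro tendsto_intros limM limr limy limf')
  then have limB: "B \<longlonglongrightarrow> 0" by simp
  obtain K where K: "K > 0" "\<And>M v. norm ((M::real^'n^'n) *v v) \<le> norm M * norm v * K"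
    using bounded_bilinear.pos_bounded[OF bounded_bilinear_matrix_vector_mult] by metis
  \<comment> \<open>A norm below \<open>1 / (4 * K)\<close> makes \<open>B k\<close> contract by
    1/4; against \<open>r k > 1/2\<close> this leaves a factor 1/2 per step.\<close>
  have e1: "\<forall>\<^sub>F k in sequentially. norm (B k) < 1 / (4 * K)"
    using tendstoD[OF limB, of "1 / (4 * K)"] K by simp
  have e2: "\<forall>\<^sub>F k in sequentially. r k > 1/2" using order_tendstoD(1)[OF limr, of "1/2"] by simp
  have e3: "\<forall>\<^sub>F k in sequentially. f k \<bullet> y k > 0" using order_tendstoD(1)[OF limfy, of 0] by simp
  have e4: "\<forall>\<^sub>F k in sequentially. norm (y k - x) < \<epsilon>"
    using tendstoD[OF limy eps] by (simp add: dist_norm)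
  have "\<forall>\<^sub>F k in sequentially. norm (B k) < 1 / (4 * K) \<and> r k > 1/2 \<and> f k \<bullet> y k > 0 \<and> norm (y k - x) < \<epsilon>"
    using e1 e2 e3 e4 by eventually_elim simp
  then obtain k where k: "norm (B k) < 1 / (4 * K)" "r k > 1/2" "f k \<bullet> y k > 0" "norm (y k - x) < \<epsilon>"
    using eventually_happens'[OF sequentially_bot] by blast
  let ?M = "M (n k)" and ?y = "y k" and ?r = "r k" and ?f = "f' k"
  have My: "?M *v ?y = ?r *\<^sub>R ?y" and Mf: "transpose ?M *v f k = s k *\<^sub>R f k"
    using S[of k] by (simp_all add: S_def)
  have fM: "f k \<bullet> (?M *v v) = s k * (f k \<bullet> v)" for v
  proof -
    have "f k v* ?M = s k *\<^sub>R f k" using Mf by simp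
    then show ?thesis using dot_lmul_matrix[of "f k" ?M v] by simp
  qed
  \<comment> \<open>The eigenvalues of the matrix and of its transpose agree because
    \<open>f k \<bullet> y k\<close> is nonzero.\<close>
  have "s k = ?r" using fM[of ?y] My k(3) by simp
  then have f'M: "?f \<bullet> (?M *v v) = ?r * (?f \<bullet> v)" for v
    using fM[of v] by (simp add: f'_def)
  have fy: "?f \<bullet> ?y = 1" using k(3) by (simp add: f'_def)
  have "attracts ?M ?r ?y ?f"
  proof (rule attractsI)
    show "?r \<noteq> 0" using k(2) by simp
    show "?f \<bullet> ?y = 1" by (rule fy)
    fix v
    define u where "u = v - (?f \<bullet> v) *\<^sub>R ?y"
    have pow: "?f \<bullet> (mpow ?M m *v u) = 0 \<and> norm (mpow ?M m *v u) \<le> (1/4) ^ m * norm u" for m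
    proof (induction m)
      case 0 then show ?case using fy by (simp add: u_def inner_diff_right)
    next
      case (Suc m)
      let ?w = "mpow ?M m *v u"
      have "mpow ?M (Suc m) *v u = ?M *v ?w" by (rule mpow_Suc_vec)
      moreover have "?M *v ?w = B k *v ?w"
        using Suc by (simp add: B_def matrix_vector_mult_diff_rdistrib scaleR_matrix_vector outer_mult_vec)
      moreover have "norm (B k *v ?w) \<le> 1 / (4 * K) * norm ?w * K"
        using K k(1) by (intro order_trans[OF K(2)] mult_right_mono) auto
      moreover have "1 / (4 * K) * norm ?w * K = (1/4) * norm ?w" using K by simp
      ultimately have "norm (mpow ?M (Suc m) *v u) \<le> (1/4) * norm ?w" by metis
      also have "\<dots> \<le> (1/4) * ((1/4) ^ m * norm u)" using Suc by (intro mult_left_mono) auto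
      finally have "norm (mpow ?M (Suc m) *v u) \<le> (1/4) ^ Suc m * norm u" by simp
      moreover have "?f \<bullet> (mpow ?M (Suc m) *v u) = 0" using Suc unfolding mpow_Suc_vec f'M by simp
      ultimately show ?case by blast
    qed
    have bd: "norm ((1 / ?r ^ m) *\<^sub>R (mpow ?M m *v u)) \<le> (1/2) ^ m * norm u" for m
    proof -
      have "1 / ?r ^ m \<le> 2 ^ m"
        using power_mono[of "1/2" ?r m] k(2) by (simp add: field_simps power_divide)
      then have "(1 / ?r ^ m) * norm (mpow ?M m *v u) \<le> 2 ^ m * ((1/4) ^ m * norm u)"
        using pow[of m] k(2) by (intro mult_mono) auto
      also have "\<dots> = (1/2) ^ m * norm u"
      proof -
        have "(2::real) ^ m * (1/4) ^ m = (1/2) ^ m" by (simp flip: power_mult_distrib)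
        then show ?thesis by (simp add: mult.assoc[symmetric])
      qed
      finally show ?thesis using k(2) by simp
    qed
    have "(\<lambda>m. (1/2::real) ^ m * norm u) \<longlonglongrightarrow> 0"
      using tendsto_mult_right[OF LIMSEQ_realpow_zero[of "1/2"], of "norm u"] by simp
    then have "(\<lambda>m. (1 / ?r ^ m) *\<^sub>R (mpow ?M m *v u)) \<longlonglongrightarrow> 0"
      by (rule Lim_null_comparison[rotated]) (use bd in auto)
    from tendsto_add[OF this tendsto_const[of "(?f \<bullet> v) *\<^sub>R ?y"]]
    have "(\<lambda>m. (1 / ?r ^ m) *\<^sub>R (mpow ?M m *v u) + (?f \<bullet> v) *\<^sub>R ?y) \<longlonglongrightarrow> (?f \<bullet> v) *\<^sub>R ?y"
      by simp
    moreover have "(1 / ?r ^ m) *\<^sub>R (mpow ?M m *v u) + (?f \<bullet> v) *\<^sub>R ?y = (1 / ?r ^ m) *\<^sub>R (mpow ?M m *v v)" for m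
      using k(2) unfolding u_def
      by (simp add: matrix_vector_mult_diff_distrib matrix_vector_mult_scaleR mpow_eigenvector[OF My] algebra_simps)
    ultimately show "(\<lambda>m. (1 / ?r ^ m) *\<^sub>R (mpow ?M m *v v)) \<longlonglongrightarrow> (?f \<bullet> v) *\<^sub>R ?y" by simp
  qed
  with bad[of k] k(4) show False by blast
qed


subsection \<open>Projective space and its automorphisms\<close>

lemma pgl_rel_self: "invertible A \<Longrightarrow> pgl_rel A A"
  by (auto simp: pgl_rel_def intro!: exI[of _ "1::real"])

lemma proj_rel_self: "v \<noteq> 0 \<Longrightarrow> proj_rel v v"
  by (auto simp: proj_rel_def intro!: exI[of _ "1::real"])

lemma tvec_rel_self: "p \<noteq> 0 \<Longrightarrow> tvec_rel (p, u) (p, u)"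
proof -
  assume "p \<noteq> 0"
  moreover have "\<exists>c m. c \<noteq> 0 \<and> p = c *\<^sub>R p \<and> u = c *\<^sub>R u + m *\<^sub>R p"
    by (rule exI[of _ 1], rule exI[of _ 0]) simp
  ultimately show ?thesis by (simp add: tvec_rel_def)
qed

lemma pgl_act_proj: "invertible A \<Longrightarrow> v \<noteq> 0 \<Longrightarrow> pgl_act (pgl A) (proj v) = proj (A *v v)"
  by (simp add: pgl_act.abs_eq pgl_rel_self proj_rel_self)

lemma pgl_tact_tvec:
  "invertible A \<Longrightarrow> p \<noteq> 0 \<Longrightarrow> pgl_tact (pgl A) (tvec (p, u)) = tvec (A *v p, A *v u)"
  by (simp add: pgl_tact.abs_eq pgl_rel_self tvec_rel_self)

lemma tbase_tvec: "p \<noteq> 0 \<Longrightarrow> tbase (tvec (p, u)) = proj p"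
  by (simp add: tbase.abs_eq tvec_rel_self)

lemma tplane_tvec: "p \<noteq> 0 \<Longrightarrow> tplane (tvec (p, u)) = span {p, u}"
  by (simp add: tplane.abs_eq tvec_rel_self)

lemma tvec_eq_iff:
  assumes "p \<noteq> 0" "p' \<noteq> 0"
  shows "tvec (p, u) = tvec (p', u') \<longleftrightarrow> (\<exists>c m. c \<noteq> 0 \<and> p' = c *\<^sub>R p \<and> u' = c *\<^sub>R u + m *\<^sub>R p)"
proof -
  have "tvec (p, u) = tvec (p', u') \<longleftrightarrow> tvec_rel (p, u) (p', u')"
    using Quotient3_rel[OF Quotient3_ptangent, of "(p, u)" "(p', u')"] tvec_rel_self assms by blast
  then show ?thesis using assms by (simp add: tvec_rel_def)
qed

lemma tvec_cases: obtains p u where "p \<noteq> 0" "v = tvec (p, u)"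
proof -
  have "tvec_rel (rep_tvec v) (rep_tvec v)"
    by (rule Quotient3_rep_reflp[OF Quotient3_ptangent])
  moreover have "v = tvec (rep_tvec v)"
    by (simp add: Quotient3_abs_rep[OF Quotient3_ptangent])
  ultimately show ?thesis
    using that[of "fst (rep_tvec v)" "snd (rep_tvec v)"] by (auto simp: tvec_rel_def split: prod.splits)
qed

lemma pgl_eq_iff:
  assumes "invertible A" "invertible B"
  shows "pgl A = pgl B \<longleftrightarrow> (\<exists>c. c \<noteq> 0 \<and> B = c *\<^sub>R A)"
proof -
  have "pgl A = pgl B \<longleftrightarrow> pgl_rel A B"
    using Quotient3_rel[OF Quotient3_pgl, of A B] pgl_rel_self assms by blast
  then show ?thesis using assms by (simp add: pgl_rel_def)
qed

lemma scaleR_mult_matrix: "(c *\<^sub>R A) ** (d *\<^sub>R B) = (c * d) *\<^sub>R (A ** B)"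
  for A B :: "real^'n^'n"
  by (simp add: matrix_matrix_mult_def vec_eq_iff sum_distrib_left mult_ac)

lemma proj_scale: "c \<noteq> 0 \<Longrightarrow> v \<noteq> 0 \<Longrightarrow> proj (c *\<^sub>R v) = proj v"
  using proj_eq_iff[of v "c *\<^sub>R v"] by auto

lemma proj_minus: "v \<noteq> 0 \<Longrightarrow> proj (- v) = proj v"
  using proj_scale[of "- 1" v] by simp

lemma proj_eq_independent:
  assumes "p \<noteq> 0" "q \<noteq> 0" "proj p \<noteq> proj q" "\<alpha> *\<^sub>R p + \<beta> *\<^sub>R q = 0"
  shows "\<alpha> = 0 \<and> \<beta> = 0"
proof (rule ccontr)
  assume n: "\<not> ?thesis"
  then have \<beta>: "\<beta> \<noteq> 0" using assms(1,4) by auto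
  then have \<alpha>: "\<alpha> \<noteq> 0" using assms(2,4) by auto
  have "\<beta> *\<^sub>R q = - \<alpha> *\<^sub>R p" using assms(4) by (simp add: eq_neg_iff_add_eq_0 add.commute)
  from arg_cong[OF this, of "\<lambda>v. (1/\<beta>) *\<^sub>R v"] have "q = (- \<alpha> / \<beta>) *\<^sub>R p" using \<beta> by simp
  moreover have "- \<alpha> / \<beta> \<noteq> 0" using \<alpha> \<beta> by simp
  ultimately show False using assms(1-3) proj_eq_iff[of p q] by blast
qed

lemma pgl_scale: "invertible A \<Longrightarrow> c \<noteq> 0 \<Longrightarrow> invertible (c *\<^sub>R A) \<and> pgl (c *\<^sub>R A) = pgl A"
  for A :: "real^'n^'n"
proof -
  assume A: "invertible A" and c: "c \<noteq> 0"
  obtain B where B: "A ** B = mat 1" "B ** A = mat 1" using A by (auto simp: invertible_def)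
  have "(c *\<^sub>R A) ** ((1/c) *\<^sub>R B) = mat 1" "((1/c) *\<^sub>R B) ** (c *\<^sub>R A) = mat 1"
    using B c by (simp_all add: scaleR_mult_matrix)
  then have "invertible (c *\<^sub>R A)" by (auto simp: invertible_def)
  then show "invertible (c *\<^sub>R A) \<and> pgl (c *\<^sub>R A) = pgl A"
    using A c pgl_eq_iff[of A "c *\<^sub>R A"] by auto
qed

lemma PGL_mult: "invertible A \<Longrightarrow> invertible B \<Longrightarrow> pgl A \<otimes>\<^bsub>PGL\<^esub> pgl B = pgl (A ** B)"
  by (simp add: PGL_def pgl_mult.abs_eq pgl_rel_self)

lemma PGL_one: "\<one>\<^bsub>PGL\<^esub> = pgl (mat 1)"
  by (simp add: PGL_def pgl_one.abs_eq)

lemma carrier_PGL [simp]: "carrier PGL = UNIV"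
  by (simp add: PGL_def)

lemma PGL_inv:
  assumes "A ** B = mat 1" "B ** A = mat 1"
  shows "inv\<^bsub>PGL\<^esub> (pgl A) = pgl B"
proof -
  interpret group PGL by (rule group_PGL)
  have "invertible A" "invertible B" using assms by (auto simp: invertible_def)
  then show ?thesis
    using assms by (intro inv_equality) (simp_all add: PGL_mult PGL_one)
qed

lemma inverse_pair_invertible:
  "A ** B = mat 1 \<Longrightarrow> B ** A = mat 1 \<Longrightarrow> invertible A \<and> invertible B"
  for A B :: "'a::semiring_1^'n^'n"
  by (auto simp: invertible_def)

lemma inverse_pair_vec:
  "A ** B = mat 1 \<Longrightarrow> A *v (B *v v) = (v :: 'a::comm_semiring_1^'n)"
  by (simp add: matrix_vector_mul_assoc)

lemma open_proj_image:
  fixes S :: "(real^'n) set"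
  assumes "open S"
  shows "open (proj ` (S - {0}))"
proof -
  have "{v. v \<noteq> 0 \<and> proj v \<in> proj ` (S - {0})} = (\<Union>c\<in>-{0}. (\<lambda>v. c *\<^sub>R v) ` (S - {0}))"
  proof (intro subset_antisym subsetI)
    fix v assume "v \<in> {v. v \<noteq> 0 \<and> proj v \<in> proj ` (S - {0})}"
    then obtain u where u: "v \<noteq> 0" "u \<in> S" "u \<noteq> 0" "proj v = proj u" by auto
    then obtain c where "c \<noteq> 0" "v = c *\<^sub>R u" using proj_eq_iff[of u v] by auto
    then show "v \<in> (\<Union>c\<in>-{0}. (\<lambda>v. c *\<^sub>R v) ` (S - {0}))" using u by blast
  next
    fix v assume "v \<in> (\<Union>c\<in>-{0}. (\<lambda>v. c *\<^sub>R v) ` (S - {0}))"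
    then obtain c u where "c \<noteq> 0" "v = c *\<^sub>R u" "u \<in> S - {0}" by blast
    then show "v \<in> {v. v \<noteq> 0 \<and> proj v \<in> proj ` (S - {0})}" using proj_scale[of c u] by auto
  qed
  moreover have "open (\<Union>c\<in>-{0::real}. (\<lambda>v. c *\<^sub>R v) ` (S - {0}))"
    using assms by (intro open_UN ballI open_scaling open_Diff) auto
  ultimately show ?thesis unfolding open_projective_def by simp
qed

lemma open_proj_vimage: "open U \<Longrightarrow> open {v. v \<noteq> 0 \<and> proj v \<in> U}"
  by (simp add: open_projective_def)

lemma tendsto_proj:
  assumes "(f \<longlongrightarrow> v) F" "v \<noteq> 0"
  shows "((\<lambda>n. proj (f n)) \<longlongrightarrow> proj v) F"
proof (rule topological_tendstoI)
  fix U assume U: "open U" "proj v \<in> U"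
  have "\<forall>\<^sub>F n in F. f n \<in> {v. v \<noteq> 0 \<and> proj v \<in> U}"
    by (rule topological_tendstoD[OF assms(1) open_proj_vimage[OF U(1)]]) (use U assms in simp)
  then show "\<forall>\<^sub>F n in F. proj (f n) \<in> U" by eventually_elim simp
qed

lemma inner_zero_parallel:
  fixes h h' :: "'a::real_inner"
  assumes "h \<noteq> 0" "\<And>v. h \<bullet> v = 0 \<Longrightarrow> h' \<bullet> v = 0"
  shows "\<exists>c. h' = c *\<^sub>R h"
proof -
  define c where "c = (h' \<bullet> h) / (h \<bullet> h)"
  define u where "u = h' - c *\<^sub>R h"
  have hu: "h \<bullet> u = 0" using assms(1) by (simp add: u_def c_def inner_diff_right inner_commute)
  then have "u \<bullet> u = 0" using assms(2)[OF hu] by (simp add: u_def inner_diff_left inner_diff_right algebra_simps)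
  then show ?thesis by (auto simp: u_def)
qed

lemma projset_subspace_eq:
  assumes "subspace W" "subspace W'" "projset W = projset W'"
  shows "W = W'"
proof -
  have "W \<subseteq> W'" if W: "subspace W" "subspace W'" "projset W = projset W'" for W W' :: "(real^'n) set"
  proof
    fix v assume v: "v \<in> W"
    show "v \<in> W'"
    proof (cases "v = 0")
      case False
      then have "proj v \<in> projset W'" using v W(3) by (auto simp: projset_def)
      then obtain v' where "v' \<in> W'" "v' \<noteq> 0" "proj v = proj v'" by (auto simp: projset_def)
      then show ?thesis using False W(2) proj_eq_iff[of v' v] by (auto simp: subspace_scale)
    qed (use W(2) subspace_0 in auto)
  qed
  then show ?thesis using assms by (metis subset_antisym)
qed

subsection \<open>Proper convex cones\<close>

text \<open>The functional \<open>w\<close> is the affine chart: its positivity on the closure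
  encodes that the domain is bounded there, and it selects one of the two lifts of a point. The cone
  may be empty, hence the hypothesis \<open>C \<noteq> {}\<close> in later lemmas.\<close>

locale cone =
  fixes C :: "(real^'n) set" and w :: "real^'n"
  assumes open_C: "open C"
    and C_scale: "c > 0 \<Longrightarrow> v \<in> C \<Longrightarrow> c *\<^sub>R v \<in> C"
    and C_add: "u \<in> C \<Longrightarrow> v \<in> C \<Longrightarrow> u + v \<in> C"
    and w_pos: "v \<in> closure C \<Longrightarrow> v \<noteq> 0 \<Longrightarrow> w \<bullet> v > 0"
begin

definition K :: "(real^'n) set" where "K = closure C"

definition \<Omega> :: "'n projective set" where "\<Omega> = proj ` C"

lemma C_K: "v \<in> C \<Longrightarrow> v \<in> K"
  unfolding K_def using closure_subset by blast

lemma K_pos: "v \<in> K \<Longrightarrow> v \<noteq> 0 \<Longrightarrow> w \<bullet> v > 0"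
  using w_pos by (simp add: K_def)

lemma K_nonneg: "v \<in> K \<Longrightarrow> w \<bullet> v \<ge> 0"
  using K_pos[of v] by (cases "v = 0") auto

lemma closed_K: "closed K"
  by (simp add: K_def)

lemma zero_notin_C [simp]: "0 \<notin> C"
proof
  assume "0 \<in> C"
  then obtain e where e: "e > 0" "ball 0 e \<subseteq> C" using open_C open_contains_ball by blast
  define v :: "real^'n" where "v = (e / 2) *\<^sub>R axis undefined 1"
  have "norm v < e" using e by (simp add: v_def)
  then have "v \<in> C" "- v \<in> C" using e(2) by (auto simp: subset_eq)
  moreover have "v \<noteq> 0" using e by (simp add: v_def axis_eq_0_iff)
  ultimately show False using K_pos[of v] K_pos[of "- v"] C_K by fastforce
qed

lemma C_nonzero: "v \<in> C \<Longrightarrow> v \<noteq> 0"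
  by auto

lemma K_scale: "v \<in> K \<Longrightarrow> c \<ge> 0 \<Longrightarrow> c *\<^sub>R v \<in> K"
proof -
  assume v: "v \<in> K" and c: "c \<ge> 0"
  obtain x where x: "\<And>n. x n \<in> C" "x \<longlonglongrightarrow> v"
    using v unfolding K_def closure_sequential by blast
  \<comment> \<open>Shifted to be positive, since \<open>C\<close> is stable under strictly positive
    factors only and \<open>c = 0\<close> is allowed.\<close>
  define c' where "c' n = c + inverse (real (Suc n))" for n
  have "(\<lambda>n. c' n *\<^sub>R x n) \<longlonglongrightarrow> (c + 0) *\<^sub>R v"
    unfolding c'_def by (intro tendsto_intros x LIMSEQ_inverse_real_of_nat)
  moreover have "c' n *\<^sub>R x n \<in> C" for n
    using x c by (intro C_scale) (auto simp: c'_def add_nonneg_pos)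
  ultimately show "c *\<^sub>R v \<in> K"
    unfolding K_def closure_sequential by (intro exI[of _ "\<lambda>n. c' n *\<^sub>R x n"]) auto
qed

lemma K_add: "u \<in> K \<Longrightarrow> v \<in> K \<Longrightarrow> u + v \<in> K"
proof -
  assume "u \<in> K" "v \<in> K"
  then obtain x y where x: "\<And>n. x n \<in> C" "x \<longlonglongrightarrow> u" and y: "\<And>n. y n \<in> C" "y \<longlonglongrightarrow> v"
    unfolding K_def closure_sequential by blast
  then show "u + v \<in> K"
    unfolding K_def closure_sequential using C_add tendsto_add[OF x(2) y(2)]
    by (intro exI[of _ "\<lambda>n. x n + y n"]) auto
qed

text \<open>An element of \<open>K\<close> differs from one of \<open>C\<close> by an error that the
  open set \<open>C\<close> absorbs at \<open>u\<close>.\<close>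

lemma C_K_add: "u \<in> C \<Longrightarrow> v \<in> K \<Longrightarrow> u + v \<in> C"
proof -
  assume u: "u \<in> C" and v: "v \<in> K"
  obtain e where e: "e > 0" "ball u e \<subseteq> C" using u open_C open_contains_ball by blast
  obtain v' where v': "v' \<in> C" "dist v' v < e"
    using v e unfolding K_def closure_approachable by blast
  have "u + (v - v') \<in> C" using v' e by (intro subsetD[OF e(2)]) (simp add: dist_norm norm_minus_commute)
  from C_add[OF this v'(1)] show "u + v \<in> C" by simp
qed

lemma K_C_add: "u \<in> K \<Longrightarrow> v \<in> C \<Longrightarrow> u + v \<in> C"
  using C_K_add[of v u] by (simp add: add.commute)

lemma K_pointed: "v \<in> K \<Longrightarrow> - v \<in> K \<Longrightarrow> v = 0"
  using K_pos[of v] K_pos[of "- v"] by fastforce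

lemma K_sign: "v \<in> K \<Longrightarrow> c *\<^sub>R v \<in> K \<Longrightarrow> v \<noteq> 0 \<Longrightarrow> c \<ge> 0"
  using K_pos[of v] K_nonneg[of "c *\<^sub>R v"] by (simp add: zero_le_mult_iff)

lemma proj_mem_\<Omega>: "v \<noteq> 0 \<Longrightarrow> proj v \<in> \<Omega> \<longleftrightarrow> v \<in> C \<or> - v \<in> C"
proof
  assume v: "v \<noteq> 0" "proj v \<in> \<Omega>"
  then obtain u where u: "u \<in> C" "proj u = proj v" by (auto simp: \<Omega>_def)
  then obtain c where c: "c \<noteq> 0" "v = c *\<^sub>R u" using v proj_eq_iff[of u v] C_nonzero[OF u(1)] by metis
  then show "v \<in> C \<or> - v \<in> C"
    using C_scale[OF _ u(1), of c] C_scale[OF _ u(1), of "- c"] by (cases "c > 0") auto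
next
  assume "v \<noteq> 0" "v \<in> C \<or> - v \<in> C"
  moreover have "proj (- v) = proj v" if "v \<noteq> 0"
    using that by (rule proj_minus)
  ultimately show "proj v \<in> \<Omega>" unfolding \<Omega>_def by (metis imageI)
qed

lemma open_\<Omega>: "open \<Omega>"
  using open_proj_image[OF open_C] by (simp add: \<Omega>_def)

text \<open>If neither lift lies in \<open>K\<close>, the symmetric open set avoiding
  \<open>K\<close> and \<open>- K\<close> projects to a neighbourhood that misses
  \<open>\<Omega>\<close>; so points of the closure have a lift in \<open>K\<close>. Pointedness
  prevents one lift from being in \<open>K\<close> and the other in \<open>C\<close>.\<close>

lemma proj_mem_frontier:
  assumes v: "v \<noteq> 0"
  shows "proj v \<in> frontier \<Omega> \<longleftrightarrow> (v \<in> K - C \<or> - v \<in> K - C)"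
proof -
  have 1: "proj v \<in> closure \<Omega>" if "v \<in> K" "v \<noteq> 0" for v
  proof -
    have "\<exists>y\<in>\<Omega>. y \<in> U" if U: "open U" "proj v \<in> U" for U
    proof -
      have "C \<inter> {v. v \<noteq> 0 \<and> proj v \<in> U} \<noteq> {}"
        using \<open>v \<in> K\<close> \<open>v \<noteq> 0\<close> open_Int_closure_eq_empty[OF open_proj_vimage[OF U(1)], of C] U(2)
        unfolding K_def by blast
      then show ?thesis unfolding \<Omega>_def by blast
    qed
    then show ?thesis unfolding closure_iff_nhds_not_empty by blast
  qed
  have neg: "proj (- v) = proj v" using v by (rule proj_minus)
  have 2: "v \<in> K \<or> - v \<in> K" if cl: "proj v \<in> closure \<Omega>"
  proof (rule ccontr)
    assume not: "\<not> (v \<in> K \<or> - v \<in> K)"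
    define P where "P = (- K) \<inter> uminus ` (- K)"
    have P: "open P" unfolding P_def using closed_K by (intro open_Int open_negations) auto
    have "v \<in> P" using not unfolding P_def by (auto intro!: image_eqI[of _ _ "- v"])
    then have "proj v \<in> proj ` (P - {0})" using v by blast
    then have "proj ` (P - {0}) \<inter> \<Omega> \<noteq> {}"
      using cl open_Int_closure_eq_empty[OF open_proj_image[OF P], of \<Omega>] by blast
    then obtain u where u: "u \<in> P" "u \<noteq> 0" "proj u \<in> \<Omega>" by blast
    then have "u \<in> K \<or> - u \<in> K" using proj_mem_\<Omega> C_K by blast
    then show False using u(1) by (auto simp: P_def)
  qed
  have "proj v \<in> closure \<Omega> \<longleftrightarrow> v \<in> K \<or> - v \<in> K"
    using 1[of v] 1[of "- v"] 2 v neg by auto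
  moreover have "\<not> (v \<in> K \<and> - v \<in> C)" "\<not> (- v \<in> K \<and> v \<in> C)"
    using K_pointed[of v] C_K v by blast+
  ultimately show ?thesis
    using open_\<Omega> proj_mem_\<Omega>[OF v] C_K by (auto simp: frontier_def interior_open)
qed

section \<open>Pairs of boundary points joined through the cone\<close>

lemma comb_mem_C_pos:
  assumes a: "a \<in> K - C" "a \<noteq> 0" and b: "b \<in> K - C" and c: "\<alpha> *\<^sub>R a + \<beta> *\<^sub>R b \<in> C"
  shows "\<beta> > 0"
proof (rule ccontr)
  assume "\<not> \<beta> > 0"
  then have 1: "\<alpha> *\<^sub>R a \<in> C" using C_K_add[OF c, of "(- \<beta>) *\<^sub>R b"] K_scale[of b "- \<beta>"] b by simp
  then have "w \<bullet> (\<alpha> *\<^sub>R a) > 0" using K_pos[OF C_K] C_nonzero by blast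
  moreover have "w \<bullet> a > 0" using a K_pos[of a] by simp
  ultimately have "\<alpha> > 0" by (simp add: zero_less_mult_iff)
  then have "a \<in> C" using C_scale[OF _ 1, of "1 / \<alpha>"] by simp
  then show False using a by simp
qed

lemma K_minus_C_scale: "c > 0 \<Longrightarrow> v \<in> K - C \<Longrightarrow> c *\<^sub>R v \<in> K - C"
  using K_scale[of v c] C_scale[of "1/c" "c *\<^sub>R v"] by auto

text \<open>\<open>a\<close> lifts the backward and \<open>b\<close> the forward endpoint of a
  geodesic. The scale of \<open>a\<close> relative to \<open>b\<close> fixes the base point
  \<open>proj (a + b)\<close> on it.\<close>

definition pair :: "real^'n \<Rightarrow> real^'n \<Rightarrow> bool" where
  "pair a b \<longleftrightarrow> a \<in> K - C \<and> b \<in> K - C \<and> a + b \<in> C"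

lemma pair_commute: "pair a b \<longleftrightarrow> pair b a"
  by (auto simp: pair_def add.commute)

lemma pair_nonzero: assumes "pair a b" shows "a \<noteq> 0" "b \<noteq> 0" "a + b \<noteq> 0"
  using assms by (auto simp: pair_def dest: C_nonzero)

text \<open>The plane of a pair meets \<open>C\<close> in the open quadrant; all explicit
  computations on a geodesic rest on this.\<close>

lemma pair_comb:
  assumes "pair a b"
  shows "\<alpha> *\<^sub>R a + \<beta> *\<^sub>R b \<in> C \<longleftrightarrow> \<alpha> > 0 \<and> \<beta> > 0"
proof -
  have half: "\<beta> > 0" if ab: "pair a b" and c: "\<alpha> *\<^sub>R a + \<beta> *\<^sub>R b \<in> C" for a b \<alpha> \<beta>
    using comb_mem_C_pos[OF _ _ _ c] ab pair_nonzero[OF ab] by (simp add: pair_def)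
  have "\<alpha> *\<^sub>R a + \<beta> *\<^sub>R b \<in> C" if "\<alpha> > 0" "\<beta> > 0"
  proof -
    \<comment> \<open>Splitting off the smaller coefficient leaves a vector of \<open>C\<close> plus
      a vector of \<open>K\<close>.\<close>
    define m where "m = min \<alpha> \<beta>"
    have "m *\<^sub>R (a + b) + ((\<alpha> - m) *\<^sub>R a + (\<beta> - m) *\<^sub>R b) \<in> C"
      using that assms by (intro C_K_add[OF C_scale K_add[OF K_scale K_scale]]) (auto simp: pair_def m_def)
    then show ?thesis by (simp add: algebra_simps)
  qed
  then show ?thesis
    using half[OF assms, of \<alpha> \<beta>] half[of b a \<beta> \<alpha>] assms pair_commute by (auto simp: add.commute)
qed

text \<open>A relation could be added to \<open>a + b\<close> with any factor \<open>t\<close>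
  without leaving \<open>C\<close>; then \<open>pair_comb\<close> makes
  \<open>1 + t * \<alpha>\<close> and \<open>1 + t * \<beta>\<close> positive for all
  \<open>t\<close>.\<close>

lemma pair_independent:
  assumes "pair a b" "\<alpha> *\<^sub>R a + \<beta> *\<^sub>R b = 0" shows "\<alpha> = 0 \<and> \<beta> = 0"
proof -
  have "(1 + t * \<alpha>) *\<^sub>R a + (1 + t * \<beta>) *\<^sub>R b \<in> C" for t
  proof -
    have "(1 + t * \<alpha>) *\<^sub>R a + (1 + t * \<beta>) *\<^sub>R b = (a + b) + t *\<^sub>R (\<alpha> *\<^sub>R a + \<beta> *\<^sub>R b)"
      by (simp add: algebra_simps)
    then show ?thesis using assms by (simp add: pair_def)
  qed
  then have "1 + t * \<alpha> > 0" "1 + t * \<beta> > 0" for t using pair_comb[OF assms(1)] by blast+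
  from this(1)[of "- 1 / \<alpha>"] this(2)[of "- 1 / \<beta>"] show ?thesis by (auto split: if_splits)
qed

lemma Geod_pair:
  assumes "(\<xi>, \<eta>) \<in> Geod \<Omega>"
  obtains a b where "pair a b" "\<xi> = proj b" "\<eta> = proj a"
proof -
  have fr: "\<xi> \<in> frontier \<Omega>" "\<eta> \<in> frontier \<Omega>" and line: "proj_line \<xi> \<eta> \<inter> \<Omega> \<noteq> {}"
    using assms by (auto simp: Geod_def)
  have lift: "\<exists>v. v \<in> K - C \<and> v \<noteq> 0 \<and> \<zeta> = proj v" if "\<zeta> \<in> frontier \<Omega>" for \<zeta>
  proof -
    obtain v where v: "v \<noteq> 0" "\<zeta> = proj v" by (metis proj_cases)
    moreover have "proj (- v) = proj v" using v(1) by (rule proj_minus)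
    ultimately show ?thesis using that proj_mem_frontier[OF v(1)] by (metis neg_equal_0_iff_equal)
  qed
  obtain a b where a: "a \<in> K - C" "a \<noteq> 0" "\<eta> = proj a" and b: "b \<in> K - C" "b \<noteq> 0" "\<xi> = proj b"
    using lift fr by blast
  have rep: "\<exists>c. c \<noteq> 0 \<and> rep_proj (proj v) = c *\<^sub>R v" if "v \<noteq> 0" for v :: "real^'n"
    using Quotient3_rep_abs[OF Quotient3_projective proj_rel_self[OF that]]
    unfolding proj_rel_def by (metis scaleR_scaleR left_inverse scaleR_one inverse_nonzero_iff_nonzero)
  obtain ca cb where cab: "rep_proj \<eta> = ca *\<^sub>R a" "rep_proj \<xi> = cb *\<^sub>R b"
    using rep a b by metis
  obtain z where z: "z \<in> span {rep_proj \<xi>, rep_proj \<eta>}" "z \<noteq> 0" "proj z \<in> \<Omega>"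
    using line by (auto simp: proj_line_def projset_def)
  have "{rep_proj \<xi>, rep_proj \<eta>} \<subseteq> span {a, b}"
    unfolding cab using span_scale[OF span_base, of _ "{a, b}"] by blast
  then have "z \<in> span {a, b}" using z(1) span_minimal[OF _ subspace_span] by blast
  then have "\<exists>\<alpha> \<beta>. z = \<alpha> *\<^sub>R a + \<beta> *\<^sub>R b"
    by (auto simp: span_insert algebra_simps)
  moreover obtain z' where "z' \<in> C" "z' = z \<or> z' = - z" using z(3) proj_mem_\<Omega>[OF z(2)] by auto
  ultimately obtain \<alpha> \<beta> where z': "\<alpha> *\<^sub>R a + \<beta> *\<^sub>R b \<in> C"
    by (metis minus_add_distrib scaleR_minus_left)
  have pos: "\<alpha> > 0" "\<beta> > 0"
    using comb_mem_C_pos[OF a(1,2) b(1) z'] comb_mem_C_pos[OF b(1,2) a(1), of \<beta> \<alpha>] z' by (simp_all add: add.commute)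
  \<comment> \<open>Raising both coefficients to their maximum stays in \<open>C\<close> and gives a
    multiple of \<open>a + b\<close>, so the lifts already chosen form a pair.\<close>
  define m where "m = max \<alpha> \<beta>"
  have "(\<alpha> *\<^sub>R a + \<beta> *\<^sub>R b) + ((m - \<alpha>) *\<^sub>R a + (m - \<beta>) *\<^sub>R b) \<in> C"
    using z' a b pos by (intro C_K_add[OF _ K_add[OF K_scale K_scale]]) (auto simp: m_def)
  also have "(\<alpha> *\<^sub>R a + \<beta> *\<^sub>R b) + ((m - \<alpha>) *\<^sub>R a + (m - \<beta>) *\<^sub>R b) = m *\<^sub>R (a + b)"
    by (simp add: algebra_simps)
  finally have "m *\<^sub>R (a + b) \<in> C" .
  moreover have "m > 0" using pos by (simp add: m_def)
  ultimately have "a + b \<in> C" using C_scale[of "1/m" "m *\<^sub>R (a + b)"] by simp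
  then show ?thesis using that[of a b] a b by (simp add: pair_def)
qed

section \<open>Supporting functionals, smooth points and extremal points\<close>

definition supports :: "real^'n \<Rightarrow> real^'n \<Rightarrow> bool" where
  "supports h b \<longleftrightarrow> h \<noteq> 0 \<and> (\<forall>v\<in>K. h \<bullet> v \<ge> 0) \<and> h \<bullet> b = 0"

definition smooth :: "real^'n \<Rightarrow> bool" where
  "smooth b \<longleftrightarrow> (\<forall>h h'. supports h b \<and> supports h' b \<longrightarrow> (\<exists>c. h' = c *\<^sub>R h))"

text \<open>The condition on \<open>p\<close> says that the segment from \<open>b\<close> to
  \<open>p\<close> stays in the boundary. Segments starting at \<open>b\<close> suffice, because a
  boundary segment through \<open>b\<close> contains those from \<open>b\<close> to its two
  ends.\<close>

definition extremal :: "real^'n \<Rightarrow> bool" where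
  "extremal b \<longleftrightarrow> (\<forall>p\<in>K. (\<forall>t\<ge>0. b + t *\<^sub>R p \<notin> C) \<longrightarrow> (\<exists>c. p = c *\<^sub>R b))"

lemma nonneg_functional_pos:
  assumes "h \<noteq> 0" "\<And>v. v \<in> C \<Longrightarrow> h \<bullet> v \<ge> 0" "v \<in> C"
  shows "h \<bullet> v > 0"
proof -
  obtain e where e: "e > 0" "ball v e \<subseteq> C" using assms(3) open_C open_contains_ball by blast
  \<comment> \<open>A step of length \<open>e / 2\<close> against \<open>h\<close> stays in the ball
    and lowers \<open>h\<close> by a positive amount.\<close>
  define s where "s = e / (2 * norm h)"
  have s: "s > 0" using e assms(1) by (simp add: s_def)
  have "v - s *\<^sub>R h \<in> C"
    using e assms(1) by (intro subsetD[OF e(2)]) (simp add: dist_norm s_def)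
  from assms(2)[OF this] have "h \<bullet> v \<ge> s * (h \<bullet> h)" by (simp add: inner_diff_right)
  moreover have "s * (h \<bullet> h) > 0" using s assms(1) by simp
  ultimately show ?thesis by linarith
qed

lemma supports_pos: "supports h b \<Longrightarrow> v \<in> C \<Longrightarrow> h \<bullet> v > 0"
  using nonneg_functional_pos C_K by (auto simp: supports_def)

lemma nonneg_on_K: assumes "\<And>v. v \<in> C \<Longrightarrow> h \<bullet> v \<ge> 0" "v \<in> K" shows "h \<bullet> v \<ge> 0"
proof -
  have "closed {v. 0 \<le> h \<bullet> v}" by (intro closed_Collect_le continuous_intros)
  then have "K \<subseteq> {v. 0 \<le> h \<bullet> v}" unfolding K_def using assms(1) by (intro closure_minimal) auto
  then show ?thesis using assms(2) by blast
qed

text \<open>Separation yields only an affine bound \<open>c\<close>. Scaling a point of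
  \<open>C\<close> towards 0 shows \<open>c \<le> 0\<close>, and scaling it towards infinity shows
  that the functional is nonnegative on \<open>C\<close>.\<close>

lemma supports_exists:
  assumes b: "b \<in> K - C"
  shows "\<exists>h. supports h b"
proof -
  have "C \<noteq> {}" using b by (auto simp: K_def)
  moreover have "convex C"
    by (rule convexI) (metis C_add C_scale add_0 less_eq_real_def scale_zero_left add.right_neutral mult_zero_left not_one_le_zero order_refl)
  ultimately obtain h c where h: "h \<noteq> 0" "h \<bullet> b \<le> c" "\<And>x. x \<in> C \<Longrightarrow> c \<le> h \<bullet> x"
    using separating_hyperplane_sets[of "{b}" C] b by auto
  have lim: "(\<lambda>n. inverse (real (Suc n)) * r) \<longlonglongrightarrow> 0" for r
    using tendsto_mult_right[OF LIMSEQ_inverse_real_of_nat, of r] by simp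
  have c: "c \<le> 0"
  proof -
    obtain x where x: "x \<in> C" using \<open>C \<noteq> {}\<close> by blast
    have "c \<le> inverse (real (Suc n)) * (h \<bullet> x)" for n
      using h(3)[OF C_scale[OF _ x, of "inverse (real (Suc n))"]] by simp
    then show ?thesis using LIMSEQ_le_const[OF lim] by blast
  qed
  have pos: "h \<bullet> x \<ge> 0" if "x \<in> C" for x
  proof -
    have "inverse (real (Suc n)) * c \<le> h \<bullet> x" for n
      using h(3)[OF C_scale[OF _ that, of "real (Suc n)"]] by (simp add: field_simps del: of_nat_Suc)
    then show ?thesis using LIMSEQ_le_const2[OF lim] by blast
  qed
  then have "h \<bullet> b \<ge> 0" using b nonneg_on_K by blast
  then have "h \<bullet> b = 0" using h(2) c by linarith
  then show ?thesis using h(1) nonneg_on_K[OF pos] by (auto simp: supports_def)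
qed

lemma supports_hyperplane:
  assumes h: "supports h b" and b: "b \<noteq> 0"
  shows "supporting_hyperplane \<Omega> (proj b) (projset {v. h \<bullet> v = 0})"
proof -
  have "projset {v. h \<bullet> v = 0} \<inter> \<Omega> = {}"
  proof (rule ccontr)
    assume "\<not> ?thesis"
    then obtain v where "v \<noteq> 0" "h \<bullet> v = 0" "proj v \<in> \<Omega>" by (auto simp: projset_def)
    then show False using proj_mem_\<Omega>[of v] supports_pos[OF h, of v] supports_pos[OF h, of "- v"] by auto
  qed
  moreover have "projective_hyperplane (projset {v. h \<bullet> v = 0})"
    unfolding projective_hyperplane_def
    using h by (intro exI[of _ "{v. h \<bullet> v = 0}"]) (auto simp: subspace_hyperplane dim_hyperplane supports_def)
  ultimately show ?thesis
    using h b by (auto simp: supporting_hyperplane_def projset_def supports_def)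
qed

text \<open>A linear form defining the hyperplane has no zero on the convex set \<open>C\<close>,
  hence constant sign there, and can be oriented.\<close>

lemma supporting_hyperplane_supports:
  assumes H: "supporting_hyperplane \<Omega> (proj b) H" and b: "b \<noteq> 0"
  shows "\<exists>h. supports h b \<and> H = projset {v. h \<bullet> v = 0}"
proof -
  obtain W where W: "subspace W" "dim W + 1 = CARD('n)" "H = projset W"
    using H by (auto simp: supporting_hyperplane_def projective_hyperplane_def)
  have "dim W < DIM(real^'n)" using W(2) by simp
  then obtain h where h: "h \<noteq> 0" "span W \<subseteq> {v. h \<bullet> v = 0}" using lowdim_subset_hyperplane by metis
  have "W = {v. h \<bullet> v = 0}"
  proof (rule subspace_dim_equal)
    show "W \<subseteq> {v. h \<bullet> v = 0}" using h(2) span_superset by blast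
    show "dim {v. h \<bullet> v = 0} \<le> dim W" using W(2) h(1) by (simp add: dim_hyperplane)
  qed (use W subspace_hyperplane in auto)
  note W' = this
  have C0: "h \<bullet> v \<noteq> 0" if "v \<in> C" for v
    using H that C_nonzero[OF that] unfolding supporting_hyperplane_def W(3) W' projset_def \<Omega>_def by blast
  have "proj b \<in> projset W" using H W(3) by (simp add: supporting_hyperplane_def)
  then obtain b' where "b' \<in> W" "b' \<noteq> 0" "proj b = proj b'" by (auto simp: projset_def)
  then have hb: "h \<bullet> b = 0" using b proj_eq_iff[of b' b] by (auto simp: W')
  have sign: "(h \<bullet> u > 0) = (h \<bullet> v > 0)" if u: "u \<in> C" and v: "v \<in> C" for u v
  proof (rule ccontr)
    assume "\<not> ?thesis"
    then have opp: "(h \<bullet> u) * (h \<bullet> v) < 0" using C0[OF u] C0[OF v] by (auto simp: mult_less_0_iff not_less_iff_gr_or_eq)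
    \<comment> \<open>With these weights, values of opposite sign cancel.\<close>
    have "\<bar>h \<bullet> v\<bar> *\<^sub>R u + \<bar>h \<bullet> u\<bar> *\<^sub>R v \<in> C" using u v C0 by (intro C_add C_scale) auto
    from C0[OF this] show False using opp by (auto simp: inner_add_right mult_less_0_iff)
  qed
  define h' where "h' = (if \<exists>v\<in>C. h \<bullet> v > 0 then h else - h)"
  have "h' \<bullet> v \<ge> 0" if "v \<in> C" for v
  proof (cases "\<exists>u\<in>C. h \<bullet> u > 0")
    case True
    then obtain u where "u \<in> C" "h \<bullet> u > 0" by blast
    then have "h \<bullet> v > 0" using sign[OF that] by blast
    then show ?thesis using True by (simp add: h'_def)
  next
    case False
    then have "h \<bullet> v \<le> 0" using that by (simp add: not_less)
    then show ?thesis using False by (simp add: h'_def)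
  qed
  then have "supports h' b" using nonneg_on_K h(1) hb by (auto simp: supports_def h'_def)
  moreover have "{v. h' \<bullet> v = 0} = W" by (auto simp: W' h'_def)
  ultimately show ?thesis using W(3) by metis
qed

lemma smooth_point_iff:
  assumes b: "b \<in> K - C" "b \<noteq> 0"
  shows "smooth_point \<Omega> (proj b) \<longleftrightarrow> smooth b"
proof -
  have fr: "proj b \<in> frontier \<Omega>" using b proj_mem_frontier by blast
  obtain h0 where h0: "supports h0 b" using supports_exists b by blast
  show ?thesis
  proof
    assume L: "smooth_point \<Omega> (proj b)"
    show "smooth b" unfolding smooth_def
    proof (intro allI impI, elim conjE)
      fix h h' assume h: "supports h b" "supports h' b"
      then have "projset {v. h \<bullet> v = 0} = projset {v. h' \<bullet> v = 0}"
        using L supports_hyperplane[OF _ b(2)] unfolding smooth_point_def by blast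
      then have "{v. h \<bullet> v = 0} = {v. h' \<bullet> v = 0}"
        using projset_subspace_eq subspace_hyperplane by blast
      then show "\<exists>c. h' = c *\<^sub>R h" using h by (intro inner_zero_parallel) (auto simp: supports_def)
    qed
  next
    assume R: "smooth b"
    have "H = projset {v. h0 \<bullet> v = 0}" if H: "supporting_hyperplane \<Omega> (proj b) H" for H
    proof -
      obtain h where h: "supports h b" "H = projset {v. h \<bullet> v = 0}"
        using supporting_hyperplane_supports[OF H b(2)] by blast
      then obtain c where c: "h = c *\<^sub>R h0" using R h0 by (auto simp: smooth_def)
      with h(1) have "c \<noteq> 0" by (auto simp: supports_def)
      then show ?thesis using h(2) c by simp
    qed
    then show "smooth_point \<Omega> (proj b)"
      using fr supports_hyperplane[OF h0 b(2)] by (auto simp: smooth_point_def)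
  qed
qed

text \<open>The difficulty lies in the signs, since \<open>proj_segment\<close> is given by
  arbitrary lifts \<open>p\<close> and \<open>q\<close>. As \<open>w\<close> has no zero along the
  lifted segment, one common sign moves both ends into \<open>K\<close>.\<close>

lemma strongly_extremal_iff:
  assumes b: "b \<in> K - C" "b \<noteq> 0"
  shows "strongly_extremal \<Omega> (proj b) \<longleftrightarrow> extremal b"
proof
  assume L: "strongly_extremal \<Omega> (proj b)"
  show "extremal b" unfolding extremal_def
  proof (intro ballI impI, rule ccontr)
    fix p assume p: "p \<in> K" "\<forall>t\<ge>0. b + t *\<^sub>R p \<notin> C" and np: "\<not> (\<exists>c. p = c *\<^sub>R b)"
    have p0: "p \<noteq> 0" using np by (metis scale_zero_left)
    have "proj b \<noteq> proj p" using np b(2) p0 by (auto simp: proj_eq_iff)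
    moreover have "proj z \<in> frontier \<Omega>" if z: "z \<in> closed_segment b p" for z
    proof -
      obtain s where s: "0 \<le> s" "s \<le> 1" "z = (1 - s) *\<^sub>R b + s *\<^sub>R p" using z by (auto simp: in_segment)
      have zK: "z \<in> K" unfolding s(3) using s b p by (intro K_add K_scale) auto
      have z0: "z \<noteq> 0"
      proof
        assume "z = 0"
        then have eq: "s *\<^sub>R p = (s - 1) *\<^sub>R b" using s(3) by (simp add: algebra_simps eq_neg_iff_add_eq_0)
        have "s \<noteq> 0" using eq b(2) by auto
        then have "p = ((s - 1) / s) *\<^sub>R b" using arg_cong[OF eq, of "\<lambda>v. (1/s) *\<^sub>R v"] by simp
        then show False using np by blast
      qed
      have "z \<notin> C"
      proof
        assume zC: "z \<in> C"
        show False
        proof (cases "s = 1")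
          case True
          then have "p \<in> C" using zC s(3) by simp
          then have "b + p \<in> C" using b K_C_add by blast
          then show False using p(2)[rule_format, of 1] by simp
        next
          case False
          then have "(1 / (1 - s)) *\<^sub>R z \<in> C" using zC s by (intro C_scale) auto
          moreover have "(1 / (1 - s)) *\<^sub>R z = b + (s / (1 - s)) *\<^sub>R p"
            using False by (simp add: s(3) scaleR_add_right)
          ultimately show False using p(2)[rule_format, of "s / (1 - s)"] s False by auto
        qed
      qed
      then show ?thesis using zK z0 proj_mem_frontier by blast
    qed
    then have "proj_segment b p \<subseteq> frontier \<Omega>" by (auto simp: proj_segment_def)
    moreover have "proj b \<in> proj_segment b p" by (auto simp: proj_segment_def)
    ultimately show False using L b(2) p0 unfolding strongly_extremal_def by blast
  qed
next
  assume R: "extremal b"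
  have False if pq: "p \<noteq> 0" "q \<noteq> 0" "proj p \<noteq> proj q" "proj b \<in> proj_segment p q"
    "proj_segment p q \<subseteq> frontier \<Omega>" for p q
  proof -
    define z where "z s = (1 - s) *\<^sub>R p + s *\<^sub>R q" for s
    have seg: "z s \<in> closed_segment p q" if "0 \<le> s" "s \<le> 1" for s
      using that by (auto simp: in_segment z_def)
    have z0: "\<alpha> *\<^sub>R p + \<beta> *\<^sub>R q \<noteq> 0" if "\<alpha> \<noteq> 0 \<or> \<beta> \<noteq> 0" for \<alpha> \<beta>
      using proj_eq_independent[OF pq(1-3)] that by blast
    have zK: "z s \<in> K - C \<or> - z s \<in> K - C" if "0 \<le> s" "s \<le> 1" for s
    proof -
      have "z s \<noteq> 0" unfolding z_def using z0[of "1 - s" s] by force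
      moreover have "proj (z s) \<in> frontier \<Omega>" using pq(5) seg[OF that] by (auto simp: proj_segment_def)
      ultimately show ?thesis using proj_mem_frontier by blast
    qed
    have wz: "w \<bullet> z s \<noteq> 0" if "0 \<le> s" "s \<le> 1" for s
    proof -
      have "z s \<noteq> 0" unfolding z_def using z0[of "1 - s" s] by force
      then show ?thesis using zK[OF that] K_pos[of "z s"] K_pos[of "- z s"] by auto
    qed
    define \<sigma> :: real where "\<sigma> = (if w \<bullet> p > 0 then 1 else - 1)"
    have \<sigma>: "\<sigma> = 1 \<or> \<sigma> = - 1" by (simp add: \<sigma>_def)
    have wp: "w \<bullet> (\<sigma> *\<^sub>R p) > 0" using wz[of 0] by (auto simp: \<sigma>_def z_def)
    have wq: "w \<bullet> (\<sigma> *\<^sub>R q) > 0"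
    proof (rule ccontr)
      assume n: "\<not> ?thesis"
      \<comment> \<open>The zero of the affine function \<open>w \<bullet> z s\<close>, which would
        lie in the unit interval if the ends had opposite signs.\<close>
      define s where "s = w \<bullet> (\<sigma> *\<^sub>R p) / (w \<bullet> (\<sigma> *\<^sub>R p) - w \<bullet> (\<sigma> *\<^sub>R q))"
      have d: "w \<bullet> (\<sigma> *\<^sub>R p) - w \<bullet> (\<sigma> *\<^sub>R q) > 0" using n wp by linarith
      then have "0 \<le> s" "s \<le> 1" unfolding s_def using n wp by (simp_all add: field_simps)
      moreover have "w \<bullet> z s = 0"
      proof -
        have "\<sigma> * (w \<bullet> z s) = w \<bullet> (\<sigma> *\<^sub>R p) - s * (w \<bullet> (\<sigma> *\<^sub>R p) - w \<bullet> (\<sigma> *\<^sub>R q))"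
          by (simp add: z_def inner_add_right inner_diff_right algebra_simps)
        moreover have "s * (w \<bullet> (\<sigma> *\<^sub>R p) - w \<bullet> (\<sigma> *\<^sub>R q)) = w \<bullet> (\<sigma> *\<^sub>R p)"
          unfolding s_def using d by (intro nonzero_eq_divide_eq[THEN iffD1]) auto
        ultimately show ?thesis using \<sigma> by auto
      qed
      ultimately show False using wz by blast
    qed
    have cone_pq: "\<alpha> *\<^sub>R (\<sigma> *\<^sub>R p) + \<beta> *\<^sub>R (\<sigma> *\<^sub>R q) \<in> K - C" if ab: "\<alpha> \<ge> 0" "\<beta> \<ge> 0" "\<alpha> + \<beta> > 0" for \<alpha> \<beta>
    proof -
      define s where "s = \<beta> / (\<alpha> + \<beta>)"
      have s: "0 \<le> s" "s \<le> 1" using ab by (simp_all add: s_def)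
      have eq: "\<alpha> *\<^sub>R (\<sigma> *\<^sub>R p) + \<beta> *\<^sub>R (\<sigma> *\<^sub>R q) = (\<alpha> + \<beta>) *\<^sub>R (\<sigma> *\<^sub>R z s)"
      proof -
        have "(\<alpha> + \<beta>) * (\<sigma> * (1 - s)) = \<alpha> * \<sigma>" "(\<alpha> + \<beta>) * (\<sigma> * s) = \<beta> * \<sigma>"
          using ab by (simp_all add: s_def field_simps)
        then show ?thesis by (simp only: z_def scaleR_add_right scaleR_scaleR)
      qed
      have "w \<bullet> (\<sigma> *\<^sub>R z s) \<ge> 0"
      proof -
        have "w \<bullet> (\<sigma> *\<^sub>R z s) = (1 - s) * (w \<bullet> (\<sigma> *\<^sub>R p)) + s * (w \<bullet> (\<sigma> *\<^sub>R q))"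
          by (simp add: z_def inner_add_right inner_diff_right algebra_simps)
        then show ?thesis using wp wq s by simp
      qed
      then have "- (\<sigma> *\<^sub>R z s) \<notin> K"
        using K_nonneg[of "- (\<sigma> *\<^sub>R z s)"] wz[OF s] \<sigma> by auto
      then have *: "\<sigma> *\<^sub>R z s \<in> K - C" using zK[OF s] \<sigma> by auto
      have "(\<alpha> + \<beta>) *\<^sub>R (\<sigma> *\<^sub>R z s) \<notin> C"
      proof
        assume "(\<alpha> + \<beta>) *\<^sub>R (\<sigma> *\<^sub>R z s) \<in> C"
        from C_scale[OF _ this, of "1 / (\<alpha> + \<beta>)"] ab * show False by simp
      qed
      then show ?thesis unfolding eq using * K_scale[of "\<sigma> *\<^sub>R z s" "\<alpha> + \<beta>"] ab by simp
    qed
    obtain s where s: "0 \<le> s" "s \<le> 1" "proj b = proj (z s)"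
      using pq(4) by (auto simp: proj_segment_def in_segment z_def)
    have zs: "\<sigma> *\<^sub>R z s \<in> K" "z s \<noteq> 0"
      using cone_pq[of "1 - s" s] s z0[of "1 - s" s] by (auto simp: z_def scaleR_add_right mult.commute)
    obtain c where c: "c \<noteq> 0" "b = c *\<^sub>R z s" using s(3) proj_eq_iff[of "z s" b] zs(2) b(2) by auto
    define k where "k = c * \<sigma>"
    have bk: "b = k *\<^sub>R (\<sigma> *\<^sub>R z s)" using c \<sigma> by (auto simp: k_def)
    have "k \<ge> 0" using K_sign[OF zs(1), of k] bk b zs(2) \<sigma> by auto
    moreover have "k \<noteq> 0" using c \<sigma> by (auto simp: k_def)
    ultimately have k: "k > 0" by simp
    \<comment> \<open>As \<open>b\<close> lies in the cone over the segment, adding a nonnegative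
      multiple of either end stays in that cone and so outside \<open>C\<close>; extremality then
      makes both ends multiples of \<open>b\<close>.\<close>
    have bpq: "b = (k * (1 - s)) *\<^sub>R (\<sigma> *\<^sub>R p) + (k * s) *\<^sub>R (\<sigma> *\<^sub>R q)"
      unfolding bk z_def by (simp add: scaleR_add_right mult_ac)
    have pos: "k * (1 - s) \<ge> 0" "k * s \<ge> 0" "k * (1 - s) + k * s > 0" using k s by (simp_all add: algebra_simps)
    have "b + t *\<^sub>R (\<sigma> *\<^sub>R p) \<notin> C" "b + t *\<^sub>R (\<sigma> *\<^sub>R q) \<notin> C" if "t \<ge> 0" for t
    proof -
      have "b + t *\<^sub>R (\<sigma> *\<^sub>R p) = (k * (1 - s) + t) *\<^sub>R (\<sigma> *\<^sub>R p) + (k * s) *\<^sub>R (\<sigma> *\<^sub>R q)"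
        by (subst bpq) (simp only: scaleR_add_left add_ac)
      then show "b + t *\<^sub>R (\<sigma> *\<^sub>R p) \<notin> C" using cone_pq[of "k * (1 - s) + t" "k * s"] pos that by simp
      have "b + t *\<^sub>R (\<sigma> *\<^sub>R q) = (k * (1 - s)) *\<^sub>R (\<sigma> *\<^sub>R p) + (k * s + t) *\<^sub>R (\<sigma> *\<^sub>R q)"
        by (subst bpq) (simp only: scaleR_add_left add_ac)
      then show "b + t *\<^sub>R (\<sigma> *\<^sub>R q) \<notin> C" using cone_pq[of "k * (1 - s)" "k * s + t"] pos that by simp
    qed
    moreover have "\<sigma> *\<^sub>R p \<in> K" "\<sigma> *\<^sub>R q \<in> K" using cone_pq[of 1 0] cone_pq[of 0 1] by simp_all
    ultimately obtain c1 c2 where c12: "\<sigma> *\<^sub>R p = c1 *\<^sub>R b" "\<sigma> *\<^sub>R q = c2 *\<^sub>R b"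
      using R unfolding extremal_def by blast
    have "(c2 * \<sigma>) *\<^sub>R p + (- c1 * \<sigma>) *\<^sub>R q = c2 *\<^sub>R (\<sigma> *\<^sub>R p) - c1 *\<^sub>R (\<sigma> *\<^sub>R q)" by simp
    also have "\<dots> = 0" unfolding c12 by simp
    finally have "c2 * \<sigma> = 0 \<and> - c1 * \<sigma> = 0" using z0 by blast
    then have "\<sigma> *\<^sub>R q = 0" using c12(2) \<sigma> by auto
    then show False using pq(2) \<sigma> by auto
  qed
  moreover have "proj b \<in> frontier \<Omega>" using b proj_mem_frontier by blast
  ultimately show "strongly_extremal \<Omega> (proj b)" unfolding strongly_extremal_def by blast
qed

section \<open>Linear lifts of automorphisms\<close>

definition preserves :: "real^'n^'n \<Rightarrow> bool" where
  "preserves A \<longleftrightarrow> (\<forall>v\<in>C. A *v v \<in> C)"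

lemma preserves_K: "preserves A \<Longrightarrow> v \<in> K \<Longrightarrow> A *v v \<in> K"
proof -
  assume A: "preserves A" and "v \<in> K"
  then obtain x where x: "\<And>n. x n \<in> C" "x \<longlonglongrightarrow> v" unfolding K_def closure_sequential by blast
  then show "A *v v \<in> K"
    unfolding K_def closure_sequential using A tendsto_matrix_vector_mult[OF tendsto_const x(2)]
    by (intro exI[of _ "\<lambda>n. A *v x n"]) (auto simp: preserves_def)
qed

lemma preserves_mult: "preserves A \<Longrightarrow> preserves B \<Longrightarrow> preserves (A ** B)"
  by (simp add: preserves_def flip: matrix_vector_mul_assoc)

lemma preserves_mpow: "preserves A \<Longrightarrow> preserves (mpow A n)"
  by (induction n) (simp_all add: preserves_mult preserves_def[of "mat 1"])

text \<open>A lift maps \<open>C\<close> into the union of \<open>C\<close> and \<open>- C\<close>.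
  Both signs cannot occur, because a suitable positive combination of two such points would be sent
  into the kernel of \<open>w\<close>; so one of the two choices of sign preserves
  \<open>C\<close>.\<close>

lemma Aut_lift:
  assumes g: "g \<in> Aut \<Omega>" and ne: "C \<noteq> {}"
  obtains A B where "g = pgl A" "A ** B = mat 1" "B ** A = mat 1" "preserves A" "preserves B"
proof -
  obtain A where A: "invertible A" "g = pgl A" by (metis pgl_cases)
  obtain B where B: "A ** B = mat 1" "B ** A = mat 1" using A(1) by (auto simp: invertible_def)
  have img: "pgl_act g ` \<Omega> = \<Omega>" using g by (simp add: Aut_def)
  have AC: "A *v v \<in> C \<or> - (A *v v) \<in> C" if v: "v \<in> C" for v
  proof -
    have "pgl_act g (proj v) \<in> \<Omega>" using img v by (auto simp: \<Omega>_def)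
    then show ?thesis
      using A v C_nonzero[OF v] by (simp add: pgl_act_proj proj_mem_\<Omega> invertible_vector_nonzero)
  qed
  have "(\<forall>v\<in>C. A *v v \<in> C) \<or> (\<forall>v\<in>C. - (A *v v) \<in> C)"
  proof (rule ccontr)
    assume "\<not> ?thesis"
    then obtain u v where u: "u \<in> C" "- (A *v u) \<in> C" and v: "v \<in> C" "A *v v \<in> C" using AC by blast
    \<comment> \<open>The weights are chosen so that the two contributions to
      \<open>w \<bullet> (A *v z)\<close> cancel.\<close>
    define z where "z = (w \<bullet> (A *v v)) *\<^sub>R u + (w \<bullet> (- (A *v u))) *\<^sub>R v"
    have "w \<bullet> (A *v v) > 0" "w \<bullet> (- (A *v u)) > 0" using u v K_pos C_K C_nonzero by blast+
    then have "z \<in> C" unfolding z_def using u v by (intro C_add C_scale) auto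
    moreover have "w \<bullet> (A *v z) = 0"
      by (simp add: z_def matrix_vector_mult_diff_distrib matrix_vector_mult_scaleR inner_diff_right)
    ultimately show False
      using AC[of z] K_pos[OF C_K, of "A *v z"] K_pos[OF C_K, of "- (A *v z)"] C_nonzero by fastforce
  qed
  then obtain \<sigma> where \<sigma>: "\<sigma> = 1 \<or> \<sigma> = - (1::real)" and pA: "\<And>v. v \<in> C \<Longrightarrow> \<sigma> *\<^sub>R (A *v v) \<in> C"
    by (metis scaleR_minus1_left scaleR_one)
  have "preserves (\<sigma> *\<^sub>R A)" using pA by (simp add: preserves_def scaleR_matrix_vector)
  moreover have "preserves (\<sigma> *\<^sub>R B)" unfolding preserves_def
  proof
    fix v assume v: "v \<in> C"
    then have "proj v \<in> pgl_act g ` \<Omega>" using img by (auto simp: \<Omega>_def)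
    then obtain u where u: "u \<in> C" "pgl_act g (proj u) = proj v" by (auto simp: \<Omega>_def)
    then have "proj v = proj (\<sigma> *\<^sub>R (A *v u))"
      using A \<sigma> C_nonzero[OF u(1)] invertible_vector_nonzero[OF A(1), of u]
      by (auto simp: pgl_act_proj proj_minus)
    then obtain c where c: "\<sigma> *\<^sub>R (A *v u) = c *\<^sub>R v" "c \<noteq> 0"
      using proj_eq_iff[of v "\<sigma> *\<^sub>R (A *v u)"] C_nonzero v pA[OF u(1)] by metis
    have "c \<ge> 0" using K_sign[of v c] C_K v pA[OF u(1)] c C_nonzero by metis
    then have c': "c > 0" using c(2) by simp
    have "\<sigma> *\<^sub>R u = c *\<^sub>R (B *v v)"
      using arg_cong[OF c(1), of "\<lambda>x. B *v x"] by (simp add: matrix_vector_mult_scaleR inverse_pair_vec[OF B(2)])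
    moreover have "\<sigma> *\<^sub>R (B *v v) = (\<sigma> / c) *\<^sub>R (c *\<^sub>R (B *v v))" using c' by simp
    ultimately have "\<sigma> *\<^sub>R (B *v v) = (\<sigma> * \<sigma> / c) *\<^sub>R u" by (metis scaleR_scaleR times_divide_eq_left)
    then show "(\<sigma> *\<^sub>R B) *v v \<in> C" using C_scale[OF _ u(1), of "\<sigma> * \<sigma> / c"] \<sigma> c' by (auto simp: scaleR_matrix_vector)
  qed
  moreover have "(\<sigma> *\<^sub>R A) ** (\<sigma> *\<^sub>R B) = mat 1" "(\<sigma> *\<^sub>R B) ** (\<sigma> *\<^sub>R A) = mat 1"
    using B \<sigma> by (auto simp: scaleR_mult_matrix)
  moreover have "g = pgl (\<sigma> *\<^sub>R A)" using pgl_scale[OF A(1), of \<sigma>] \<sigma> A(2) by auto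
  ultimately show ?thesis using that by blast
qed

end

text \<open>This is the cone over the slice \<open>w \<bullet> v = 1\<close>. Boundedness of the
  slice becomes the homogeneous estimate \<open>norm v \<le> R * (w \<bullet> v)\<close>, which
  passes to the closure and gives \<open>w_pos\<close>.\<close>

lemma properly_convex_cone:
  fixes \<Omega> :: "('n::finite) projective set"
  assumes "open \<Omega>" "properly_convex \<Omega>"
  obtains C w where "cone C w" "\<Omega> = proj ` C"
proof -
  obtain w where w: "w \<noteq> 0" "\<And>v. v \<noteq> 0 \<Longrightarrow> proj v \<in> \<Omega> \<Longrightarrow> w \<bullet> v \<noteq> 0"
    and cv: "convex {v. w \<bullet> v = 1 \<and> proj v \<in> \<Omega>}" and bd: "bounded {v. w \<bullet> v = 1 \<and> proj v \<in> \<Omega>}"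
    using assms(2) by (auto simp: properly_convex_def)
  define C where "C = {v. w \<bullet> v > 0 \<and> proj v \<in> \<Omega>}"
  obtain R where R: "R > 0" "\<And>v. w \<bullet> v = 1 \<Longrightarrow> proj v \<in> \<Omega> \<Longrightarrow> norm v \<le> R"
    using bd unfolding bounded_pos by blast
  have sc: "proj (c *\<^sub>R v) = proj v" if "c \<noteq> 0" "v \<noteq> 0" for c and v :: "real^'n"
    using that by (subst proj_eq_iff) (auto intro: exI[of _ "1/c"])
  have scC: "c *\<^sub>R v \<in> C" if "c > 0" "v \<in> C" for c v
    using that sc[of c v] by (force simp: C_def)
  have norm: "(1 / (w \<bullet> v)) *\<^sub>R v \<in> {v. w \<bullet> v = 1 \<and> proj v \<in> \<Omega>}" if "v \<in> C" for v
    using that sc[of "1 / (w \<bullet> v)" v] by (force simp: C_def)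
  have "cone C w"
  proof
    have "C = {v. v \<noteq> 0 \<and> proj v \<in> \<Omega>} \<inter> {v. w \<bullet> v > 0}" by (auto simp: C_def)
    then show "open C"
      using open_proj_vimage[OF assms(1)] by (auto intro!: open_Int open_halfspace_gt simp: open_halfspace_gt)
    show "c *\<^sub>R v \<in> C" if "c > 0" "v \<in> C" for c v using scC that .
    show "u + v \<in> C" if u: "u \<in> C" and v: "v \<in> C" for u v
    proof -
      let ?s = "w \<bullet> u + w \<bullet> v"
      have pos: "w \<bullet> u > 0" "w \<bullet> v > 0" using u v by (auto simp: C_def)
      have "(w \<bullet> u / ?s) *\<^sub>R ((1 / (w \<bullet> u)) *\<^sub>R u) + (w \<bullet> v / ?s) *\<^sub>R ((1 / (w \<bullet> v)) *\<^sub>R v)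
          \<in> {v. w \<bullet> v = 1 \<and> proj v \<in> \<Omega>}"
        using pos by (intro convexD[OF cv norm[OF u] norm[OF v]]) (auto simp flip: add_divide_distrib)
      moreover have "(w \<bullet> u / ?s) *\<^sub>R ((1 / (w \<bullet> u)) *\<^sub>R u) + (w \<bullet> v / ?s) *\<^sub>R ((1 / (w \<bullet> v)) *\<^sub>R v) = (1 / ?s) *\<^sub>R (u + v)"
        using pos by (simp add: scaleR_add_right)
      ultimately have "(1 / ?s) *\<^sub>R (u + v) \<in> C" by (auto simp: C_def)
      from scC[OF _ this, of ?s] show ?thesis using pos by simp
    qed
    show "w \<bullet> v > 0" if v: "v \<in> closure C" "v \<noteq> 0" for v
    proof -
      have "closed {v. norm v \<le> R * (w \<bullet> v)}" by (intro closed_Collect_le continuous_intros)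
      moreover have "norm v \<le> R * (w \<bullet> v)" if "v \<in> C" for v
      proof -
        have "norm ((1 / (w \<bullet> v)) *\<^sub>R v) \<le> R" using norm[OF that] R(2) by blast
        then show ?thesis using that by (simp add: C_def field_simps)
      qed
      ultimately have "closure C \<subseteq> {v. norm v \<le> R * (w \<bullet> v)}" by (intro closure_minimal) auto
      then have "norm v \<le> R * (w \<bullet> v)" using v by blast
      moreover have "norm v > 0" using v by simp
      ultimately show ?thesis using R(1) by (smt (verit) mult_nonneg_nonpos)
    qed
  qed
  moreover have "\<Omega> = proj ` C"
  proof
    show "proj ` C \<subseteq> \<Omega>" by (auto simp: C_def)
    show "\<Omega> \<subseteq> proj ` C"
    proof
      fix x assume x: "x \<in> \<Omega>"
      obtain v where v: "v \<noteq> 0" "x = proj v" by (metis proj_cases)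
      have "w \<bullet> v > 0 \<or> w \<bullet> (- v) > 0" using w(2)[OF v(1)] x v(2) by auto
      moreover have "proj (- v) = proj v" using sc[of "-1" v] v by simp
      ultimately show "x \<in> proj ` C" using x v unfolding C_def by (metis (mono_tags, lifting) imageI mem_Collect_eq)
    qed
  qed
  ultimately show ?thesis using that by blast
qed


subsection \<open>Hilbert metric, unit tangent vectors and geodesic flow\<close>

text \<open>The factor between two lifts is not known to be differentiable; but near
  \<open>t\<close> it equals a quotient of inner products with \<open>\<gamma> t\<close>, which
  is.\<close>

lemma has_velocity_unique:
  assumes "has_velocity c t w1" "has_velocity c t w2"
  shows "w1 = w2"
proof -
  obtain \<gamma> u where g: "\<And>s. \<gamma> s \<noteq> 0" "\<And>s. c s = proj (\<gamma> s)"
    "(\<gamma> has_vector_derivative u) (at t)" "w1 = tvec (\<gamma> t, u)"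
    using assms(1) unfolding has_velocity_def by blast
  obtain \<delta> u' where d: "\<And>s. \<delta> s \<noteq> 0" "\<And>s. c s = proj (\<delta> s)"
    "(\<delta> has_vector_derivative u') (at t)" "w2 = tvec (\<delta> t, u')"
    using assms(2) unfolding has_velocity_def by blast
  have "\<exists>k. k \<noteq> 0 \<and> \<delta> s = k *\<^sub>R \<gamma> s" for s
    using proj_eq_iff[OF g(1) d(1), of s s] g(2) d(2) by metis
  then obtain k where k: "\<And>s. k s \<noteq> 0" "\<And>s. \<delta> s = k s *\<^sub>R \<gamma> s" by metis
  define q where "q s = (\<delta> s \<bullet> \<gamma> t) / (\<gamma> s \<bullet> \<gamma> t)" for s
  have D1: "((\<lambda>s. \<gamma> s \<bullet> \<gamma> t) has_real_derivative u \<bullet> \<gamma> t) (at t)"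
    using bounded_linear.has_vector_derivative[OF bounded_linear_inner_left g(3)]
    by (simp add: has_real_derivative_iff_has_vector_derivative)
  have D2: "((\<lambda>s. \<delta> s \<bullet> \<gamma> t) has_real_derivative u' \<bullet> \<gamma> t) (at t)"
    using bounded_linear.has_vector_derivative[OF bounded_linear_inner_left d(3)]
    by (simp add: has_real_derivative_iff_has_vector_derivative)
  have nz: "\<gamma> t \<bullet> \<gamma> t \<noteq> 0" using g(1) by simp
  obtain m where m: "(q has_real_derivative m) (at t)"
    unfolding q_def using DERIV_divide[OF D2 D1 nz] by blast
  have Dq: "((\<lambda>s. q s *\<^sub>R \<gamma> s) has_vector_derivative q t *\<^sub>R u + m *\<^sub>R \<gamma> t) (at t)"
    by (rule has_vector_derivative_scaleR[OF m g(3)])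
  have "isCont (\<lambda>s. \<gamma> s \<bullet> \<gamma> t) t" using D1 by (rule DERIV_isCont)
  then have "\<forall>\<^sub>F s in at t. \<gamma> s \<bullet> \<gamma> t \<noteq> 0"
    using nz unfolding isCont_def by (rule tendsto_imp_eventually_ne)
  then obtain e where e: "e > 0" "\<And>s. s \<noteq> t \<Longrightarrow> dist s t < e \<Longrightarrow> \<gamma> s \<bullet> \<gamma> t \<noteq> 0"
    unfolding eventually_at by blast
  have qk: "q s = k s" if "dist s t < e" for s
    using e(2)[OF _ that] nz by (cases "s = t") (simp_all add: q_def k(2))
  have "(\<delta> has_vector_derivative q t *\<^sub>R u + m *\<^sub>R \<gamma> t) (at t)"
    by (rule has_vector_derivative_transform_within[OF Dq e(1)]) (auto simp: qk k(2))
  then have u': "u' = q t *\<^sub>R u + m *\<^sub>R \<gamma> t" using d(3) vector_derivative_unique_at by blast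
  have "q t = k t" using qk[of t] e(1) by simp
  then show ?thesis
    unfolding g(4) d(4) using u' k g(1) d(1) by (subst tvec_eq_iff) metis+
qed

lemma tvec_eqI:
  assumes "p \<noteq> 0" "c \<noteq> 0" "p' = c *\<^sub>R p" "u' = c *\<^sub>R u + m *\<^sub>R p"
  shows "tvec (p, u) = tvec (p', u')"
  using assms by (subst tvec_eq_iff) auto

lemma proj_comb_eq:
  assumes ind: "\<And>\<alpha> \<beta>. \<alpha> *\<^sub>R p + \<beta> *\<^sub>R q = 0 \<Longrightarrow> \<alpha> = 0 \<and> \<beta> = 0"
    and "\<alpha> *\<^sub>R p + \<beta> *\<^sub>R q \<noteq> 0" "\<gamma> *\<^sub>R p + \<delta> *\<^sub>R q \<noteq> 0"
    and "proj (\<alpha> *\<^sub>R p + \<beta> *\<^sub>R q) = proj (\<gamma> *\<^sub>R p + \<delta> *\<^sub>R q)"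
  shows "\<exists>c. c \<noteq> 0 \<and> \<gamma> = c * \<alpha> \<and> \<delta> = c * \<beta>"
proof -
  obtain c where c: "c \<noteq> 0" "\<gamma> *\<^sub>R p + \<delta> *\<^sub>R q = c *\<^sub>R (\<alpha> *\<^sub>R p + \<beta> *\<^sub>R q)"
    using assms(2-4) proj_eq_iff by blast
  then have "(\<gamma> - c * \<alpha>) *\<^sub>R p + (\<delta> - c * \<beta>) *\<^sub>R q = 0" by (simp add: algebra_simps)
  then show ?thesis using ind c(1) by fastforce
qed

lemma cross_ratio_eq:
  assumes pq: "p \<noteq> 0" "q \<noteq> 0" "proj p \<noteq> proj q" and st: "s > 0" "t > 0"
  shows "cross_ratio (proj p) (proj (p + s *\<^sub>R q)) (proj (p + t *\<^sub>R q)) (proj q) = t / s"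
  unfolding cross_ratio_def
proof (rule the_equality)
  show "\<exists>p' q'. p' \<noteq> 0 \<and> q' \<noteq> 0 \<and> proj p' \<noteq> proj q' \<and> proj p = proj p' \<and>
     proj (p + s *\<^sub>R q) = proj (p' + q') \<and> proj (p + t *\<^sub>R q) = proj (p' + (t / s) *\<^sub>R q') \<and> proj q = proj q'"
    using pq st proj_scale[of s q] by (intro exI[of _ p] exI[of _ "s *\<^sub>R q"]) auto
next
  note ind = proj_eq_independent[OF pq]
  have nz: "\<alpha> *\<^sub>R p + \<beta> *\<^sub>R q \<noteq> 0" if "\<alpha> \<noteq> 0" for \<alpha> \<beta> using ind that by blast
  fix t' assume "\<exists>p' q'. p' \<noteq> 0 \<and> q' \<noteq> 0 \<and> proj p' \<noteq> proj q' \<and> proj p = proj p' \<and>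
     proj (p + s *\<^sub>R q) = proj (p' + q') \<and> proj (p + t *\<^sub>R q) = proj (p' + t' *\<^sub>R q') \<and> proj q = proj q'"
  then obtain p' q' where *: "p' \<noteq> 0" "q' \<noteq> 0" "proj p = proj p'" "proj q = proj q'"
     "proj (p + s *\<^sub>R q) = proj (p' + q')" "proj (p + t *\<^sub>R q) = proj (p' + t' *\<^sub>R q')" by blast
  obtain \<alpha> where \<alpha>: "\<alpha> \<noteq> 0" "p' = \<alpha> *\<^sub>R p" using * pq proj_eq_iff by blast
  obtain \<beta> where \<beta>: "\<beta> \<noteq> 0" "q' = \<beta> *\<^sub>R q" using * pq proj_eq_iff by blast
  have "\<exists>c. c \<noteq> 0 \<and> \<alpha> = c * 1 \<and> \<beta> = c * s"
    by (rule proj_comb_eq[OF ind]) (use *(5) \<alpha> \<beta> nz[of 1 s] nz[of \<alpha> \<beta>] in simp_all)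
  then have "\<beta> = \<alpha> * s" by auto
  moreover have "\<exists>c. c \<noteq> 0 \<and> \<alpha> = c * 1 \<and> t' * \<beta> = c * t"
    by (rule proj_comb_eq[OF ind]) (use *(6) \<alpha> \<beta> nz[of 1 t] nz[of \<alpha> "t' * \<beta>"] in simp_all)
  then have "t' * \<beta> = \<alpha> * t" by auto
  ultimately show "t' = t / s" using \<alpha>(1) st by (simp add: field_simps)
qed

context cone
begin

section \<open>Hilbert distance on a geodesic\<close>

lemma pair_frontier:
  assumes ab: "pair a b" and nz: "\<alpha> *\<^sub>R a + \<beta> *\<^sub>R b \<noteq> 0" and fr: "proj (\<alpha> *\<^sub>R a + \<beta> *\<^sub>R b) \<in> frontier \<Omega>"
  shows "\<alpha> = 0 \<or> \<beta> = 0"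
proof -
  have *: "\<alpha> = 0 \<or> \<beta> = 0" if z: "\<alpha> *\<^sub>R a + \<beta> *\<^sub>R b \<in> K - C" for \<alpha> \<beta>
  proof (rule ccontr)
    assume n: "\<not> ?thesis"
    have pos: "\<alpha> + e > 0 \<and> \<beta> + e > 0" if "e > 0" for e
    proof -
      have "(\<alpha> *\<^sub>R a + \<beta> *\<^sub>R b) + e *\<^sub>R (a + b) \<in> C"
        using z ab that by (intro K_C_add[OF _ C_scale]) (auto simp: pair_def)
      moreover have "(\<alpha> *\<^sub>R a + \<beta> *\<^sub>R b) + e *\<^sub>R (a + b) = (\<alpha> + e) *\<^sub>R a + (\<beta> + e) *\<^sub>R b"
        by (simp add: algebra_simps)
      ultimately show ?thesis using pair_comb[OF ab] by metis
    qed
    have "\<alpha> > 0" using pos[of "- \<alpha>"] n by (cases "\<alpha> < 0") auto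
    moreover have "\<beta> > 0" using pos[of "- \<beta>"] n by (cases "\<beta> < 0") auto
    ultimately show False using z pair_comb[OF ab] by blast
  qed
  show ?thesis
    using fr *[of \<alpha> \<beta>] *[of "- \<alpha>" "- \<beta>"] unfolding proj_mem_frontier[OF nz] by auto
qed

lemma pair_proj_frontier:
  assumes "pair a b" shows "proj a \<in> frontier \<Omega>" "proj b \<in> frontier \<Omega>"
  using assms pair_nonzero[OF assms] proj_mem_frontier by (auto simp: pair_def)

lemma pair_proj_neq: assumes "pair a b" shows "proj a \<noteq> proj b"
proof
  assume "proj a = proj b"
  then obtain c where "b = c *\<^sub>R a" using proj_eq_iff pair_nonzero[OF assms] by blast
  then have "c *\<^sub>R a + (-1) *\<^sub>R b = 0" by simp
  then show False using pair_independent[OF assms] by fastforce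
qed

text \<open>This is the uniqueness behind the definite description in \<open>hilbert_dist\<close>:
  boundary points aligned with two distinct points of the geodesic are its endpoints, in the order
  decided by \<open>s < t\<close> or \<open>t < s\<close>; the absolute value covers both
  orders.\<close>

lemma aligned_on_pair:
  assumes ab: "pair a b" and st: "s > 0" "t > 0" "s \<noteq> t"
    and al: "aligned_in_order x (proj (a + s *\<^sub>R b)) (proj (a + t *\<^sub>R b)) y"
    and fr: "x \<in> frontier \<Omega>" "y \<in> frontier \<Omega>"
  shows "ln (cross_ratio x (proj (a + s *\<^sub>R b)) (proj (a + t *\<^sub>R b)) y) = \<bar>ln (t / s)\<bar>"
proof -
  obtain p q s' t' where pq: "p \<noteq> 0" "q \<noteq> 0" "proj p \<noteq> proj q" and s': "0 < s'" "s' \<le> t'"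
    and eqs: "x = proj p" "y = proj q" "proj (a + s *\<^sub>R b) = proj (p + s' *\<^sub>R q)" "proj (a + t *\<^sub>R b) = proj (p + t' *\<^sub>R q)"
    using al unfolding aligned_in_order_def by metis
  note ind = pair_independent[OF ab]
  note ipq = proj_eq_independent[OF pq]
  have nzab: "\<alpha> *\<^sub>R a + \<beta> *\<^sub>R b \<noteq> 0" if "\<alpha> \<noteq> 0 \<or> \<beta> \<noteq> 0" for \<alpha> \<beta> using ind that by blast
  have nz1: "a + s *\<^sub>R b \<noteq> 0" "a + t *\<^sub>R b \<noteq> 0" using nzab[of 1 s] nzab[of 1 t] by simp_all
  have nz2: "p + s' *\<^sub>R q \<noteq> 0" "p + t' *\<^sub>R q \<noteq> 0" using ipq[of 1 s'] ipq[of 1 t'] by auto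
  obtain k where k: "k \<noteq> 0" "p + s' *\<^sub>R q = k *\<^sub>R (a + s *\<^sub>R b)" using eqs(3) nz1 nz2 proj_eq_iff by metis
  obtain l where l: "l \<noteq> 0" "p + t' *\<^sub>R q = l *\<^sub>R (a + t *\<^sub>R b)" using eqs(4) nz1 nz2 proj_eq_iff by metis
  have "proj (a + s *\<^sub>R b) \<noteq> proj (a + t *\<^sub>R b)"
  proof
    assume "proj (a + s *\<^sub>R b) = proj (a + t *\<^sub>R b)"
    then have "\<exists>c. c \<noteq> 0 \<and> 1 = c * 1 \<and> t = c * s"
      by (intro proj_comb_eq[OF ind]) (use nz1 in simp_all)
    then show False using st by auto
  qed
  then have s't': "s' < t'" using eqs s' by (metis order_le_less)
  \<comment> \<open>Solving for \<open>q\<close> and then for \<open>p\<close> expresses the outer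
    points in the basis \<open>a\<close>, \<open>b\<close>, so that \<open>pair_frontier\<close>
    applies to them.\<close>
  have "(t' - s') *\<^sub>R q = (p + t' *\<^sub>R q) - (p + s' *\<^sub>R q)" by (simp add: algebra_simps)
  also have "\<dots> = (l - k) *\<^sub>R a + (l * t - k * s) *\<^sub>R b" unfolding k l by (simp add: algebra_simps)
  finally have "q = (1 / (t' - s')) *\<^sub>R ((l - k) *\<^sub>R a + (l * t - k * s) *\<^sub>R b)"
    using s't' by (metis scaleR_scaleR divide_self_if diff_gt_0_iff_gt less_numeral_extra(3) times_divide_eq_left mult_1 scaleR_one)
  then obtain q1 q2 where q: "q = q1 *\<^sub>R a + q2 *\<^sub>R b" by (metis scaleR_add_right scaleR_scaleR)
  have "p = k *\<^sub>R (a + s *\<^sub>R b) - s' *\<^sub>R q" using k(2) by (metis add_diff_cancel_right')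
  then have p: "p = (k - s' * q1) *\<^sub>R a + (k * s - s' * q2) *\<^sub>R b" unfolding q by (simp add: algebra_simps)
  define p1 p2 where "p1 = k - s' * q1" and "p2 = k * s - s' * q2"
  have p: "p = p1 *\<^sub>R a + p2 *\<^sub>R b" using p by (simp add: p1_def p2_def)
  have cr: "cross_ratio x (proj (a + s *\<^sub>R b)) (proj (a + t *\<^sub>R b)) y = t' / s'"
    unfolding eqs using cross_ratio_eq[OF pq, of s' t'] s' s't' by simp
  have P: "p1 = 0 \<or> p2 = 0" using pair_frontier[OF ab, of p1 p2] fr(1) pq(1) unfolding eqs(1) p by blast
  have Q: "q1 = 0 \<or> q2 = 0" using pair_frontier[OF ab, of q1 q2] fr(2) pq(2) unfolding eqs(2) q by blast
  have coef: "(p1 + r' * q1 = m \<and> p2 + r' * q2 = m * r)" if "p + r' *\<^sub>R q = m *\<^sub>R (a + r *\<^sub>R b)" for r' m r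
  proof -
    have "(p1 + r' * q1 - m) *\<^sub>R a + (p2 + r' * q2 - m * r) *\<^sub>R b = 0"
      using that unfolding p q by (simp add: algebra_simps)
    then show ?thesis using ind by fastforce
  qed
  note ck = coef[OF k(2)] and cl = coef[OF l(2)]
  have notboth: "\<not> (p1 = 0 \<and> q1 = 0)" "\<not> (p2 = 0 \<and> q2 = 0)" using ck k(1) st by auto
  have s0: "s' > 0" "t' > 0" using s' s't' by auto
  \<comment> \<open>Each outer point lies on one of the two axes, and they cannot share an
    axis.\<close>
  consider "p2 = 0" "q1 = 0" | "p1 = 0" "q2 = 0" using P Q notboth by blast
  then show ?thesis
  proof cases
    case 1
    then have "s' * q2 = p1 * s" "t' * q2 = p1 * t" using ck cl by auto
    moreover have "p1 \<noteq> 0" "q2 \<noteq> 0" using 1 notboth by auto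
    ultimately have "s' = (p1 / q2) * s" "t' = (p1 / q2) * t" by (auto simp: field_simps)
    then have eq: "t' / s' = t / s" using \<open>p1 \<noteq> 0\<close> \<open>q2 \<noteq> 0\<close> by simp
    then have "t / s > 1" using s't' s0 by (metis divide_less_eq_1_pos less_divide_eq_1_pos)
    then show ?thesis unfolding cr eq using ln_gt_zero[of "t/s"] by simp
  next
    case 2
    then have "s' * q1 * s = p2" "t' * q1 * t = p2" using ck cl by auto
    moreover have "p2 \<noteq> 0" "q1 \<noteq> 0" using 2 notboth by auto
    ultimately have "s' * s = t' * t" by (metis mult.assoc mult.commute mult_left_cancel)
    then have eq: "t' / s' = s / t" using st s0 by (simp add: field_simps)
    then have "s / t > 1" using s't' s0 by (metis less_divide_eq_1_pos)
    then have "ln (s / t) > 0" by simp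
    moreover have "ln (t / s) = - ln (s / t)" using st by (simp add: ln_div)
    ultimately show ?thesis unfolding cr eq by simp
  qed
qed

lemma hilbert_dist_pair:
  assumes ab: "pair a b" and st: "s > 0" "t > 0"
  shows "hilbert_dist \<Omega> (proj (a + s *\<^sub>R b)) (proj (a + t *\<^sub>R b)) = \<bar>ln (t / s)\<bar> / 2"
proof (cases "s = t")
  case True
  then show ?thesis using st by (simp add: hilbert_dist_def)
next
  case False
  note ind = pair_independent[OF ab]
  have nz: "\<alpha> *\<^sub>R a + \<beta> *\<^sub>R b \<noteq> 0" if "\<alpha> \<noteq> 0 \<or> \<beta> \<noteq> 0" for \<alpha> \<beta> using ind that by blast
  have neq: "proj (a + s *\<^sub>R b) \<noteq> proj (a + t *\<^sub>R b)"
  proof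
    assume "proj (a + s *\<^sub>R b) = proj (a + t *\<^sub>R b)"
    then have "\<exists>c. c \<noteq> 0 \<and> 1 = c * 1 \<and> t = c * s"
      by (intro proj_comb_eq[OF ind]) (use nz[of 1 s] nz[of 1 t] in simp_all)
    then show False using False by auto
  qed
  let ?P = "\<lambda>r. \<exists>x\<in>frontier \<Omega>. \<exists>y\<in>frontier \<Omega>.
        aligned_in_order x (proj (a + s *\<^sub>R b)) (proj (a + t *\<^sub>R b)) y \<and>
        r = ln (cross_ratio x (proj (a + s *\<^sub>R b)) (proj (a + t *\<^sub>R b)) y) / 2"
  have ex: "\<exists>x\<in>frontier \<Omega>. \<exists>y\<in>frontier \<Omega>. aligned_in_order x (proj (a + s *\<^sub>R b)) (proj (a + t *\<^sub>R b)) y"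
  proof (cases "s < t")
    case True
    then have "aligned_in_order (proj a) (proj (a + s *\<^sub>R b)) (proj (a + t *\<^sub>R b)) (proj b)"
      unfolding aligned_in_order_def using st pair_nonzero[OF ab] pair_proj_neq[OF ab]
      by (intro exI[of _ a] exI[of _ b] exI[of _ s] exI[of _ t]) auto
    then show ?thesis using pair_proj_frontier[OF ab] by blast
  next
    case F: False
    \<comment> \<open>Exchanging \<open>a\<close> and \<open>b\<close> inverts the parameter, which
      covers the order \<open>t < s\<close>.\<close>
    have sw: "proj (a + r *\<^sub>R b) = proj (b + (1 / r) *\<^sub>R a)" if "r > 0" for r
      using that nz[of 1 r] proj_scale[of "1/r" "a + r *\<^sub>R b"] by (simp add: scaleR_add_right add.commute)
    have "aligned_in_order (proj b) (proj (a + s *\<^sub>R b)) (proj (a + t *\<^sub>R b)) (proj a)"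
      unfolding aligned_in_order_def sw[OF st(1)] sw[OF st(2)]
      using st pair_nonzero[OF ab] pair_proj_neq[OF ab] F
      by (intro exI[of _ b] exI[of _ a] exI[of _ "1/s"] exI[of _ "1/t"]) (auto simp: frac_le)
    then show ?thesis using pair_proj_frontier[OF ab] by blast
  qed
  have "(THE r. ?P r) = \<bar>ln (t / s)\<bar> / 2"
  proof (rule the_equality)
    show "?P (\<bar>ln (t / s)\<bar> / 2)" using ex aligned_on_pair[OF ab st False] by metis
    show "r = \<bar>ln (t / s)\<bar> / 2" if "?P r" for r using that aligned_on_pair[OF ab st False] by metis
  qed
  then show ?thesis using neq by (simp add: hilbert_dist_def)
qed

lemma hilbert_dist_pair_comb:
  assumes ab: "pair a b" and pos: "s1 > 0" "s2 > 0" "t1 > 0" "t2 > 0"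
  shows "hilbert_dist \<Omega> (proj (s1 *\<^sub>R a + s2 *\<^sub>R b)) (proj (t1 *\<^sub>R a + t2 *\<^sub>R b)) = \<bar>ln (t2 / t1) - ln (s2 / s1)\<bar> / 2"
proof -
  have sc: "proj (r1 *\<^sub>R a + r2 *\<^sub>R b) = proj (a + (r2 / r1) *\<^sub>R b)" if "r1 > 0" "r2 > 0" for r1 r2
  proof -
    have "r1 *\<^sub>R a + r2 *\<^sub>R b \<in> C" using pair_comb[OF ab] that by blast
    then have "proj ((1 / r1) *\<^sub>R (r1 *\<^sub>R a + r2 *\<^sub>R b)) = proj (r1 *\<^sub>R a + r2 *\<^sub>R b)"
      using that C_nonzero by (intro proj_scale) auto
    then show ?thesis using that by (simp add: scaleR_add_right)
  qed
  have "ln ((t2 / t1) / (s2 / s1)) = ln (t2 / t1) - ln (s2 / s1)"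
    using pos by (intro ln_divide_pos) auto
  then show ?thesis
    unfolding sc[OF pos(1,2)] sc[OF pos(3,4)] using hilbert_dist_pair[OF ab, of "s2/s1" "t2/t1"] pos by simp
qed

text \<open>
  The unit vector at \<open>proj (a + b)\<close> pointing to \<open>proj b\<close>; the normalisation is correct because
  \<open>hilbert_dist\<close> carries the factor \<open>1/2\<close>.
\<close>

definition gvec :: "real^'n \<Rightarrow> real^'n \<Rightarrow> 'n ptangent" where
  "gvec a b = tvec (a + b, b - a)"

text \<open>The description defining \<open>finsler_norm\<close> ranges over all representatives of
  the tangent vector, so the limit is required for each of them.\<close>

lemma finsler_norm_eqI:
  assumes p0: "p0 \<noteq> 0"
    and lim: "\<And>p u. p \<noteq> 0 \<Longrightarrow> tvec (p0, u0) = tvec (p, u) \<Longrightarrow>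
      ((\<lambda>t. hilbert_dist \<Omega> (proj p) (proj (p + t *\<^sub>R u)) / t) \<longlongrightarrow> l) (at_right 0)"
  shows "finsler_norm \<Omega> (tvec (p0, u0)) = l"
  unfolding finsler_norm_def
proof (rule the_equality)
  show "\<exists>p u. p \<noteq> 0 \<and> tvec (p0, u0) = tvec (p, u) \<and>
      ((\<lambda>t. hilbert_dist \<Omega> (proj p) (proj (p + t *\<^sub>R u)) / t) \<longlongrightarrow> l) (at_right 0)"
    using p0 lim[OF p0 refl] by blast
next
  fix r
  assume "\<exists>p u. p \<noteq> 0 \<and> tvec (p0, u0) = tvec (p, u) \<and>
      ((\<lambda>t. hilbert_dist \<Omega> (proj p) (proj (p + t *\<^sub>R u)) / t) \<longlongrightarrow> r) (at_right 0)"
  then show "r = l"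
  proof (elim exE conjE)
    fix p u
    assume "p \<noteq> 0" "tvec (p0, u0) = tvec (p, u)"
      and r: "((\<lambda>t. hilbert_dist \<Omega> (proj p) (proj (p + t *\<^sub>R u)) / t) \<longlongrightarrow> r) (at_right 0)"
    then show "r = l" by (intro tendsto_unique[OF trivial_limit_at_right_real r] lim)
  qed
qed

lemma finsler_norm_pair:
  assumes ab: "pair a b"
  shows "finsler_norm \<Omega> (tvec (a + b, lam *\<^sub>R (b - a))) = \<bar>lam\<bar>"
proof -
  have nz: "a + b \<noteq> 0" using pair_nonzero[OF ab] by blast
  have lim: "((\<lambda>t. hilbert_dist \<Omega> (proj p) (proj (p + t *\<^sub>R u)) / t) \<longlongrightarrow> \<bar>lam\<bar>) (at_right 0)"
    if p: "p \<noteq> 0" "tvec (a + b, lam *\<^sub>R (b - a)) = tvec (p, u)" for p u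
  proof -
    obtain c m where c: "c \<noteq> 0" "p = c *\<^sub>R (a + b)" "u = c *\<^sub>R (lam *\<^sub>R (b - a)) + m *\<^sub>R (a + b)"
      using p nz tvec_eq_iff by blast
    \<comment> \<open>The component of the representative along \<open>a + b\<close>. It shifts both
      coefficients equally and cancels in the derivative of \<open>G\<close> at 0, which is
      \<open>(\<mu> + lam) - (\<mu> - lam)\<close>.\<close>
    define \<mu> where "\<mu> = m / c"
    define G where "G t = ln (1 + t * (\<mu> + lam)) - ln (1 + t * (\<mu> - lam))" for t
    have pu: "p + t *\<^sub>R u = c *\<^sub>R ((1 + t * (\<mu> - lam)) *\<^sub>R a + (1 + t * (\<mu> + lam)) *\<^sub>R b)" for t
    proof -
      have "m = c * \<mu>" using c(1) by (simp add: \<mu>_def)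
      then show ?thesis unfolding c by (simp add: algebra_simps)
    qed
    have "((\<lambda>t. 1 + t * (\<mu> - lam)) \<longlongrightarrow> 1 + 0 * (\<mu> - lam)) (at_right 0)" by (intro tendsto_intros)
    then have e1: "\<forall>\<^sub>F t in at_right 0. 1 + t * (\<mu> - lam) > 0" by (intro order_tendstoD(1)) auto
    have "((\<lambda>t. 1 + t * (\<mu> + lam)) \<longlongrightarrow> 1 + 0 * (\<mu> + lam)) (at_right 0)" by (intro tendsto_intros)
    then have e2: "\<forall>\<^sub>F t in at_right 0. 1 + t * (\<mu> + lam) > 0" by (intro order_tendstoD(1)) auto
    have e3: "\<forall>\<^sub>F t in at_right 0. (t::real) > 0" by (simp add: eventually_at_right_less)
    have ev: "\<forall>\<^sub>F t in at_right 0. \<bar>G t / t\<bar> / 2 = hilbert_dist \<Omega> (proj p) (proj (p + t *\<^sub>R u)) / t"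
      using e1 e2 e3
    proof eventually_elim
      case (elim t)
      have "(1 + t * (\<mu> - lam)) *\<^sub>R a + (1 + t * (\<mu> + lam)) *\<^sub>R b \<in> C" using elim pair_comb[OF ab] by blast
      then have "proj (p + t *\<^sub>R u) = proj ((1 + t * (\<mu> - lam)) *\<^sub>R a + (1 + t * (\<mu> + lam)) *\<^sub>R b)"
        unfolding pu using c(1) C_nonzero by (intro proj_scale) auto
      moreover have "proj p = proj (1 *\<^sub>R a + 1 *\<^sub>R b)" unfolding c(2) using c(1) nz by (simp add: proj_scale)
      ultimately have "hilbert_dist \<Omega> (proj p) (proj (p + t *\<^sub>R u)) =
          \<bar>ln ((1 + t * (\<mu> + lam)) / (1 + t * (\<mu> - lam))) - ln (1 / 1)\<bar> / 2"
        using hilbert_dist_pair_comb[OF ab, of 1 1] elim by simp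
      also have "\<dots> = \<bar>G t\<bar> / 2" using elim by (simp add: G_def ln_div)
      finally have hd: "hilbert_dist \<Omega> (proj p) (proj (p + t *\<^sub>R u)) = \<bar>G t\<bar> / 2" .
      show ?case unfolding hd using elim by simp
    qed
    have "(G has_real_derivative (2 * lam)) (at 0)"
      unfolding G_def by (auto intro!: derivative_eq_intros)
    then have "((\<lambda>t. G t / t) \<longlongrightarrow> 2 * lam) (at 0)" by (simp add: DERIV_def G_def)
    then have "((\<lambda>t. G t / t) \<longlongrightarrow> 2 * lam) (at_right 0)" by (rule filterlim_mono) (auto simp: at_le)
    then have "((\<lambda>t. \<bar>G t / t\<bar> / 2) \<longlongrightarrow> \<bar>2 * lam\<bar> / 2) (at_right 0)" by (intro tendsto_intros) auto
    from Lim_transform_eventually[OF this ev] show ?thesis by (simp add: abs_mult)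
  qed
  show ?thesis by (rule finsler_norm_eqI[OF nz lim])
qed

lemma finsler_norm_zero:
  assumes p: "p \<in> C"
  shows "finsler_norm \<Omega> (tvec (p, m *\<^sub>R p)) = 0"
proof -
  have nz: "p \<noteq> 0" using p by auto
  have lim: "((\<lambda>t. hilbert_dist \<Omega> (proj q) (proj (q + t *\<^sub>R u)) / t) \<longlongrightarrow> 0) (at_right 0)"
    if q: "q \<noteq> 0" "tvec (p, m *\<^sub>R p) = tvec (q, u)" for q u
  proof -
    obtain c k where c: "c \<noteq> 0" "q = c *\<^sub>R p" "u = c *\<^sub>R (m *\<^sub>R p) + k *\<^sub>R p"
      using q nz tvec_eq_iff by blast
    define \<mu> where "\<mu> = (c * m + k) / c"
    have "\<mu> * c = c * m + k" using c(1) by (simp add: \<mu>_def)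
    moreover have "u = (c * m + k) *\<^sub>R p" using c(3) by (simp add: algebra_simps)
    ultimately have u: "u = \<mu> *\<^sub>R q" by (metis c(2) scaleR_scaleR)
    have "((\<lambda>t. 1 + t * \<mu>) \<longlongrightarrow> 1 + 0 * \<mu>) (at_right 0)" by (intro tendsto_intros)
    then have "\<forall>\<^sub>F t in at_right 0. 1 + t * \<mu> > 0" by (intro order_tendstoD(1)) auto
    then have "\<forall>\<^sub>F t in at_right 0. 0 = hilbert_dist \<Omega> (proj q) (proj (q + t *\<^sub>R u)) / t"
    proof eventually_elim
      case (elim t)
      have "q + t *\<^sub>R u = (1 + t * \<mu>) *\<^sub>R q" by (simp add: u algebra_simps)
      then have "proj (q + t *\<^sub>R u) = proj q" using elim q(1) by (simp add: proj_scale)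
      then show ?case by (simp add: hilbert_dist_def)
    qed
    then show ?thesis by (rule Lim_transform_eventually[OF tendsto_const])
  qed
  show ?thesis by (rule finsler_norm_eqI[OF nz lim])
qed

lemma K_bounded_by_w: "\<exists>R>0. \<forall>v\<in>K. norm v \<le> R * (w \<bullet> v)"
proof (cases "K \<inter> sphere 0 1 = {}")
  case True
  have zero: "v = 0" if "v \<in> K" for v
  proof (rule ccontr)
    assume "v \<noteq> 0"
    then have "(1 / norm v) *\<^sub>R v \<in> K \<inter> sphere 0 1" using K_scale[OF that, of "1 / norm v"] by simp
    then show False using True by blast
  qed
  show ?thesis by (intro exI[of _ 1] conjI ballI) (auto dest!: zero)
next
  case False
  have "compact (K \<inter> sphere 0 1)" using closed_K compact_sphere by (simp add: closed_Int_compact)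
  moreover have "continuous_on (K \<inter> sphere 0 1) (\<lambda>v. w \<bullet> v)" by (intro continuous_intros)
  ultimately obtain z where z: "z \<in> K \<inter> sphere 0 1" "\<And>v. v \<in> K \<inter> sphere 0 1 \<Longrightarrow> w \<bullet> z \<le> w \<bullet> v"
    using False continuous_attains_inf by metis
  have wz: "w \<bullet> z > 0" using z(1) by (intro K_pos) auto
  have "norm v \<le> 1 / (w \<bullet> z) * (w \<bullet> v)" if "v \<in> K" for v
  proof (cases "v = 0")
    case False
    then have "(1 / norm v) *\<^sub>R v \<in> K \<inter> sphere 0 1" using K_scale[OF that, of "1 / norm v"] by simp
    from z(2)[OF this] show ?thesis using wz False by (simp add: field_simps)
  qed simp
  then show ?thesis using wz by (intro exI[of _ "1 / (w \<bullet> z)"]) simp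
qed

lemma exit_point:
  assumes p: "p \<in> C" and u: "u \<noteq> 0" "w \<bullet> u = 0"
  shows "\<exists>t>0. p + t *\<^sub>R u \<in> K - C"
proof -
  obtain R where R: "R > 0" "\<And>v. v \<in> K \<Longrightarrow> norm v \<le> R * (w \<bullet> v)" using K_bounded_by_w by blast
  \<comment> \<open>Since \<open>w \<bullet> u = 0\<close>, points of \<open>K\<close> on the ray
    have norm at most \<open>R * (w \<bullet> p)\<close>; by the triangle inequality the point at
    \<open>T\<close> exceeds this.\<close>
  define T where "T = (R * (w \<bullet> p) + norm p + 1) / norm u"
  have wp: "w \<bullet> p > 0" using K_pos[OF C_K[OF p]] C_nonzero[OF p] by blast
  have T: "T > 0" using R wp u(1) by (simp add: T_def add_nonneg_pos)
  have "p + T *\<^sub>R u \<notin> C"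
  proof
    assume "p + T *\<^sub>R u \<in> C"
    then have "norm (p + T *\<^sub>R u) \<le> R * (w \<bullet> p)" using R(2)[OF C_K] u(2) by (fastforce simp: inner_add_right)
    moreover have "norm (T *\<^sub>R u) \<le> norm (p + T *\<^sub>R u) + norm p" by (metis add_diff_cancel_left' norm_triangle_ineq4)
    moreover have "norm (T *\<^sub>R u) = R * (w \<bullet> p) + norm p + 1"
    proof -
      have "norm (T *\<^sub>R u) = T * norm u" using T by simp
      then show ?thesis using u(1) by (simp add: T_def)
    qed
    ultimately show False by linarith
  qed
  then have "closed_segment p (p + T *\<^sub>R u) \<inter> frontier C \<noteq> {}"
    using p by (intro connected_Int_frontier) (auto intro: ends_in_segment)
  then obtain z where z: "z \<in> closed_segment p (p + T *\<^sub>R u)" "z \<in> frontier C" by blast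
  then obtain s where s: "0 \<le> s" "(1 - s) *\<^sub>R p + s *\<^sub>R (p + T *\<^sub>R u) \<in> frontier C"
    unfolding in_segment by metis
  have eq: "(1 - s) *\<^sub>R p + s *\<^sub>R (p + T *\<^sub>R u) = p + (s * T) *\<^sub>R u" by (simp add: algebra_simps)
  have fr: "p + (s * T) *\<^sub>R u \<in> K - C"
    using s(2) open_C unfolding eq by (simp add: frontier_def interior_open K_def)
  then have "s \<noteq> 0" using p by auto
  then show ?thesis using fr s(1) T by (intro exI[of _ "s * T"]) auto
qed

lemma T1_eq: "T1 \<Omega> = {gvec a b | a b. pair a b}"
proof (intro subset_antisym subsetI)
  fix v assume v: "v \<in> T1 \<Omega>"
  obtain p0 u0 where p0: "p0 \<noteq> 0" "v = tvec (p0, u0)" by (metis tvec_cases)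
  then have "proj p0 \<in> \<Omega>" using v by (simp add: T1_def tbase_tvec)
  then have "p0 \<in> C \<or> - p0 \<in> C" using proj_mem_\<Omega>[OF p0(1)] by blast
  moreover have "v = tvec (- p0, - u0)"
    unfolding p0(2) by (rule tvec_eqI[of _ "-1" _ _ _ 0]) (use p0 in auto)
  ultimately obtain p u1 where p: "p \<in> C" "v = tvec (p, u1)" using p0(2) by blast
  have pn: "p \<noteq> 0" using p by auto
  have wp: "w \<bullet> p > 0" using K_pos[OF C_K[OF p(1)]] pn by blast
  \<comment> \<open>A change along \<open>p\<close> does not affect the tangent vector; the choice
    with \<open>w \<bullet> u = 0\<close> makes the rays in both directions leave
    \<open>C\<close>.\<close>
  define u where "u = u1 - ((w \<bullet> u1) / (w \<bullet> p)) *\<^sub>R p"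
  have wu: "w \<bullet> u = 0" using wp by (simp add: u_def inner_diff_right)
  have vu: "v = tvec (p, u)" unfolding p(2) u_def
    by (rule tvec_eqI[of _ 1 _ _ _ "- ((w \<bullet> u1) / (w \<bullet> p))"]) (use pn in auto)
  have fin: "finsler_norm \<Omega> v = 1" using v by (simp add: T1_def)
  have "u \<noteq> 0"
  proof
    assume "u = 0"
    then show False using fin finsler_norm_zero[OF p(1), of 0] vu by simp
  qed
  obtain t1 where t1: "t1 > 0" "p + t1 *\<^sub>R u \<in> K - C" using exit_point[OF p(1) \<open>u \<noteq> 0\<close> wu] by blast
  obtain t2 where t2: "t2 > 0" "p + t2 *\<^sub>R (- u) \<in> K - C" using exit_point[OF p(1), of "- u"] \<open>u \<noteq> 0\<close> wu by auto
  \<comment> \<open>The weights for which the rescaled exit points add up to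
    \<open>p\<close>.\<close>
  define \<alpha> \<beta> where "\<alpha> = t1 / (t1 + t2)" and "\<beta> = t2 / (t1 + t2)"
  have \<alpha>\<beta>: "\<alpha> > 0" "\<beta> > 0" "\<beta> * t1 - \<alpha> * t2 = 0" using t1 t2 by (simp_all add: \<alpha>_def \<beta>_def)
  have "\<alpha> + \<beta> = 1" using t1 t2 by (simp add: \<alpha>_def \<beta>_def flip: add_divide_distrib)
  define b where "b = \<beta> *\<^sub>R (p + t1 *\<^sub>R u)"
  define a where "a = \<alpha> *\<^sub>R (p + t2 *\<^sub>R (- u))"
  have "a + b = (\<alpha> + \<beta>) *\<^sub>R p + (\<beta> * t1 - \<alpha> * t2) *\<^sub>R u"
    by (simp add: a_def b_def vec_eq_iff algebra_simps)
  then have abp: "a + b = p" using \<alpha>\<beta>(3) \<open>\<alpha> + \<beta> = 1\<close> by simp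
  have ab: "pair a b"
    unfolding pair_def abp using p K_minus_C_scale t1 t2 \<alpha>\<beta> by (simp add: a_def b_def del: Diff_iff)
  \<comment> \<open>Modulo \<open>p\<close> the vector \<open>b - a\<close> is
    \<open>\<kappa>\<close> times \<open>u\<close>; norm 1 then forces
    \<open>\<kappa> = 1\<close>.\<close>
  define \<kappa> where "\<kappa> = \<beta> * t1 + \<alpha> * t2"
  have \<kappa>: "\<kappa> > 0" using t1 t2 \<alpha>\<beta> by (simp add: \<kappa>_def add_pos_pos)
  define lam where "lam = 1 / \<kappa>"
  have "b - a = (\<beta> - \<alpha>) *\<^sub>R p + \<kappa> *\<^sub>R u"
    by (simp add: a_def b_def \<kappa>_def vec_eq_iff algebra_simps)
  then have "lam *\<^sub>R (b - a) = 1 *\<^sub>R u + (lam * (\<beta> - \<alpha>)) *\<^sub>R p"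
    using \<kappa> by (simp add: lam_def scaleR_add_right)
  then have vlam: "v = tvec (a + b, lam *\<^sub>R (b - a))"
    unfolding vu abp by (intro tvec_eqI[of _ 1]) (use pn in auto)
  then have "\<bar>lam\<bar> = 1" using fin finsler_norm_pair[OF ab] by simp
  moreover have "lam > 0" using \<kappa> by (simp add: lam_def)
  ultimately have "v = gvec a b" using vlam by (simp add: gvec_def)
  then show "v \<in> {gvec a b | a b. pair a b}" using ab by blast
next
  fix v assume "v \<in> {gvec a b | a b. pair a b}"
  then obtain a b where ab: "pair a b" "v = gvec a b" by blast
  then have "tbase v \<in> \<Omega>"
    using pair_nonzero[OF ab(1)] by (simp add: gvec_def tbase_tvec \<Omega>_def pair_def)
  then show "v \<in> T1 \<Omega>" using finsler_norm_pair[OF ab(1), of 1] ab(2) by (simp add: T1_def gvec_def)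
qed

lemma gvec_eq_iff:
  assumes ab: "pair a b" and ab': "pair a' b'"
  shows "gvec a b = gvec a' b' \<longleftrightarrow> (\<exists>c>0. a' = c *\<^sub>R a \<and> b' = c *\<^sub>R b)"
proof
  assume "gvec a b = gvec a' b'"
  then obtain c m where c: "a' + b' = c *\<^sub>R (a + b)" "b' - a' = c *\<^sub>R (b - a) + m *\<^sub>R (a + b)"
    unfolding gvec_def using tvec_eq_iff pair_nonzero[OF ab] pair_nonzero[OF ab'] by blast
  have "c *\<^sub>R a + c *\<^sub>R b \<in> C" using c(1) ab' by (simp add: pair_def scaleR_add_right)
  then have c0: "c > 0" using pair_comb[OF ab] by blast
  \<comment> \<open>Solving for \<open>b'\<close> and \<open>a'\<close>: a positive \<open>m\<close>
    would put \<open>b'\<close> into \<open>C\<close>, a negative one \<open>a'\<close>.\<close>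
  have "2 *\<^sub>R b' = (a' + b') + (b' - a')" by (simp add: scaleR_2)
  also have "\<dots> = m *\<^sub>R a + (2 * c + m) *\<^sub>R b" unfolding c by (simp add: vec_eq_iff algebra_simps)
  finally have b': "2 *\<^sub>R b' = m *\<^sub>R a + (2 * c + m) *\<^sub>R b" .
  have "2 *\<^sub>R a' = (a' + b') - (b' - a')" by (simp add: scaleR_2)
  also have "\<dots> = (2 * c - m) *\<^sub>R a + (- m) *\<^sub>R b" unfolding c by (simp add: vec_eq_iff algebra_simps)
  finally have a': "2 *\<^sub>R a' = (2 * c - m) *\<^sub>R a + (- m) *\<^sub>R b" .
  have notC: "2 *\<^sub>R z \<notin> C" if "z \<in> K - C" for z using C_scale[of "1/2" "2 *\<^sub>R z"] that by auto
  have "2 *\<^sub>R b' \<notin> C" "2 *\<^sub>R a' \<notin> C" using ab' notC by (auto simp: pair_def)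
  then have "\<not> (m > 0 \<and> 2 * c + m > 0)" "\<not> (2 * c - m > 0 \<and> - m > 0)"
    unfolding a' b' pair_comb[OF ab] by blast+
  then have "m = 0" using c0 by linarith
  then have "b' = c *\<^sub>R b" "a' = c *\<^sub>R a"
    using a' b' by (simp_all add: vec_eq_iff)
  then show "\<exists>c>0. a' = c *\<^sub>R a \<and> b' = c *\<^sub>R b" using c0 by blast
next
  assume "\<exists>c>0. a' = c *\<^sub>R a \<and> b' = c *\<^sub>R b"
  then obtain c where c: "c > 0" "a' = c *\<^sub>R a" "b' = c *\<^sub>R b" by blast
  show "gvec a b = gvec a' b'" unfolding gvec_def
  proof (subst tvec_eq_iff)
    show "\<exists>d m. d \<noteq> 0 \<and> a' + b' = d *\<^sub>R (a + b) \<and> b' - a' = d *\<^sub>R (b - a) + m *\<^sub>R (a + b)"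
      using c by (intro exI[of _ c] exI[of _ 0]) (simp add: algebra_simps)
  qed (use pair_nonzero[OF ab] pair_nonzero[OF ab'] in auto)
qed

section \<open>Geodesics and the flow in explicit form\<close>

lemma pair_scale: "pair a b \<Longrightarrow> s > 0 \<Longrightarrow> t > 0 \<Longrightarrow> pair (s *\<^sub>R a) (t *\<^sub>R b)"
proof -
  assume ab: "pair a b" and st: "s > 0" "t > 0"
  show "pair (s *\<^sub>R a) (t *\<^sub>R b)"
    using ab st K_minus_C_scale pair_comb[OF ab, of s t] unfolding pair_def by blast
qed

definition geod :: "real^'n \<Rightarrow> real^'n \<Rightarrow> real \<Rightarrow> 'n projective" where
  "geod a b t = proj (exp (- t) *\<^sub>R a + exp t *\<^sub>R b)"

lemma geod_nonzero: "pair a b \<Longrightarrow> exp (- t) *\<^sub>R a + exp t *\<^sub>R b \<noteq> 0"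
  using pair_comb[of a b "exp (- t)" "exp t"] C_nonzero by auto

lemma geod_velocity:
  assumes ab: "pair a b"
  shows "has_velocity (geod a b) t (gvec (exp (- t) *\<^sub>R a) (exp t *\<^sub>R b))"
    "has_velocity (\<lambda>s. geod a b (- s)) 0 (gvec b a)"
proof -
  show "has_velocity (geod a b) t (gvec (exp (- t) *\<^sub>R a) (exp t *\<^sub>R b))"
    unfolding has_velocity_def gvec_def geod_def
    by (intro exI[of _ "\<lambda>s. exp (- s) *\<^sub>R a + exp s *\<^sub>R b"] exI conjI allI geod_nonzero[OF ab] refl)
      (auto intro!: derivative_eq_intros simp: has_real_derivative_iff_has_vector_derivative[symmetric])
  have "((\<lambda>s. exp s *\<^sub>R a + exp (- s) *\<^sub>R b) has_vector_derivative a - b) (at 0)"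
    by (auto intro!: derivative_eq_intros simp: has_real_derivative_iff_has_vector_derivative[symmetric])
  then show "has_velocity (\<lambda>s. geod a b (- s)) 0 (gvec b a)"
    unfolding has_velocity_def gvec_def geod_def using geod_nonzero[OF ab, of "- s" for s]
    by (intro exI[of _ "\<lambda>s. exp s *\<^sub>R a + exp (- s) *\<^sub>R b"] exI[of _ "a - b"]) (simp add: add.commute)
qed

lemma geod_dist:
  assumes ab: "pair a b"
  shows "hilbert_dist \<Omega> (geod a b s) (geod a b t) = \<bar>s - t\<bar>"
proof -
  have "exp t / exp (- t) = exp (2 * t)" for t :: real by (simp add: exp_minus field_simps flip: exp_add)
  then have ln2: "ln (exp t / exp (- t)) = 2 * t" for t :: real by simp
  have "hilbert_dist \<Omega> (geod a b s) (geod a b t) = \<bar>2 * t - 2 * s\<bar> / 2"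
    unfolding geod_def by (subst hilbert_dist_pair_comb[OF ab]) (simp_all only: ln2 exp_gt_zero)
  also have "\<dots> = \<bar>s - t\<bar>" by (simp add: abs_if)
  finally show ?thesis .
qed

lemma geod_range:
  assumes ab: "pair a b"
  shows "range (geod a b) = projset (tplane (gvec a b)) \<inter> \<Omega>"
proof (intro subset_antisym subsetI)
  fix x assume "x \<in> range (geod a b)"
  then obtain t where t: "x = geod a b t" by blast
  let ?z = "exp (- t) *\<^sub>R a + exp t *\<^sub>R b"
  have zC: "?z \<in> C" using pair_comb[OF ab] by simp
  have "?z = ((exp (- t) + exp t) / 2) *\<^sub>R (a + b) + ((exp t - exp (- t)) / 2) *\<^sub>R (b - a)"
    by (simp add: algebra_simps flip: scaleR_add_left) (simp add: field_simps flip: scaleR_add_left)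
  then have "?z \<in> span {a + b, b - a}"
    by (metis span_add span_scale span_base insertI1 insertI2)
  then show "x \<in> projset (tplane (gvec a b)) \<inter> \<Omega>"
    using zC C_nonzero pair_nonzero[OF ab] unfolding t geod_def gvec_def
    by (auto simp: tplane_tvec projset_def \<Omega>_def)
next
  fix x assume "x \<in> projset (tplane (gvec a b)) \<inter> \<Omega>"
  then obtain z where z: "z \<in> span {a + b, b - a}" "z \<noteq> 0" "x = proj z" "proj z \<in> \<Omega>"
    using pair_nonzero[OF ab] by (auto simp: tplane_tvec gvec_def projset_def)
  then obtain l m where lm: "z = l *\<^sub>R (a + b) + m *\<^sub>R (b - a)"
    by (auto simp: span_insert algebra_simps)
  then have "z = (l - m) *\<^sub>R a + (l + m) *\<^sub>R b" by (simp add: algebra_simps)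
  moreover have "z \<in> C \<or> - z \<in> C" using z proj_mem_\<Omega> by blast
  ultimately obtain \<alpha> \<beta> where ab': "\<alpha> *\<^sub>R a + \<beta> *\<^sub>R b \<in> C" "proj (\<alpha> *\<^sub>R a + \<beta> *\<^sub>R b) = x"
    using z(2,3) proj_minus[OF z(2)] by (metis minus_add_distrib scaleR_minus_left)
  have pos: "\<alpha> > 0" "\<beta> > 0" using pair_comb[OF ab] ab' by blast+
  \<comment> \<open>\<open>t\<close> and \<open>c\<close> solve
    \<open>c * exp (- t) = \<alpha>\<close> and \<open>c * exp t = \<beta>\<close>.\<close>
  define t where "t = ln (\<beta> / \<alpha>) / 2"
  define c where "c = sqrt (\<alpha> * \<beta>)"
  have c: "c > 0" using pos by (simp add: c_def)
  have et: "exp t = sqrt (\<beta> / \<alpha>)" using pos by (simp add: t_def ln_sqrt[symmetric] flip: ln_sqrt)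
  have "c * exp t = \<beta>" unfolding et c_def using pos by (simp flip: real_sqrt_mult)
  moreover have "c * exp (- t) = \<alpha>" unfolding exp_minus et c_def using pos
    by (simp add: real_sqrt_divide real_sqrt_mult field_simps)
  ultimately have "\<alpha> *\<^sub>R a + \<beta> *\<^sub>R b = c *\<^sub>R (exp (- t) *\<^sub>R a + exp t *\<^sub>R b)"
    by (metis scaleR_add_right scaleR_scaleR)
  then have "x = geod a b t"
    using ab'(2) c proj_scale[of c, OF _ geod_nonzero[OF ab, of t]] by (simp add: geod_def)
  then show "x \<in> range (geod a b)" by blast
qed

lemma geodesic_param_geod: "pair a b \<Longrightarrow> geodesic_param \<Omega> (gvec a b) (geod a b)"
  unfolding geodesic_param_def using geod_range geod_dist geod_velocity(1)[of a b 0] by simp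

text \<open>An isometric parametrisation of the same line is \<open>geod a b\<close> composed with
  an isometry of the real line that fixes 0. The reflection is ruled out by its velocity
  \<open>gvec b a\<close>.\<close>

lemma geodesic_param_unique:
  assumes ab: "pair a b" and c: "geodesic_param \<Omega> (gvec a b) c"
  shows "c = geod a b"
proof -
  have "range c = range (geod a b)" using c geod_range[OF ab] by (simp add: geodesic_param_def)
  then have "\<forall>s. \<exists>\<tau>. c s = geod a b \<tau>" by blast
  then obtain \<tau> where \<tau>: "\<And>s. c s = geod a b (\<tau> s)" by metis
  have iso: "\<bar>\<tau> s - \<tau> t\<bar> = \<bar>s - t\<bar>" for s t
    using c geod_dist[OF ab, of "\<tau> s" "\<tau> t"] unfolding geodesic_param_def \<tau> by metis
  have vel: "has_velocity c 0 (gvec a b)" using c by (simp add: geodesic_param_def)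
  then obtain \<gamma> u where "\<forall>s. \<gamma> s \<noteq> 0 \<and> c s = proj (\<gamma> s)" "gvec a b = tvec (\<gamma> 0, u)"
    unfolding has_velocity_def by blast
  then have "c 0 = proj (a + b)"
    using tbase_tvec pair_nonzero[OF ab] unfolding gvec_def by metis
  then have "c 0 = geod a b 0" by (simp add: geod_def)
  then have "\<bar>\<tau> 0 - 0\<bar> = 0"
    using geod_dist[OF ab, of "\<tau> 0" 0] \<tau>[of 0] by (simp add: hilbert_dist_def)
  then have \<tau>0: "\<tau> 0 = 0" by simp
  have abs: "\<bar>\<tau> s\<bar> = \<bar>s\<bar>" for s using iso[of s 0] \<tau>0 by simp
  show ?thesis
  proof (cases "\<tau> 1 = 1")
    case True
    have "\<tau> s = s" for s using abs[of s] iso[of s 1] True by (auto simp: abs_if split: if_splits)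
    then show ?thesis using \<tau> by auto
  next
    case False
    then have "\<tau> 1 = -1" using abs[of 1] by auto
    then have "\<tau> s = - s" for s using abs[of s] iso[of s 1] by (auto simp: abs_if split: if_splits)
    then have "c = (\<lambda>s. geod a b (- s))" using \<tau> by auto
    then have "gvec a b = gvec b a" using vel geod_velocity(2)[OF ab] has_velocity_unique by blast
    then obtain k where "b = k *\<^sub>R a" using gvec_eq_iff[of a b b a] ab pair_commute by blast
    then have "k *\<^sub>R a + (-1) *\<^sub>R b = 0" by simp
    then show ?thesis using pair_independent[OF ab] by fastforce
  qed
qed

theorem flow_gvec:
  assumes ab: "pair a b"
  shows "flow \<Omega> t (gvec a b) = gvec (exp (- t) *\<^sub>R a) (exp t *\<^sub>R b)"
  unfolding flow_def
proof (rule the_equality)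
  show "\<exists>c. geodesic_param \<Omega> (gvec a b) c \<and> has_velocity c t (gvec (exp (- t) *\<^sub>R a) (exp t *\<^sub>R b))"
    using geodesic_param_geod[OF ab] geod_velocity(1)[OF ab] by blast
  show "v = gvec (exp (- t) *\<^sub>R a) (exp t *\<^sub>R b)" if "\<exists>c. geodesic_param \<Omega> (gvec a b) c \<and> has_velocity c t v" for v
    using that geodesic_param_unique[OF ab] geod_velocity(1)[OF ab] has_velocity_unique by metis
qed

lemma tbase_flow: "pair a b \<Longrightarrow> tbase (flow \<Omega> t (gvec a b)) = geod a b t"
  unfolding flow_gvec by (simp add: gvec_def tbase_tvec geod_nonzero geod_def)

lemma forward_end_gvec:
  assumes ab: "pair a b"
  shows "forward_end \<Omega> (gvec a b) = proj b"
proof -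
  have nz: "b \<noteq> 0" using pair_nonzero[OF ab] by blast
  have "((\<lambda>t::real. exp (- t)) \<longlongrightarrow> 0) at_top"
    using filterlim_compose[OF exp_at_bot filterlim_uminus_at_bot_at_top] by simp
  then have "((\<lambda>t. (exp (- t) * exp (- t)) *\<^sub>R a + b) \<longlongrightarrow> (0 * 0) *\<^sub>R a + b) at_top"
    by (intro tendsto_intros)
  then have "((\<lambda>t. proj ((exp (- t) * exp (- t)) *\<^sub>R a + b)) \<longlongrightarrow> proj b) at_top"
    using nz by (intro tendsto_proj) auto
  moreover have "proj ((exp (- t) * exp (- t)) *\<^sub>R a + b) = geod a b t" for t
  proof -
    have "(exp (- t) * exp (- t)) *\<^sub>R a + b = exp (- t) *\<^sub>R (exp (- t) *\<^sub>R a + exp t *\<^sub>R b)"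
      by (simp add: scaleR_add_right flip: exp_add)
    then show ?thesis using geod_nonzero[OF ab] by (simp add: geod_def proj_scale)
  qed
  ultimately show ?thesis
    unfolding forward_end_def tbase_flow[OF ab] by (intro tendsto_Lim) auto
qed

lemma backward_end_gvec:
  assumes ab: "pair a b"
  shows "backward_end \<Omega> (gvec a b) = proj a"
proof -
  have nz: "a \<noteq> 0" using pair_nonzero[OF ab] by blast
  have "((\<lambda>t::real. exp t) \<longlongrightarrow> 0) at_bot" by (rule exp_at_bot)
  then have "((\<lambda>t. (exp t * exp t) *\<^sub>R b + a) \<longlongrightarrow> (0 * 0) *\<^sub>R b + a) at_bot"
    by (intro tendsto_intros)
  then have "((\<lambda>t. proj ((exp t * exp t) *\<^sub>R b + a)) \<longlongrightarrow> proj a) at_bot"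
    using nz by (intro tendsto_proj) auto
  moreover have "proj ((exp t * exp t) *\<^sub>R b + a) = geod a b t" for t
  proof -
    have "(exp t * exp t) *\<^sub>R b + a = exp t *\<^sub>R (exp (- t) *\<^sub>R a + exp t *\<^sub>R b)"
      by (simp add: scaleR_add_right flip: exp_add)
    then show ?thesis using geod_nonzero[OF ab] by (simp add: geod_def proj_scale)
  qed
  ultimately show ?thesis
    unfolding backward_end_def tbase_flow[OF ab] by (intro tendsto_Lim) auto
qed

lemma pgl_tact_gvec:
  assumes "pair a b" "invertible A"
  shows "pgl_tact (pgl A) (gvec a b) = gvec (A *v a) (A *v b)"
  using assms pair_nonzero[OF assms(1)]
  by (simp add: gvec_def pgl_tact_tvec matrix_vector_right_distrib matrix_vector_mult_diff_distrib)

lemma preserves_K_minus_C: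
  assumes "preserves A" "preserves B" "B ** A = mat 1" "v \<in> K - C"
  shows "A *v v \<in> K - C"
proof -
  have "A *v v \<notin> C"
  proof
    assume "A *v v \<in> C"
    then have "B *v (A *v v) \<in> C" using assms by (simp add: preserves_def)
    then show False using assms by (simp add: inverse_pair_vec)
  qed
  then show ?thesis using assms preserves_K by blast
qed

lemma pair_preserves:
  assumes "preserves A" "preserves B" "B ** A = mat 1" "pair a b"
  shows "pair (A *v a) (A *v b)"
  using assms preserves_K_minus_C[OF assms(1-3)] unfolding pair_def preserves_def
  by (metis matrix_vector_right_distrib)

lemma gvec_near:
  assumes U: "open U" "gvec a b \<in> U" and ab: "pair a b"
  shows "\<exists>e>0. \<forall>a' b'. norm (a' - a) < e \<longrightarrow> norm (b' - b) < e \<longrightarrow> pair a' b' \<longrightarrow> gvec a' b' \<in> U"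
proof -
  let ?S = "{(p, u). p \<noteq> 0 \<and> tvec (p, u) \<in> U}"
  have "open ?S" using U(1) by (simp add: open_ptangent_def)
  moreover have "(a + b, b - a) \<in> ?S" using U(2) pair_nonzero[OF ab] by (simp add: gvec_def)
  ultimately obtain e where e: "e > 0" "ball (a + b, b - a) e \<subseteq> ?S" using open_contains_ball by blast
  have "gvec a' b' \<in> U" if "norm (a' - a) < e / 4" "norm (b' - b) < e / 4" for a' b'
  proof -
    have "dist (a + b, b - a) (a' + b', b' - a') \<le> norm ((a' + b') - (a + b)) + norm ((b' - a') - (b - a))"
      unfolding dist_norm by (metis norm_Pair_le minus_prod_def diff_Pair norm_minus_commute)
    also have "\<dots> = norm ((a' - a) + (b' - b)) + norm ((b' - b) - (a' - a))" by (simp add: algebra_simps)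
    also have "\<dots> \<le> (norm (a' - a) + norm (b' - b)) + (norm (b' - b) + norm (a' - a))"
      by (intro add_mono norm_triangle_ineq norm_triangle_ineq4)
    also have "\<dots> < e" using that by linarith
    finally have "(a' + b', b' - a') \<in> ?S" using e(2) by (auto simp: subset_eq)
    then show ?thesis by (simp add: gvec_def)
  qed
  then show ?thesis using e(1) by (intro exI[of _ "e / 4"]) auto
qed

end


subsection \<open>Dynamics of automorphisms with an attracting and a repelling fixed point\<close>

lemma mpow_Suc_vec_right: "mpow A (Suc n) *v v = mpow A n *v (A *v v)"
  by (simp only: mpow_Suc_vec mpow_vec_shift)

lemma mpow_inverse:
  fixes A B :: "real^'n^'n"
  assumes "A ** B = mat 1"
  shows "mpow A n *v (mpow B n *v v) = v"
proof (induction n)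
  case (Suc n)
  have "mpow A (Suc n) *v (mpow B (Suc n) *v v) = mpow A n *v (A *v (B *v (mpow B n *v v)))"
    by (simp only: mpow_Suc_vec_right[of A] mpow_Suc_vec[of B])
  then show ?case using Suc inverse_pair_vec[OF assms] by metis
qed simp

lemma inverse_eigenvector:
  fixes A B :: "real^'n^'n"
  assumes "B ** A = mat 1" "A *v x = r *\<^sub>R x" "r \<noteq> 0"
  shows "B *v x = (1 / r) *\<^sub>R x"
proof -
  have "r *\<^sub>R (B *v x) = B *v (A *v x)" by (simp add: assms(2) matrix_vector_mult_scaleR)
  also have "\<dots> = x" by (rule inverse_pair_vec[OF assms(1)])
  finally have "(1 / r) *\<^sub>R (r *\<^sub>R (B *v x)) = (1 / r) *\<^sub>R x" by simp
  then show ?thesis using assms(3) by simp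
qed

lemma inner_transpose: "(transpose A *v h) \<bullet> v = h \<bullet> (A *v v)" for A :: "real^'n^'n"
  using dot_lmul_matrix[of h A v] by simp

lemma transpose_mult_nonzero:
  fixes A B :: "real^'n^'n"
  assumes "A ** B = mat 1" "h \<noteq> 0" shows "transpose A *v h \<noteq> 0"
proof
  assume z: "transpose A *v h = 0"
  have "h \<bullet> v = 0" for v
    using inner_transpose[of A h "B *v v"] inverse_pair_vec[OF assms(1), of v] z by simp
  then show False using assms(2) by (metis inner_eq_zero_iff)
qed

lemma mpow_transpose: "mpow (transpose A) n = transpose (mpow A n)" for A :: "real^'n^'n"
proof -
  have "(mpow (transpose A) n *v h) \<bullet> v = (transpose (mpow A n) *v h) \<bullet> v" for h v
  proof (induction n arbitrary: h)
    case (Suc n)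
    have "(mpow (transpose A) (Suc n) *v h) \<bullet> v = (mpow (transpose A) n *v (transpose A *v h)) \<bullet> v"
      by (simp only: mpow_Suc_vec_right)
    also have "\<dots> = (transpose (mpow A n) *v (transpose A *v h)) \<bullet> v" by (rule Suc)
    also have "\<dots> = h \<bullet> (mpow A (Suc n) *v v)" by (simp only: inner_transpose mpow_Suc_vec)
    finally show ?case by (simp only: inner_transpose)
  qed (simp add: transpose_mat)
  then have "mpow (transpose A) n *v h = transpose (mpow A n) *v h" for h
    by (metis inner_commute vector_eq_ldot)
  then show ?thesis by (simp add: matrix_eq)
qed

lemma attracts_transpose:
  fixes A :: "real^'n^'n"
  assumes "attracts A r x e"
  shows "attracts (transpose A) r e x"
proof -
  have "(\<lambda>n. transpose ((1 / r ^ n) *\<^sub>R mpow A n)) \<longlonglongrightarrow> transpose (outer x e)"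
    using assms unfolding attracts_def transpose_def
    by (intro tendsto_vec_lambda tendsto_vec_nth) blast
  moreover have "transpose (c *\<^sub>R M) = c *\<^sub>R transpose M" for c and M :: "real^'n^'n"
    by (simp add: transpose_def vec_eq_iff)
  ultimately have "(\<lambda>n. (1 / r ^ n) *\<^sub>R mpow (transpose A) n) \<longlonglongrightarrow> outer e x"
    by (simp only: transpose_outer mpow_transpose)
  then show ?thesis using assms by (simp add: attracts_def inner_commute)
qed

lemma attracts_functional_inverse:
  assumes "attracts A r x e" "A ** B = mat 1"
  shows "e \<bullet> (mpow B n *v v) = (1 / r ^ n) * (e \<bullet> v)"
proof (induction n)
  case (Suc n)
  have r: "r \<noteq> 0" using assms(1) by (simp add: attracts_def)
  have "r * (e \<bullet> (B *v u)) = e \<bullet> u" for u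
    using attracts_functional[OF assms(1), of "B *v u"] inverse_pair_vec[OF assms(2), of u] by simp
  then have "e \<bullet> (B *v u) = (1 / r) * (e \<bullet> u)" for u using r by (simp add: field_simps)
  then show ?case using Suc by (simp add: mpow_Suc_vec del: mpow.simps)
qed simp

text \<open>
  On the invariant complement of \<open>x\<close> the inverse of \<open>A\<close> grows faster than \<open>r\<^sup>-\<^sup>n\<close>, the rate on \<open>x\<close>.
\<close>

lemma attracts_escape:
  fixes A B :: "real^'n^'n"
  assumes at: "attracts A r x e" and AB: "A ** B = mat 1" "B ** A = mat 1" and v: "v \<noteq> 0" "e \<bullet> v = 0"
  shows "\<exists>\<sigma> u. strict_mono (\<sigma> :: nat \<Rightarrow> nat) \<and> norm u = 1 \<and>
    (\<lambda>n. (1 / norm (mpow B (\<sigma> n) *v v)) *\<^sub>R (mpow B (\<sigma> n) *v v)) \<longlonglongrightarrow> u \<and>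
    (\<lambda>n. 1 / (r ^ \<sigma> n * norm (mpow B (\<sigma> n) *v v))) \<longlonglongrightarrow> 0"
proof -
  define N where "N n = norm (mpow B n *v v)" for n
  define q where "q n = (1 / N n) *\<^sub>R (mpow B n *v v)" for n
  have nz: "mpow B n *v v \<noteq> 0" for n
    using mpow_inverse[OF AB(1), of n v] v(1) by (metis matrix_vector_mult_0_right)
  then have q: "q n \<in> sphere 0 1" for n by (simp add: q_def N_def)
  obtain u \<sigma> where u: "u \<in> sphere 0 1" "strict_mono \<sigma>" "(q \<circ> \<sigma>) \<longlonglongrightarrow> u"
    using compact_sphere[of "0::real^'n" 1] q unfolding compact_def by metis
  have "e \<bullet> q n = 0" for n
    using attracts_functional_inverse[OF at AB(1), of n v] v(2) by (simp add: q_def)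
  then have eu: "e \<bullet> u = 0"
    using tendsto_inner[OF tendsto_const[of e] u(3)] by (simp add: o_def LIMSEQ_const_iff)
  have "(\<lambda>n. (1 / r ^ n) *\<^sub>R mpow A n) \<longlonglongrightarrow> outer x e" using at by (simp add: attracts_def)
  from LIMSEQ_subseq_LIMSEQ[OF this u(2)]
  have "(\<lambda>n. ((1 / r ^ \<sigma> n) *\<^sub>R mpow A (\<sigma> n)) *v q (\<sigma> n)) \<longlonglongrightarrow> outer x e *v u"
    using u(3) unfolding o_def by (rule tendsto_matrix_vector_mult)
  moreover have "((1 / r ^ n) *\<^sub>R mpow A n) *v q n = (1 / (r ^ n * N n)) *\<^sub>R v" for n
    by (simp add: q_def scaleR_matrix_vector matrix_vector_mult_scaleR mpow_inverse[OF AB(1)])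
  ultimately have "(\<lambda>n. (1 / (r ^ \<sigma> n * N (\<sigma> n))) *\<^sub>R v) \<longlonglongrightarrow> 0"
    using eu by (simp add: outer_mult_vec)
  from tendsto_inner[OF this tendsto_const[of v]]
  have "(\<lambda>n. (1 / (r ^ \<sigma> n * N (\<sigma> n))) * (v \<bullet> v)) \<longlonglongrightarrow> 0" by simp
  from tendsto_divide[OF this tendsto_const[of "v \<bullet> v"]]
  have "(\<lambda>n. 1 / (r ^ \<sigma> n * N (\<sigma> n))) \<longlonglongrightarrow> 0" using v(1) by simp
  then show ?thesis using u unfolding q_def N_def o_def by (intro exI[of _ \<sigma>] exI[of _ u]) simp
qed

lemma bounded_tendsto_zeroI:
  fixes z :: "nat \<Rightarrow> 'a::euclidean_space"
  assumes bd: "\<And>n. norm (z n) \<le> M"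
    and sub: "\<And>\<sigma> l. strict_mono (\<sigma> :: nat \<Rightarrow> nat) \<Longrightarrow> (\<lambda>n. z (\<sigma> n)) \<longlonglongrightarrow> l \<Longrightarrow> l = 0"
  shows "z \<longlonglongrightarrow> 0"
proof (rule ccontr)
  assume "\<not> ?thesis"
  then obtain e where e: "e > 0" "\<And>N. \<exists>n\<ge>N. norm (z n) \<ge> e"
    unfolding LIMSEQ_def by (auto simp: not_less)
  have "infinite {n. norm (z n) \<ge> e}"
    unfolding infinite_nat_iff_unbounded_le using e(2) by blast
  then obtain \<rho> :: "nat \<Rightarrow> nat" where \<rho>: "strict_mono \<rho>" "\<And>n. norm (z (\<rho> n)) \<ge> e"
    using infinite_enumerate by blast
  have "z (\<rho> n) \<in> cball 0 M" for n using bd by simp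
  then obtain l \<sigma> where \<sigma>: "strict_mono \<sigma>" "((\<lambda>n. z (\<rho> n)) \<circ> \<sigma>) \<longlonglongrightarrow> l"
    using compact_cball[of "0::'a" M] unfolding compact_def by metis
  from \<sigma>(2) have lim: "(\<lambda>n. z (\<rho> (\<sigma> n))) \<longlonglongrightarrow> l" by (simp add: o_def)
  have "l = 0" using sub[of "\<lambda>n. \<rho> (\<sigma> n)" l] \<sigma>(1) lim \<rho>(1) by (simp add: strict_mono_def)
  moreover have "norm l \<ge> e"
    by (rule LIMSEQ_le_const[OF tendsto_norm[OF lim]]) (use \<rho>(2) in blast)
  ultimately show False using e(1) by simp
qed

context cone
begin

lemma not_C_limit:
  assumes "f \<longlonglongrightarrow> l" "\<And>n. f n \<notin> C" shows "l \<notin> C"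
proof
  assume "l \<in> C"
  from topological_tendstoD[OF assms(1) open_C this] have "\<forall>\<^sub>F n in sequentially. f n \<in> C" .
  then have "\<forall>\<^sub>F n in sequentially. False" using assms(2) by (auto elim: eventually_mono)
  then show False by simp
qed

lemma K_limit: "f \<longlonglongrightarrow> l \<Longrightarrow> (\<And>n. f n \<in> K) \<Longrightarrow> l \<in> K"
  using closed_K closed_sequential_limits by blast

lemma functional_nonzero_on_C:
  assumes "h \<noteq> 0" "C \<noteq> {}" shows "\<exists>v\<in>C. h \<bullet> v \<noteq> 0"
proof (rule ccontr)
  assume n: "\<not> ?thesis"
  then obtain v where v: "v \<in> C" "h \<bullet> v = 0" using assms(2) by blast
  then have "h \<bullet> v > 0" using nonneg_functional_pos[OF assms(1)] n by fastforce
  then show False using v by simp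
qed

section \<open>Fixed points and dual eigenvectors of an automorphism of the cone\<close>

lemma attracts_in_K:
  assumes A: "preserves A" and at: "attracts A r x e" and ne: "C \<noteq> {}"
  shows "x \<in> K \<or> - x \<in> K" "x \<in> K \<Longrightarrow> r > 0" "x \<in> K \<Longrightarrow> v \<in> K \<Longrightarrow> e \<bullet> v \<ge> 0"
proof -
  have r: "r \<noteq> 0" and x: "x \<noteq> 0" using at attracts_nonzero by (auto simp: attracts_def)
  have lim: "(e \<bullet> v) *\<^sub>R x \<in> K" if v: "v \<in> C" for v
  proof (rule K_limit)
    \<comment> \<open>Along even exponents the factors \<open>1 / r ^ (2 * n)\<close> are positive
      whatever the sign of \<open>r\<close>.\<close>
    have "strict_mono (\<lambda>n::nat. 2 * n)" by (simp add: strict_mono_def)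
    from LIMSEQ_subseq_LIMSEQ[OF attracts_tendsto[OF at, of v] this]
    show "(\<lambda>n. (1 / r ^ (2 * n)) *\<^sub>R (mpow A (2 * n) *v v)) \<longlonglongrightarrow> (e \<bullet> v) *\<^sub>R x" by (simp add: o_def)
    have "mpow A n *v v \<in> C" for n using preserves_mpow[OF A] v by (simp add: preserves_def)
    then show "(1 / r ^ (2 * n)) *\<^sub>R (mpow A (2 * n) *v v) \<in> K" for n
      by (intro K_scale C_K) (auto simp: power_mult)
  qed
  have "e \<noteq> 0" using at by (auto simp: attracts_def)
  then obtain v where v: "v \<in> C" "e \<bullet> v \<noteq> 0" using functional_nonzero_on_C ne by blast
  show "x \<in> K \<or> - x \<in> K"
    using K_scale[OF lim[OF v(1)], of "1 / \<bar>e \<bullet> v\<bar>"] v(2) by (cases "e \<bullet> v > 0") auto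
  show "r > 0" if "x \<in> K"
    using preserves_K[OF A that] K_sign[OF that, of r] x r attracts_eigenvector[OF at] by simp
  show "e \<bullet> v \<ge> 0" if "x \<in> K" "v \<in> K" for v
    using nonneg_on_K[OF _ that(2), of e] K_sign[OF that(1) lim x] by blast
qed

text \<open>An automorphism with both attracting points lifted to \<open>K\<close>; \<open>e\<close>
  and \<open>f\<close> are the dual eigenvectors. Its axis is \<open>pair y x\<close>, from the
  repelling to the attracting point. The last conjunct serves to exclude
  \<open>r * s = 1\<close>.\<close>

definition hyperbolic :: "real^'n^'n \<Rightarrow> real^'n^'n \<Rightarrow> real \<Rightarrow> real \<Rightarrow> real^'n \<Rightarrow> real^'n \<Rightarrow> real^'n \<Rightarrow> real^'n \<Rightarrow> bool" where
  "hyperbolic A B r s x y e f \<longleftrightarrow> A ** B = mat 1 \<and> B ** A = mat 1 \<and> preserves A \<and> preserves B \<and>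
    attracts A r x e \<and> attracts B s y f \<and> x \<in> K \<and> y \<in> K \<and> x + y \<in> C \<and> proj x \<noteq> proj y"

lemma hyperbolic_sym: "hyperbolic A B r s x y e f \<Longrightarrow> hyperbolic B A s r y x f e"
  by (auto simp: hyperbolic_def add.commute)

text \<open>Invariance gives \<open>e \<bullet> y = r * s * (e \<bullet> y)\<close>. If
  \<open>r * s = 1\<close>, then \<open>x\<close> would be an eigenvector of \<open>B\<close> for
  its dominant eigenvalue and so a multiple of \<open>y\<close>.\<close>

lemma hyperbolic_orthogonal:
  assumes h: "hyperbolic A B r s x y e f"
  shows "e \<bullet> y = 0"
proof -
  have A: "attracts A r x e" and B: "attracts B s y f" and AB: "A ** B = mat 1" "B ** A = mat 1"
    using h by (auto simp: hyperbolic_def)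
  have r: "r \<noteq> 0" and s: "s \<noteq> 0" using A B by (simp_all add: attracts_def)
  have x: "x \<noteq> 0" and y: "y \<noteq> 0" using A B attracts_nonzero by blast+
  have "r * s \<noteq> 1"
  proof
    assume rs: "r * s = 1"
    have "B *v x = s *\<^sub>R x"
      using inverse_eigenvector[OF AB(2) attracts_eigenvector[OF A] r] rs r by (simp add: field_simps)
    from mpow_eigenvector[OF this]
    have "x = (f \<bullet> x) *\<^sub>R y" using attracts_tendsto[OF B, of x] s by (simp add: LIMSEQ_const_iff)
    moreover from this have "f \<bullet> x \<noteq> 0" using x by auto
    ultimately have "proj x = proj y" using proj_scale[OF _ y] by metis
    then show False using h by (simp add: hyperbolic_def)
  qed
  moreover have "e \<bullet> y = r * (s * (e \<bullet> y))"
    using attracts_functional[OF A, of "B *v y"] inverse_pair_vec[OF AB(1), of y] attracts_eigenvector[OF B] by simp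
  ultimately show ?thesis by auto
qed

text \<open>The supporting functionals are crossed: the functional dual to one fixed point vanishes
  at the other. This is what keeps both fixed points out of \<open>C\<close>.\<close>

lemma hyperbolic_props:
  assumes h: "hyperbolic A B r s x y e f"
  shows "r > 0" "s > 0" "supports e y" "supports f x" "pair y x" "r * s > 1"
    "A *v x = r *\<^sub>R x" "A *v y = (1 / s) *\<^sub>R y"
proof -
  have A: "attracts A r x e" and B: "attracts B s y f" and AB: "A ** B = mat 1" "B ** A = mat 1"
    and p: "preserves A" "preserves B" and xy: "x \<in> K" "y \<in> K" "x + y \<in> C"
    using h by (auto simp: hyperbolic_def)
  have ne: "C \<noteq> {}" using xy by blast
  show r: "r > 0" and s: "s > 0" using attracts_in_K[OF p(1) A ne] attracts_in_K[OF p(2) B ne] xy by auto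
  have ey: "e \<bullet> y = 0" by (rule hyperbolic_orthogonal[OF h])
  have fx: "f \<bullet> x = 0" by (rule hyperbolic_orthogonal[OF hyperbolic_sym[OF h]])
  show e: "supports e y" and f: "supports f x"
    using attracts_in_K(3)[OF p(1) A ne xy(1)] attracts_in_K(3)[OF p(2) B ne xy(2)] ey fx A B
    by (auto simp: supports_def attracts_def)
  show "pair y x" unfolding pair_def
    using xy supports_pos[OF e, of y] supports_pos[OF f, of x] ey fx by (auto simp: add.commute)
  show Ax: "A *v x = r *\<^sub>R x" by (rule attracts_eigenvector[OF A])
  show Ay: "A *v y = (1 / s) *\<^sub>R y"
    using inverse_eigenvector[OF AB(1) attracts_eigenvector[OF B]] s by simp
  have y: "y \<noteq> 0" using B attracts_nonzero by blast
  \<comment> \<open>As \<open>e \<bullet> y = 0\<close>, the rescaled powers of \<open>A\<close>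
    send \<open>y\<close>, whose eigenvalue is \<open>1 / s\<close>, to 0.\<close>
  have "(\<lambda>n. (1 / r ^ n) *\<^sub>R ((1 / s) ^ n *\<^sub>R y)) \<longlonglongrightarrow> 0"
    using attracts_tendsto[OF A, of y] unfolding mpow_eigenvector[OF Ay] ey by simp
  from power_scale_tendsto_zero[OF this y] r s show "r * s > 1" by (simp add: field_simps)
qed

lemma supports_transpose:
  assumes "preserves A" "preserves B" "A ** B = mat 1" "supports h (A *v x)"
  shows "supports (transpose A *v h) x"
proof -
  have "transpose A *v h \<noteq> 0"
    using transpose_mult_nonzero[OF assms(3)] assms(4) by (simp add: supports_def)
  then show ?thesis
    using assms preserves_K[OF assms(1)] unfolding supports_def inner_transpose by auto
qed

lemma smooth_preserves:
  assumes "preserves A" "preserves B" "A ** B = mat 1" "B ** A = mat 1" "smooth x"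
  shows "smooth (A *v x)"
  unfolding smooth_def
proof (intro allI impI, elim conjE)
  fix h h' assume h: "supports h (A *v x)" "supports h' (A *v x)"
  then obtain c where c: "transpose A *v h' = c *\<^sub>R (transpose A *v h)"
    using supports_transpose[OF assms(1-3)] assms(5) unfolding smooth_def by blast
  have "(h' - c *\<^sub>R h) \<bullet> v = 0" for v
  proof -
    have "h' \<bullet> (A *v (B *v v)) = c * (h \<bullet> (A *v (B *v v)))"
      using arg_cong[OF c, of "\<lambda>z. z \<bullet> (B *v v)"] by (simp only: inner_transpose inner_scaleR_left)
    then show ?thesis by (simp add: inverse_pair_vec[OF assms(3)] inner_diff_left)
  qed
  then have "h' - c *\<^sub>R h = 0" by (metis inner_eq_zero_iff)
  then show "\<exists>c. h' = c *\<^sub>R h" by auto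
qed

lemma extremal_preserves:
  assumes "preserves A" "preserves B" "A ** B = mat 1" "B ** A = mat 1" "extremal x"
  shows "extremal (A *v x)"
  unfolding extremal_def
proof (intro ballI impI)
  fix p assume p: "p \<in> K" "\<forall>t\<ge>0. A *v x + t *\<^sub>R p \<notin> C"
  have "x + t *\<^sub>R (B *v p) \<notin> C" if "t \<ge> 0" for t
  proof
    assume "x + t *\<^sub>R (B *v p) \<in> C"
    then have "A *v (x + t *\<^sub>R (B *v p)) \<in> C" using assms(1) by (simp add: preserves_def)
    then show False
      using p(2) that by (simp add: matrix_vector_right_distrib matrix_vector_mult_scaleR inverse_pair_vec[OF assms(3)])
  qed
  then obtain c where "B *v p = c *\<^sub>R x"
    using assms(5) preserves_K[OF assms(2) p(1)] unfolding extremal_def by blast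
  then have "p = c *\<^sub>R (A *v x)" using inverse_pair_vec[OF assms(3), of p] by (simp add: matrix_vector_mult_scaleR)
  then show "\<exists>c. p = c *\<^sub>R (A *v x)" by blast
qed

theorem hyperbolic_smooth:
  assumes h: "hyperbolic A B r s x y e f"
  shows "smooth x"
proof -
  have A: "attracts A r x e" and B: "attracts B s y f" and AB: "A ** B = mat 1" "B ** A = mat 1"
    and p: "preserves A" "preserves B" and xy: "x \<in> K" "y \<in> K" "x + y \<in> C"
    using h by (auto simp: hyperbolic_def)
  note hp = hyperbolic_props[OF h]
  have fy: "f \<bullet> y = 1" and fx: "f \<bullet> x = 0" using B hp(4) by (simp_all add: attracts_def supports_def)
  have mult: "\<exists>c. g = c *\<^sub>R f" if g: "supports g x" for g
  proof (rule ccontr)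
    assume n: "\<not> ?thesis"
    \<comment> \<open>Subtracting a multiple of \<open>f\<close> makes \<open>g0\<close> vanish at
      \<open>y\<close>, the vector dual to \<open>f\<close>; \<open>attracts_escape\<close> then
      applies to the transposes, with \<open>f\<close> as the attracting point.\<close>
    define g0 where "g0 = g - (g \<bullet> y) *\<^sub>R f"
    have g0: "g0 \<noteq> 0"
    proof
      assume "g0 = 0"
      then have "g = (g \<bullet> y) *\<^sub>R f" by (simp add: g0_def)
      with n show False by blast
    qed
    have g0y: "y \<bullet> g0 = 0" using fy by (simp add: g0_def inner_diff_right inner_commute)
    have tr: "transpose B ** transpose A = mat 1" "transpose A ** transpose B = mat 1"
      using AB by (simp_all add: transpose_mat flip: matrix_transpose_mul)
    let ?g = "\<lambda>n. mpow (transpose A) n *v g0"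
    obtain \<sigma> u where \<sigma>: "strict_mono (\<sigma> :: nat \<Rightarrow> nat)" and u: "norm u = 1"
      "(\<lambda>n. (1 / norm (?g (\<sigma> n))) *\<^sub>R ?g (\<sigma> n)) \<longlonglongrightarrow> u"
      "(\<lambda>n. 1 / (s ^ \<sigma> n * norm (?g (\<sigma> n)))) \<longlonglongrightarrow> 0"
      using attracts_escape[OF attracts_transpose[OF B] tr g0 g0y] by blast
    have gv: "?g n \<bullet> v = g0 \<bullet> (mpow A n *v v)" for n v
      by (simp only: mpow_transpose inner_transpose)
    have "?g n \<bullet> x = 0" for n
      using g fx unfolding gv mpow_eigenvector[OF hp(7)] by (simp add: g0_def inner_diff_left supports_def)
    then have ux: "u \<bullet> x = 0"
      using tendsto_inner[OF u(2) tendsto_const[of x]] by (simp add: LIMSEQ_const_iff)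
    have "?g n \<bullet> y = 0" for n
      using g0y unfolding gv mpow_eigenvector[OF hp(8)] by (simp add: inner_commute)
    then have uy: "u \<bullet> y = 0"
      using tendsto_inner[OF u(2) tendsto_const[of y]] by (simp add: LIMSEQ_const_iff)
    \<comment> \<open>The subtracted multiple of \<open>f\<close> enters with weight
      \<open>1 / (s ^ \<sigma> n * N n)\<close>, which tends to 0, so \<open>u\<close> inherits
      nonnegativity from \<open>g\<close>.\<close>
    have "u \<bullet> v \<ge> 0" if v: "v \<in> C" for v
    proof -
      define N where "N n = norm (?g (\<sigma> n))" for n
      have "(\<lambda>n. (1 / N n) *\<^sub>R ?g (\<sigma> n) \<bullet> v + (g \<bullet> y) * (f \<bullet> v) * (1 / (s ^ \<sigma> n * N n))) \<longlonglongrightarrow> u \<bullet> v + (g \<bullet> y) * (f \<bullet> v) * 0"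
        unfolding N_def by (intro tendsto_intros u)
      moreover have "(1 / N n) *\<^sub>R ?g (\<sigma> n) \<bullet> v + (g \<bullet> y) * (f \<bullet> v) * (1 / (s ^ \<sigma> n * N n)) =
          (1 / N n) * (g \<bullet> (mpow A (\<sigma> n) *v v))" for n
      proof -
        have "f \<bullet> (mpow A m *v v) = (1 / s ^ m) * (f \<bullet> v)" for m
          by (rule attracts_functional_inverse[OF B AB(2)])
        moreover have "?g m \<bullet> v = g \<bullet> (mpow A m *v v) - (g \<bullet> y) * (f \<bullet> (mpow A m *v v))" for m
          unfolding gv by (simp add: g0_def inner_diff_left)
        ultimately have eq: "?g (\<sigma> n) \<bullet> v = g \<bullet> (mpow A (\<sigma> n) *v v) - (g \<bullet> y) * ((1 / s ^ \<sigma> n) * (f \<bullet> v))"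
          by metis
        show ?thesis unfolding inner_scaleR_left eq by (simp add: diff_divide_distrib mult_ac)
      qed
      moreover have "(1 / N n) * (g \<bullet> (mpow A (\<sigma> n) *v v)) \<ge> 0" for n
        using g preserves_K[OF preserves_mpow[OF p(1)] C_K[OF v]] by (simp add: supports_def N_def)
      ultimately show ?thesis by (auto intro: LIMSEQ_le_const)
    qed
    then have "u \<bullet> (x + y) > 0" using nonneg_functional_pos[of u "x + y"] u(1) xy(3) by fastforce
    then show False using ux uy by (simp add: inner_add_right)
  qed
  show ?thesis unfolding smooth_def
  proof (intro allI impI, elim conjE)
    fix g g' assume g: "supports g x" "supports g' x"
    obtain c c' where c: "g = c *\<^sub>R f" "g' = c' *\<^sub>R f" using mult g by blast
    have "c \<noteq> 0" using g(1) c by (auto simp: supports_def)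
    then have "g' = (c' / c) *\<^sub>R g" using c by simp
    then show "\<exists>c. g' = c *\<^sub>R g" by blast
  qed
qed

theorem hyperbolic_extremal:
  assumes h: "hyperbolic A B r s x y e f" and V0: "\<And>v. v \<in> K \<Longrightarrow> e \<bullet> v = 0 \<Longrightarrow> f \<bullet> v = 0 \<Longrightarrow> v = 0"
  shows "extremal x"
  unfolding extremal_def
proof (intro ballI impI)
  fix p assume p: "p \<in> K" and np: "\<forall>t\<ge>0. x + t *\<^sub>R p \<notin> C"
  have A: "attracts A r x e" and B: "attracts B s y f" and AB: "A ** B = mat 1" "B ** A = mat 1"
    and pr: "preserves A" "preserves B" and xy: "x \<in> K" "y \<in> K" "x + y \<in> C"
    using h by (auto simp: hyperbolic_def)
  note hp = hyperbolic_props[OF h]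
  have ex: "e \<bullet> x = 1" and fx: "f \<bullet> x = 0" using A hp(4) by (simp_all add: attracts_def supports_def)
  \<comment> \<open>\<open>A^n\<close> sends \<open>x\<close> to \<open>r^n x\<close>, and the
    condition on \<open>p\<close> is invariant under scaling of \<open>t\<close>; hence it passes
    from \<open>p\<close> to \<open>B^n p\<close>.\<close>
  have stay: "x + t *\<^sub>R (mpow B n *v p) \<notin> C" if t: "t \<ge> 0" for t n
  proof
    assume "x + t *\<^sub>R (mpow B n *v p) \<in> C"
    then have "mpow A n *v (x + t *\<^sub>R (mpow B n *v p)) \<in> C"
      using preserves_mpow[OF pr(1)] by (simp add: preserves_def)
    then have "r ^ n *\<^sub>R x + t *\<^sub>R p \<in> C"
      by (simp add: matrix_vector_right_distrib matrix_vector_mult_scaleR mpow_inverse[OF AB(1)] mpow_eigenvector[OF hp(7)])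
    then have "(1 / r ^ n) *\<^sub>R (r ^ n *\<^sub>R x + t *\<^sub>R p) \<in> C" using hp(1) by (intro C_scale) auto
    moreover have "(1 / r ^ n) *\<^sub>R (r ^ n *\<^sub>R x + t *\<^sub>R p) = x + (t / r ^ n) *\<^sub>R p"
      using hp(1) by (simp add: scaleR_add_right)
    ultimately show False using np t hp(1) by simp
  qed
  \<comment> \<open>Otherwise \<open>B^n p / s^n\<close> tends to a positive multiple of
    \<open>y\<close>, and the limit would put \<open>x + y\<close> outside \<open>C\<close>.\<close>
  have fp: "f \<bullet> p = 0"
  proof (rule ccontr)
    assume "f \<bullet> p \<noteq> 0"
    then have pos: "f \<bullet> p > 0" using hp(4) p by (force simp: supports_def order_less_le)
    have "(\<lambda>n. x + (1 / (f \<bullet> p)) *\<^sub>R ((1 / s ^ n) *\<^sub>R (mpow B n *v p))) \<longlonglongrightarrow> x + (1 / (f \<bullet> p)) *\<^sub>R ((f \<bullet> p) *\<^sub>R y)"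
      by (intro tendsto_intros attracts_tendsto[OF B])
    moreover have "x + (1 / (f \<bullet> p)) *\<^sub>R ((1 / s ^ n) *\<^sub>R (mpow B n *v p)) \<notin> C" for n
      using stay[of "1 / (f \<bullet> p) * (1 / s ^ n)" n] pos hp(2) by simp
    ultimately have "x + (1 / (f \<bullet> p)) *\<^sub>R ((f \<bullet> p) *\<^sub>R y) \<notin> C" by (rule not_C_limit)
    then show False using pos xy(3) by simp
  qed
  \<comment> \<open>Without its \<open>x\<close> component, \<open>p\<close> lies in the common
    kernel of \<open>e\<close> and \<open>f\<close>. The normalised images under \<open>B^n\<close>
    differ from points of \<open>K\<close> by a null sequence, so a limit point lies in
    \<open>K\<close> and in that kernel, which \<open>V0\<close> excludes.\<close>
  define v where "v = p - (e \<bullet> p) *\<^sub>R x"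
  have "v = 0"
  proof (rule ccontr)
    assume v0: "v \<noteq> 0"
    have ev: "e \<bullet> v = 0" and fv: "f \<bullet> v = 0" using ex fx fp by (simp_all add: v_def inner_diff_right)
    obtain \<sigma> u where \<sigma>: "strict_mono (\<sigma> :: nat \<Rightarrow> nat)" and u: "norm u = 1"
      "(\<lambda>n. (1 / norm (mpow B (\<sigma> n) *v v)) *\<^sub>R (mpow B (\<sigma> n) *v v)) \<longlonglongrightarrow> u"
      "(\<lambda>n. 1 / (r ^ \<sigma> n * norm (mpow B (\<sigma> n) *v v))) \<longlonglongrightarrow> 0"
      using attracts_escape[OF A AB v0 ev] by blast
    define N where "N n = norm (mpow B (\<sigma> n) *v v)" for n
    have Bx: "B *v x = (1 / r) *\<^sub>R x" using inverse_eigenvector[OF AB(2) hp(7)] hp(1) by simp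
    have "(\<lambda>n. (1 / N n) *\<^sub>R (mpow B (\<sigma> n) *v v) + (1 / (r ^ \<sigma> n * N n)) *\<^sub>R ((e \<bullet> p) *\<^sub>R x)) \<longlonglongrightarrow> u + 0 *\<^sub>R ((e \<bullet> p) *\<^sub>R x)"
      unfolding N_def by (intro tendsto_intros u)
    moreover have "(1 / N n) *\<^sub>R (mpow B (\<sigma> n) *v v) + (1 / (r ^ \<sigma> n * N n)) *\<^sub>R ((e \<bullet> p) *\<^sub>R x)
        = (1 / N n) *\<^sub>R (mpow B (\<sigma> n) *v p)" for n
      unfolding v_def
      by (simp add: matrix_vector_mult_diff_distrib matrix_vector_mult_scaleR mpow_eigenvector[OF Bx]
          power_divide scaleR_diff_right mult.commute)
    moreover have "(1 / N n) *\<^sub>R (mpow B (\<sigma> n) *v p) \<in> K" for n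
      using preserves_K[OF preserves_mpow[OF pr(2)] p] by (intro K_scale) (simp_all add: N_def)
    ultimately have uK: "u \<in> K" by (auto intro: K_limit)
    have "e \<bullet> (mpow B n *v v) = 0" for n using attracts_functional_inverse[OF A AB(1), of n v] ev by simp
    then have "e \<bullet> u = 0"
      using tendsto_inner[OF tendsto_const[of e] u(2)] by (simp add: LIMSEQ_const_iff)
    moreover have "f \<bullet> (mpow B n *v v) = 0" for n
      by (induction n) (simp_all add: fv mpow_Suc_vec attracts_functional[OF B] del: mpow.simps(2))
    then have "f \<bullet> u = 0"
      using tendsto_inner[OF tendsto_const[of f] u(2)] by (simp add: LIMSEQ_const_iff)
    ultimately show False using V0[OF uK] u(1) by auto
  qed
  then have "p = (e \<bullet> p) *\<^sub>R x" by (simp add: v_def)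
  then show "\<exists>c. p = c *\<^sub>R x" by blast
qed

text \<open>By extremality a limit of bad directions is a positive multiple of \<open>b\<close>. But
  that direction enters \<open>C\<close> from the other endpoint, because \<open>a + b\<close> is in
  \<open>C\<close>.\<close>

lemma pair_near_no_common_face:
  assumes ab: "pair a b" and ext: "extremal b"
  shows "\<exists>\<epsilon>>0. \<forall>x y v. norm (x - b) < \<epsilon> \<longrightarrow> norm (y - a) < \<epsilon> \<longrightarrow> v \<in> K \<longrightarrow> v \<noteq> 0 \<longrightarrow>
    (\<exists>t\<ge>0. x + t *\<^sub>R v \<in> C \<or> y + t *\<^sub>R v \<in> C)"
proof (rule ccontr)
  assume n: "\<not> ?thesis"
  have "\<exists>x y v. norm (x - b) < inverse (real (Suc k)) \<and> norm (y - a) < inverse (real (Suc k)) \<and> v \<in> K \<and> norm v = 1 \<and>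
      (\<forall>t\<ge>0. x + t *\<^sub>R v \<notin> C \<and> y + t *\<^sub>R v \<notin> C)" for k
  proof -
    have "inverse (real (Suc k)) > 0" by simp
    then obtain x y v where xy: "norm (x - b) < inverse (real (Suc k))" "norm (y - a) < inverse (real (Suc k))"
      and v: "v \<in> K" "v \<noteq> 0" and t: "\<And>t. t \<ge> 0 \<Longrightarrow> x + t *\<^sub>R v \<notin> C \<and> y + t *\<^sub>R v \<notin> C"
      using n by blast
    have "x + t *\<^sub>R ((1 / norm v) *\<^sub>R v) \<notin> C \<and> y + t *\<^sub>R ((1 / norm v) *\<^sub>R v) \<notin> C" if "t \<ge> 0" for t
      using t[of "t / norm v"] that by simp
    then show ?thesis using xy v K_scale[OF v(1), of "1 / norm v"]
      by (intro exI[of _ x] exI[of _ y] exI[of _ "(1 / norm v) *\<^sub>R v"]) auto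
  qed
  then obtain x y v where x: "\<And>k. norm (x k - b) < inverse (real (Suc k))"
    and y: "\<And>k. norm (y k - a) < inverse (real (Suc k))" and v: "\<And>k. v k \<in> K" "\<And>k. norm (v k) = 1"
    and t: "\<And>k t. t \<ge> 0 \<Longrightarrow> x k + t *\<^sub>R v k \<notin> C \<and> y k + t *\<^sub>R v k \<notin> C"
    by metis
  have limx: "x \<longlonglongrightarrow> b"
    by (rule LIM_zero_cancel, rule Lim_null_comparison[OF _ LIMSEQ_inverse_real_of_nat])
      (rule always_eventually, rule allI, rule less_imp_le, rule x)
  have limy: "y \<longlonglongrightarrow> a"
    by (rule LIM_zero_cancel, rule Lim_null_comparison[OF _ LIMSEQ_inverse_real_of_nat])
      (rule always_eventually, rule allI, rule less_imp_le, rule y)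
  have "v k \<in> sphere 0 1" for k using v(2) by simp
  then obtain u \<sigma> where u: "u \<in> sphere 0 1" "strict_mono \<sigma>" "(v \<circ> \<sigma>) \<longlonglongrightarrow> u"
    using compact_sphere[of "0::real^'n" 1] unfolding compact_def by metis
  have uK: "u \<in> K" using u(3) v(1) by (auto intro: K_limit)
  have b: "b + t *\<^sub>R u \<notin> C" and a: "a + t *\<^sub>R u \<notin> C" if "t \<ge> 0" for t
  proof -
    have "(\<lambda>k. (x \<circ> \<sigma>) k + t *\<^sub>R (v \<circ> \<sigma>) k) \<longlonglongrightarrow> b + t *\<^sub>R u"
      by (intro tendsto_intros LIMSEQ_subseq_LIMSEQ[OF limx u(2)] u(3))
    then show "b + t *\<^sub>R u \<notin> C" by (rule not_C_limit) (use t that in simp)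
    have "(\<lambda>k. (y \<circ> \<sigma>) k + t *\<^sub>R (v \<circ> \<sigma>) k) \<longlonglongrightarrow> a + t *\<^sub>R u"
      by (intro tendsto_intros LIMSEQ_subseq_LIMSEQ[OF limy u(2)] u(3))
    then show "a + t *\<^sub>R u \<notin> C" by (rule not_C_limit) (use t that in simp)
  qed
  obtain c where c: "u = c *\<^sub>R b" using ext uK b unfolding extremal_def by blast
  have "c \<noteq> 0" using c u(1) by auto
  moreover have "c \<ge> 0" using K_sign[of b c] c uK ab pair_nonzero[OF ab] by (simp add: pair_def)
  ultimately have "c > 0" by simp
  then have "a + (1 / c) *\<^sub>R u = a + b" by (simp add: c)
  then show False using a[of "1 / c"] \<open>c > 0\<close> ab by (simp add: pair_def)
qed

lemma pair_near_open:
  assumes ab: "pair a b"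
  shows "\<exists>\<epsilon>>0. \<forall>x y. norm (x - b) < \<epsilon> \<longrightarrow> norm (y - a) < \<epsilon> \<longrightarrow>
    x + y \<in> C \<and> w \<bullet> x > 0 \<and> w \<bullet> y > 0 \<and> proj x \<noteq> proj y"
proof -
  have "proj b \<noteq> proj a" using pair_proj_neq[OF ab] by metis
  then obtain U V where UV: "open U" "open V" "proj b \<in> U" "proj a \<in> V" "U \<inter> V = {}"
    using hausdorff[OF \<open>proj b \<noteq> proj a\<close>] by auto
  have "open ({v. v \<noteq> 0 \<and> proj v \<in> U} \<inter> {v. w \<bullet> v > 0})"
    using open_proj_vimage[OF UV(1)] by (intro open_Int) (simp_all add: open_halfspace_gt)
  moreover have "b \<in> {v. v \<noteq> 0 \<and> proj v \<in> U} \<inter> {v. w \<bullet> v > 0}"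
    using UV pair_nonzero[OF ab] K_pos ab by (simp add: pair_def)
  ultimately obtain e1 where e1: "e1 > 0" "ball b e1 \<subseteq> {v. v \<noteq> 0 \<and> proj v \<in> U} \<inter> {v. w \<bullet> v > 0}"
    using open_contains_ball by blast
  have "open ({v. v \<noteq> 0 \<and> proj v \<in> V} \<inter> {v. w \<bullet> v > 0})"
    using open_proj_vimage[OF UV(2)] by (intro open_Int) (simp_all add: open_halfspace_gt)
  moreover have "a \<in> {v. v \<noteq> 0 \<and> proj v \<in> V} \<inter> {v. w \<bullet> v > 0}"
    using UV pair_nonzero[OF ab] K_pos ab by (simp add: pair_def)
  ultimately obtain e2 where e2: "e2 > 0" "ball a e2 \<subseteq> {v. v \<noteq> 0 \<and> proj v \<in> V} \<inter> {v. w \<bullet> v > 0}"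
    using open_contains_ball by blast
  have "a + b \<in> C" using ab by (simp add: pair_def)
  then obtain e3 where e3: "e3 > 0" "ball (a + b) e3 \<subseteq> C" using open_C open_contains_ball by blast
  define \<epsilon> where "\<epsilon> = min (min e1 e2) (e3 / 2)"
  have "x + y \<in> C \<and> w \<bullet> x > 0 \<and> w \<bullet> y > 0 \<and> proj x \<noteq> proj y" if xy: "norm (x - b) < \<epsilon>" "norm (y - a) < \<epsilon>" for x y
  proof -
    have x: "x \<in> ball b e1" and y: "y \<in> ball a e2" using xy by (simp_all add: dist_norm norm_minus_commute \<epsilon>_def)
    have "norm ((x + y) - (a + b)) \<le> norm (x - b) + norm (y - a)"
      using norm_triangle_ineq[of "x - b" "y - a"] by (simp add: algebra_simps)
    then have "x + y \<in> C" using xy by (intro subsetD[OF e3(2)]) (simp add: dist_norm norm_minus_commute \<epsilon>_def)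
    then show ?thesis using subsetD[OF e1(2) x] subsetD[OF e2(2) y] UV(5) by auto
  qed
  moreover have "\<epsilon> > 0" using e1 e2 e3 by (simp add: \<epsilon>_def)
  ultimately show ?thesis by blast
qed

text \<open>The bound depends on the pair alone and not on the automorphism. The absence of a common
  direction is symmetric in \<open>x\<close> and \<open>y\<close>, so both become extremal although
  this is assumed of \<open>b\<close> only.\<close>

theorem attracts_near_pair:
  assumes ab: "pair a b" and ext: "extremal b"
  shows "\<exists>\<epsilon>>0. \<forall>A B r s x y e f. A ** B = mat 1 \<longrightarrow> B ** A = mat 1 \<longrightarrow> preserves A \<longrightarrow> preserves B \<longrightarrow>
    attracts A r x e \<longrightarrow> attracts B s y f \<longrightarrow> norm (x - b) < \<epsilon> \<longrightarrow> norm (y - a) < \<epsilon> \<longrightarrow>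
    hyperbolic A B r s x y e f \<and> smooth x \<and> smooth y \<and> extremal x \<and> extremal y"
proof -
  obtain e1 where e1: "e1 > 0" "\<And>x y v. norm (x - b) < e1 \<Longrightarrow> norm (y - a) < e1 \<Longrightarrow> v \<in> K \<Longrightarrow> v \<noteq> 0 \<Longrightarrow>
    (\<exists>t\<ge>0. x + t *\<^sub>R v \<in> C \<or> y + t *\<^sub>R v \<in> C)"
    using pair_near_no_common_face[OF ab ext] by blast
  obtain e2 where e2: "e2 > 0" "\<And>x y. norm (x - b) < e2 \<Longrightarrow> norm (y - a) < e2 \<Longrightarrow>
    x + y \<in> C \<and> w \<bullet> x > 0 \<and> w \<bullet> y > 0 \<and> proj x \<noteq> proj y"
    using pair_near_open[OF ab] by blast
  have ne: "C \<noteq> {}" using ab by (auto simp: pair_def)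
  have main: "hyperbolic A B r s x y e f \<and> smooth x \<and> smooth y \<and> extremal x \<and> extremal y"
    if AB: "A ** B = mat 1" "B ** A = mat 1" and p: "preserves A" "preserves B"
    and A: "attracts A r x e" and B: "attracts B s y f"
    and x: "norm (x - b) < min e1 e2" and y: "norm (y - a) < min e1 e2" for A B r s x y e f
  proof -
    have xy: "x + y \<in> C" "w \<bullet> x > 0" "w \<bullet> y > 0" "proj x \<noteq> proj y" using e2(2)[of x y] x y by auto
    \<comment> \<open>\<open>w \<bullet> x > 0\<close> decides between \<open>x\<close> and
      \<open>- x\<close>.\<close>
    have "x \<in> K" using attracts_in_K(1)[OF p(1) A ne] K_nonneg[of "- x"] xy by auto
    moreover have "y \<in> K" using attracts_in_K(1)[OF p(2) B ne] K_nonneg[of "- y"] xy by auto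
    ultimately have h: "hyperbolic A B r s x y e f"
      using AB p A B xy by (simp add: hyperbolic_def)
    note hp = hyperbolic_props[OF h]
    have V0: "v = 0" if v: "v \<in> K" "e \<bullet> v = 0" "f \<bullet> v = 0" for v
    proof (rule ccontr)
      assume "v \<noteq> 0"
      then obtain t where "x + t *\<^sub>R v \<in> C \<or> y + t *\<^sub>R v \<in> C" using e1(2)[of x y v] x y v by auto
      \<comment> \<open>But \<open>f\<close> supports \<open>K\<close> at \<open>x\<close> and
        vanishes at \<open>x + t v\<close>, and likewise \<open>e\<close> at \<open>y + t v\<close>;
        so neither point is in \<open>C\<close>.\<close>
      then show False
        using supports_pos[OF hp(3), of "y + t *\<^sub>R v"] supports_pos[OF hp(4), of "x + t *\<^sub>R v"] hp(3,4) v
        by (auto simp: supports_def inner_add_right)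
    qed
    show ?thesis
      using h hyperbolic_smooth[OF h] hyperbolic_smooth[OF hyperbolic_sym[OF h]]
        hyperbolic_extremal[OF h V0] hyperbolic_extremal[OF hyperbolic_sym[OF h] V0] by blast
  qed
  show ?thesis
    by (rule exI[of _ "min e1 e2"]) (use e1(1) e2(1) main in \<open>simp (no_asm_simp)\<close>)
qed

section \<open>Proximality from smooth and extremal fixed points\<close>

lemma pair_supports_pos: "pair a b \<Longrightarrow> supports h a \<Longrightarrow> h \<bullet> b > 0"
  using supports_pos[of h a "a + b"] by (simp add: pair_def supports_def inner_add_right)

text \<open>
  By smoothness the supporting functionals at \<open>a\<close> and \<open>b\<close> are eigenvectors. On their common kernel
  \<open>A\<^sup>n / l\<^sup>n\<close> is bounded, and a nonzero limit point \<open>q\<close> would give a segment through \<open>b\<close> in the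
  direction \<open>q\<close> in the boundary.
\<close>

theorem fixed_smooth_extremal_attracts:
  assumes AB: "A ** B = mat 1" "B ** A = mat 1" and p: "preserves A" "preserves B"
    and ab: "pair a b" and Aa: "A *v a = m *\<^sub>R a" and Ab: "A *v b = l *\<^sub>R b" and ml: "0 < m" "m < l"
    and sm: "smooth a" "smooth b" and ext: "extremal b"
  shows "\<exists>e. attracts A l b e"
proof -
  obtain h where h: "supports h a" using supports_exists ab by (auto simp: pair_def)
  obtain g where g: "supports g b" using supports_exists ab by (auto simp: pair_def)
  have hb: "h \<bullet> b > 0" and ga: "g \<bullet> a > 0"
    using pair_supports_pos[OF ab h] pair_supports_pos[of b a g] g ab pair_commute by blast+
  define e where "e = (1 / (h \<bullet> b)) *\<^sub>R h"
  have e: "supports e a" "e \<bullet> b = 1" using h hb by (auto simp: e_def supports_def)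
  \<comment> \<open>The transpose of \<open>A\<close> maps supporting functionals at
    \<open>a\<close> to such functionals, because \<open>a\<close> is an eigenvector. By smoothness
    they form a single ray, so \<open>e\<close> is an eigenvector, and its eigenvalue is read off at
    \<open>b\<close>.\<close>
  have eA: "e \<bullet> (A *v v) = l * (e \<bullet> v)" for v
  proof -
    have "supports e (A *v a)" using e(1) by (simp add: Aa supports_def)
    from supports_transpose[OF p AB(1) this] obtain c where c: "transpose A *v e = c *\<^sub>R e"
      using sm(1) e(1) unfolding smooth_def by blast
    have "e \<bullet> (A *v v) = c * (e \<bullet> v)" for v using c inner_transpose[of A e v] by simp
    moreover from this[of b] have "c = l" using e(2) by (simp add: Ab)
    ultimately show ?thesis by simp
  qed
  have gA: "g \<bullet> (A *v v) = m * (g \<bullet> v)" for v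
  proof -
    have "supports g (A *v b)" using g by (simp add: Ab supports_def)
    from supports_transpose[OF p AB(1) this] obtain c where c: "transpose A *v g = c *\<^sub>R g"
      using sm(2) g unfolding smooth_def by blast
    have "g \<bullet> (A *v v) = c * (g \<bullet> v)" for v using c inner_transpose[of A g v] by simp
    moreover from this[of a] have "c = m" using ga by (simp add: Aa)
    ultimately show ?thesis by simp
  qed
  have l: "l > 0" using ml by simp
  have ml0: "(\<lambda>n. (m / l) ^ n) \<longlonglongrightarrow> 0" using ml l by (intro LIMSEQ_realpow_zero) auto
  have "attracts A l b e"
  proof (rule attractsI)
    show "l \<noteq> 0" using l by simp
    show "e \<bullet> b = 1" by (rule e(2))
    fix v
    define \<beta> where "\<beta> = (g \<bullet> v) / (g \<bullet> a)"
    \<comment> \<open>Removing the components along \<open>b\<close> and \<open>a\<close> puts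
      \<open>u\<close> into the common kernel of \<open>e\<close> and \<open>g\<close>.\<close>
    define u where "u = v - (e \<bullet> v) *\<^sub>R b - \<beta> *\<^sub>R a"
    have eu: "e \<bullet> u = 0" using e by (simp add: u_def inner_diff_right supports_def)
    have gu: "g \<bullet> u = 0" using g ga by (simp add: u_def inner_diff_right supports_def \<beta>_def)
    define z where "z n = (1 / l ^ n) *\<^sub>R (mpow A n *v u)" for n
    have ez: "e \<bullet> z n = 0" for n
    proof -
      have "e \<bullet> (mpow A n *v u) = 0"
        by (induction n) (simp_all add: eu mpow_Suc_vec eA del: mpow.simps(2))
      then show ?thesis by (simp add: z_def)
    qed
    have gz: "g \<bullet> z n = 0" for n
    proof -
      have "g \<bullet> (mpow A n *v u) = 0"
        by (induction n) (simp_all add: gu mpow_Suc_vec gA del: mpow.simps(2))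
      then show ?thesis by (simp add: z_def)
    qed
    obtain d where d: "d > 0" "(a + b) + d *\<^sub>R u \<in> C" "(a + b) - d *\<^sub>R u \<in> C"
    proof -
      have "a + b \<in> C" using ab by (simp add: pair_def)
      then obtain \<epsilon> where \<epsilon>: "\<epsilon> > 0" "ball (a + b) \<epsilon> \<subseteq> C" using open_C open_contains_ball by blast
      define d where "d = (\<epsilon> / 2) / (norm u + 1)"
      have n1: "norm u + 1 > 0" by (simp add: add_nonneg_pos)
      have "d * norm u < \<epsilon>"
      proof -
        have "d * norm u \<le> d * (norm u + 1)" using \<epsilon>(1) n1 by (intro mult_left_mono) (simp_all add: d_def)
        also have "\<dots> = \<epsilon> / 2"
          using n1 unfolding d_def by (metis less_irrefl nonzero_eq_divide_eq)
        finally show ?thesis using \<epsilon>(1) by simp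
      qed
      moreover have "d > 0" using \<epsilon>(1) n1 by (simp add: d_def)
      ultimately show ?thesis using that[of d] \<epsilon>(2) by (auto simp: subset_eq dist_norm)
    qed
    \<comment> \<open>Applying \<open>A^n / l^n\<close> to two points of \<open>C\<close> symmetric
      about \<open>a + b\<close> gives points of \<open>K\<close> symmetric about
      \<open>(m / l)^n a + b\<close>; their difference bounds \<open>z n\<close>.\<close>
    have zK: "(m / l) ^ n *\<^sub>R a + b + d *\<^sub>R z n \<in> K" "(m / l) ^ n *\<^sub>R a + b - d *\<^sub>R z n \<in> K" for n
    proof -
      have pw: "(1 / l ^ n) *\<^sub>R (mpow A n *v q) \<in> K" if "q \<in> C" for q
        using preserves_K[OF preserves_mpow[OF p(1)] C_K[OF that]] l by (intro K_scale) auto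
      have "(1 / l ^ n) *\<^sub>R (mpow A n *v ((a + b) + d *\<^sub>R u)) = (m / l) ^ n *\<^sub>R a + b + d *\<^sub>R z n"
        "(1 / l ^ n) *\<^sub>R (mpow A n *v ((a + b) - d *\<^sub>R u)) = (m / l) ^ n *\<^sub>R a + b - d *\<^sub>R z n"
        using l by (simp_all add: z_def matrix_vector_right_distrib matrix_vector_mult_diff_distrib
            matrix_vector_mult_scaleR mpow_eigenvector[OF Aa] mpow_eigenvector[OF Ab] scaleR_add_right scaleR_diff_right
            power_divide)
      then show "(m / l) ^ n *\<^sub>R a + b + d *\<^sub>R z n \<in> K" "(m / l) ^ n *\<^sub>R a + b - d *\<^sub>R z n \<in> K"
        using pw[OF d(2)] pw[OF d(3)] by simp_all
    qed
    obtain R where R: "R > 0" "\<And>v. v \<in> K \<Longrightarrow> norm v \<le> R * (w \<bullet> v)" using K_bounded_by_w by blast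
    have bd: "norm (z n) \<le> R * (w \<bullet> a + w \<bullet> b) / d" for n
    proof -
      let ?q = "(m / l) ^ n *\<^sub>R a + b"
      have "2 *\<^sub>R (d *\<^sub>R z n) = (?q + d *\<^sub>R z n) - (?q - d *\<^sub>R z n)" by (simp add: vec_eq_iff)
      then have "norm (2 *\<^sub>R (d *\<^sub>R z n)) \<le> norm (?q + d *\<^sub>R z n) + norm (?q - d *\<^sub>R z n)"
        by (metis norm_triangle_ineq4)
      also have "\<dots> \<le> R * (w \<bullet> (?q + d *\<^sub>R z n)) + R * (w \<bullet> (?q - d *\<^sub>R z n))"
        using zK R(2) by (intro add_mono) auto
      also have "\<dots> = 2 * (R * (w \<bullet> ?q))" by (simp add: inner_add_right inner_diff_right algebra_simps)
      also have "\<dots> \<le> 2 * (R * (w \<bullet> a + w \<bullet> b))"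
      proof -
        have "(m / l) ^ n \<le> 1" using ml l by (intro power_le_one) auto
        moreover have "w \<bullet> a \<ge> 0" using K_nonneg ab by (simp add: pair_def)
        ultimately have "w \<bullet> ?q \<le> w \<bullet> a + w \<bullet> b"
          by (simp add: inner_add_right mult_left_le_one_le ml l less_imp_le)
        then show ?thesis using R(1) by simp
      qed
      finally have "d * norm (z n) \<le> R * (w \<bullet> a + w \<bullet> b)" using d(1) by simp
      then show ?thesis using d(1) by (simp add: field_simps)
    qed
    have "z \<longlonglongrightarrow> 0"
    proof (rule bounded_tendsto_zeroI[OF bd])
      fix \<sigma> :: "nat \<Rightarrow> nat" and q assume \<sigma>: "strict_mono \<sigma>" and q: "(\<lambda>n. z (\<sigma> n)) \<longlonglongrightarrow> q"
      have "(\<lambda>n. (m / l) ^ \<sigma> n) \<longlonglongrightarrow> 0"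
        using LIMSEQ_subseq_LIMSEQ[OF ml0 \<sigma>] by (simp add: o_def)
      then have "(\<lambda>n. (m / l) ^ \<sigma> n *\<^sub>R a + b + d *\<^sub>R z (\<sigma> n)) \<longlonglongrightarrow> 0 *\<^sub>R a + b + d *\<^sub>R q"
        by (intro tendsto_intros q)
      then have qK: "b + d *\<^sub>R q \<in> K" using K_limit zK(1) by fastforce
      have gq: "g \<bullet> q = 0" using tendsto_inner[OF tendsto_const[of g] q] gz by (simp add: LIMSEQ_const_iff)
      have eq: "e \<bullet> q = 0" using tendsto_inner[OF tendsto_const[of e] q] ez by (simp add: LIMSEQ_const_iff)
      \<comment> \<open>\<open>g\<close> vanishes at \<open>b\<close> and \<open>q\<close>, so the
        segment from \<open>b\<close> to \<open>b + d q\<close> lies in the boundary. Extremality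
        makes \<open>b + d q\<close> a multiple of \<open>b\<close>, and \<open>e\<close> shows that
        the factor is 1.\<close>
      have "b + t *\<^sub>R (b + d *\<^sub>R q) \<notin> C" for t
        using supports_pos[OF g, of "b + t *\<^sub>R (b + d *\<^sub>R q)"] g gq by (auto simp: supports_def inner_add_right)
      then obtain c where c: "b + d *\<^sub>R q = c *\<^sub>R b" using ext qK unfolding extremal_def by blast
      from arg_cong[OF c, of "\<lambda>v. e \<bullet> v"] have "c = 1" using e(2) eq by (simp add: inner_add_right)
      then show "q = 0" using c d(1) by simp
    qed
    then have "(\<lambda>n. z n + (\<beta> * (m / l) ^ n) *\<^sub>R a + (e \<bullet> v) *\<^sub>R b) \<longlonglongrightarrow> 0 + (\<beta> * 0) *\<^sub>R a + (e \<bullet> v) *\<^sub>R b"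
      by (intro tendsto_intros ml0)
    moreover have "z n + (\<beta> * (m / l) ^ n) *\<^sub>R a + (e \<bullet> v) *\<^sub>R b = (1 / l ^ n) *\<^sub>R (mpow A n *v v)" for n
      using l unfolding z_def u_def
      by (simp add: matrix_vector_mult_diff_distrib matrix_vector_mult_scaleR mpow_eigenvector[OF Aa]
          mpow_eigenvector[OF Ab] scaleR_diff_right power_divide)
    ultimately show "(\<lambda>n. (1 / l ^ n) *\<^sub>R (mpow A n *v v)) \<longlonglongrightarrow> (e \<bullet> v) *\<^sub>R b" by simp
  qed
  then show ?thesis by blast
qed

end


subsection \<open>Proximal elements and rank-one elements\<close>

text \<open>The description of the fixed point ranges over all matrices representing the element;
  they are multiples of \<open>A\<close> and so have the same attracting line.\<close>

lemma attracts_proximal: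
  assumes inv: "invertible A" and at: "attracts A r x e"
  shows "proximal (pgl A)" "attracting_fixed_point (pgl A) = proj x"
proof -
  note dom = attracts_imp_dominant_eigenvalue[OF at]
  show "proximal (pgl A)" unfolding proximal_def using inv dom by blast
  show "attracting_fixed_point (pgl A) = proj x"
    unfolding attracting_fixed_point_def
  proof (rule the_equality)
    show "\<exists>A' r' v. invertible A' \<and> pgl A = pgl A' \<and> dominant_eigenvalue A' (complex_of_real r') \<and>
      v \<noteq> 0 \<and> A' *v v = r' *\<^sub>R v \<and> proj x = proj v"
      using inv dom attracts_eigenvector[OF at] attracts_nonzero[OF at] by blast
  next
    fix p
    assume "\<exists>A' r' v. invertible A' \<and> pgl A = pgl A' \<and> dominant_eigenvalue A' (complex_of_real r') \<and>
      v \<noteq> 0 \<and> A' *v v = r' *\<^sub>R v \<and> p = proj v"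
    then obtain A' r' v where A': "invertible A'" "pgl A = pgl A'" "dominant_eigenvalue A' (complex_of_real r')"
      and v: "v \<noteq> 0" "A' *v v = r' *\<^sub>R v" "p = proj v" by blast
    obtain x' e' where at': "attracts A' r' x' e'"
      using dominant_eigenvalue_imp_attracts[OF A'(1,3)] by auto
    obtain c where c: "c \<noteq> 0" "A' = c *\<^sub>R A" using pgl_eq_iff[OF inv A'(1)] A'(2) by blast
    have "attracts (c *\<^sub>R A) (c * r) x e" by (rule attracts_scale_matrix[OF at c(1)])
    then obtain k where k: "k \<noteq> 0" "x' = k *\<^sub>R x" using attracts_unique at' c(2) by blast
    have "r' \<noteq> 0" using at' by (simp add: attracts_def)
    then have "v = (e' \<bullet> v) *\<^sub>R x'"
      using attracts_tendsto[OF at', of v] by (simp add: mpow_eigenvector[OF v(2)] LIMSEQ_const_iff)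
    moreover from this v(1) have "e' \<bullet> v \<noteq> 0" by auto
    ultimately show "p = proj x"
      unfolding v(3) using proj_scale[of _ x'] proj_scale[OF k(1) attracts_nonzero[OF at]] attracts_nonzero[OF at'] k(2) by metis
  qed
qed

lemma proximal_attracts:
  assumes inv: "invertible A" and prox: "proximal (pgl A)"
  shows "\<exists>r x e. attracts A r x e"
proof -
  obtain A' z where A': "invertible A'" "pgl A' = pgl A" "dominant_eigenvalue A' z"
    using prox unfolding proximal_def by metis
  obtain r x e where at: "attracts A' r x e" using dominant_eigenvalue_imp_attracts[OF A'(1,3)] by blast
  obtain c where "c \<noteq> 0" "A = c *\<^sub>R A'" using pgl_eq_iff[OF A'(1) inv] A'(2) by blast
  then show ?thesis using attracts_scale_matrix[OF at] by blast
qed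

lemma mpow_commute: "mpow A n ** A = A ** mpow A n" for A :: "real^'n^'n"
  unfolding matrix_eq by (simp add: mpow_vec_shift flip: matrix_vector_mul_assoc)

lemma mpow_inverse_mult:
  fixes A B :: "real^'n^'n"
  assumes "A ** B = mat 1" shows "mpow A n ** mpow B n = mat 1"
  unfolding matrix_eq by (simp add: mpow_inverse[OF assms] flip: matrix_vector_mul_assoc)

lemma PGL_pow:
  fixes A B :: "real^'n^'n"
  assumes AB: "A ** B = mat 1" "B ** A = mat 1"
  shows "pgl A [^]\<^bsub>PGL\<^esub> (n::nat) = pgl (mpow A n)"
proof (induction n)
  case 0
  then show ?case by (simp add: PGL_one)
next
  case (Suc n)
  interpret group "PGL :: 'n pgl monoid" by (rule group_PGL)
  have "invertible A" "invertible (mpow A n)"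
    using inverse_pair_invertible[OF AB] inverse_pair_invertible[OF mpow_inverse_mult[OF AB(1)] mpow_inverse_mult[OF AB(2)]]
    by auto
  then have "pgl A [^]\<^bsub>PGL\<^esub> Suc n = pgl (mpow A n ** A)"
    by (simp add: Suc PGL_mult)
  then show ?case by (simp add: mpow_commute)
qed

lemma subgroup_PGL_closed:
  assumes "subgroup \<Gamma> PGL"
  shows "invertible A \<Longrightarrow> invertible B \<Longrightarrow> pgl A \<in> \<Gamma> \<Longrightarrow> pgl B \<in> \<Gamma> \<Longrightarrow> pgl (A ** B) \<in> \<Gamma>"
    "A ** B = mat 1 \<Longrightarrow> B ** A = mat 1 \<Longrightarrow> pgl A \<in> \<Gamma> \<Longrightarrow> pgl B \<in> \<Gamma>"
    "A ** B = mat 1 \<Longrightarrow> B ** A = mat 1 \<Longrightarrow> pgl A \<in> \<Gamma> \<Longrightarrow> pgl (mpow A n) \<in> \<Gamma>"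
    "pgl (mat 1) \<in> \<Gamma>"
proof -
  show m: "pgl (A ** B) \<in> \<Gamma>" if "invertible A" "invertible B" "pgl A \<in> \<Gamma>" "pgl B \<in> \<Gamma>" for A B
    using subgroup.m_closed[OF assms that(3,4)] PGL_mult[OF that(1,2)] by simp
  show "pgl B \<in> \<Gamma>" if "A ** B = mat 1" "B ** A = mat 1" "pgl A \<in> \<Gamma>"
    using subgroup.m_inv_closed[OF assms that(3)] PGL_inv[OF that(1,2)] by simp
  show one: "pgl (mat 1) \<in> \<Gamma>" using subgroup.one_closed[OF assms] by (simp add: PGL_one)
  show "pgl (mpow A n) \<in> \<Gamma>" if AB: "A ** B = mat 1" "B ** A = mat 1" "pgl A \<in> \<Gamma>"
  proof (induction n)
    case (Suc n)
    have "invertible A" "invertible (mpow A n)"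
      using inverse_pair_invertible[OF AB(1,2)] inverse_pair_invertible[OF mpow_inverse_mult[OF AB(1)] mpow_inverse_mult[OF AB(2)]]
      by auto
    then show ?case using m[of A "mpow A n"] AB(3) Suc by simp
  qed (simp add: one)
qed

context cone
begin

lemma preserves_Aut:
  assumes AB: "A ** B = mat 1" "B ** A = mat 1" and p: "preserves A" "preserves B"
  shows "pgl A \<in> Aut \<Omega>"
proof -
  have inv: "invertible A" using inverse_pair_invertible[OF AB] by blast
  have "pgl_act (pgl A) (proj v) = proj (A *v v)" if "v \<in> C" for v
    using pgl_act_proj[OF inv] C_nonzero[OF that] by blast
  then have "pgl_act (pgl A) ` \<Omega> = (\<lambda>v. proj (A *v v)) ` C" by (auto simp: \<Omega>_def image_image)
  also have "\<dots> = proj ` C"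
  proof
    show "(\<lambda>v. proj (A *v v)) ` C \<subseteq> proj ` C" using p(1) by (auto simp: preserves_def)
    show "proj ` C \<subseteq> (\<lambda>v. proj (A *v v)) ` C"
    proof
      fix x assume "x \<in> proj ` C"
      then obtain v where "v \<in> C" "x = proj v" by blast
      then have "B *v v \<in> C" "x = proj (A *v (B *v v))"
        using p(2) inverse_pair_vec[OF AB(1)] by (auto simp: preserves_def)
      then show "x \<in> (\<lambda>v. proj (A *v v)) ` C" by blast
    qed
  qed
  finally show ?thesis by (simp add: Aut_def \<Omega>_def)
qed

lemma group_lift:
  assumes "discrete_aut_group \<Omega> \<Gamma>" "h \<in> \<Gamma>" "C \<noteq> {}"
  obtains H H' where "h = pgl H" "H ** H' = mat 1" "H' ** H = mat 1" "preserves H" "preserves H'" "invertible H"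
  using Aut_lift[of h] assms inverse_pair_invertible unfolding discrete_aut_group_def by (metis subsetD)

text \<open>\<open>\<tau>\<close> is the translation length: flowing by \<open>\<tau>\<close> and
  applying \<open>A\<close> change the ratio of the two endpoint lifts equally, and agree up to the
  common factor \<open>r * exp (- \<tau>)\<close>. The matrix \<open>H\<close> covers the other
  lifts in a group orbit.\<close>

lemma hyperbolic_flow:
  assumes h: "hyperbolic A B r s x y e f" and tt: "exp (2 * \<tau>) = r * s"
    and H: "H ** H' = mat 1" "H' ** H = mat 1" "preserves H" "preserves H'"
  shows "flow \<Omega> (t + \<tau>) (gvec (H *v y) (H *v x)) = gvec (exp (- t) *\<^sub>R (H *v (A *v y))) (exp t *\<^sub>R (H *v (A *v x)))"
proof -
  note hp = hyperbolic_props[OF h]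
  have pr: "pair (H *v y) (H *v x)" by (rule pair_preserves[OF H(3,4,2) hp(5)])
  have e2: "exp \<tau> * exp \<tau> = r * s" using tt by (simp flip: exp_add)
  have "gvec (exp (- (t + \<tau>)) *\<^sub>R (H *v y)) (exp (t + \<tau>) *\<^sub>R (H *v x)) =
      gvec ((exp (- t) * (1 / s)) *\<^sub>R (H *v y)) ((exp t * r) *\<^sub>R (H *v x))"
  proof (subst gvec_eq_iff)
    show "\<exists>c>0. (exp (- t) * (1 / s)) *\<^sub>R (H *v y) = c *\<^sub>R (exp (- (t + \<tau>)) *\<^sub>R (H *v y)) \<and>
      (exp t * r) *\<^sub>R (H *v x) = c *\<^sub>R (exp (t + \<tau>) *\<^sub>R (H *v x))"
    proof (intro exI[of _ "r * exp (- \<tau>)"] conjI)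
      have "r * exp (- \<tau>) * exp (- (t + \<tau>)) = exp (- t) * (r / (exp \<tau> * exp \<tau>))"
        by (simp add: exp_add exp_minus exp_diff field_simps)
      also have "\<dots> = exp (- t) * (1 / s)" unfolding e2 using hp(1) by simp
      finally show "(exp (- t) * (1 / s)) *\<^sub>R (H *v y) = (r * exp (- \<tau>)) *\<^sub>R (exp (- (t + \<tau>)) *\<^sub>R (H *v y))"
        by simp
      have "r * exp (- \<tau>) * exp (t + \<tau>) = exp t * r" by (simp add: exp_add exp_minus field_simps)
      then show "(exp t * r) *\<^sub>R (H *v x) = (r * exp (- \<tau>)) *\<^sub>R (exp (t + \<tau>) *\<^sub>R (H *v x))"
        by (simp only: scaleR_scaleR)
    qed (use hp(1) in simp)
  qed (use pair_scale[OF pr] hp(1,2) in simp_all)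
  then show ?thesis
    unfolding flow_gvec[OF pr] hp(7,8) by (simp add: matrix_vector_mult_scaleR)
qed

theorem hyperbolic_rank_one_periodic:
  assumes \<Gamma>: "discrete_aut_group \<Omega> \<Gamma>" and g: "pgl A \<in> \<Gamma>" and h: "hyperbolic A B r s x y e f"
    and reg: "smooth x" "smooth y" "extremal x" "extremal y"
  shows "rank_one_periodic_vector \<Omega> \<Gamma> (orbit \<Gamma> (gvec y x))"
proof -
  interpret group "PGL :: 'n pgl monoid" by (rule group_PGL)
  note hp = hyperbolic_props[OF h]
  have sg: "subgroup \<Gamma> PGL" using \<Gamma> by (simp add: discrete_aut_group_def)
  have AB: "A ** B = mat 1" "B ** A = mat 1" using h by (auto simp: hyperbolic_def)
  have invA: "invertible A" and invB: "invertible B" using inverse_pair_invertible[OF AB] by auto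
  have gB: "pgl B \<in> \<Gamma>" using subgroup_PGL_closed(2)[OF sg AB g] .
  have ne: "C \<noteq> {}" using hp(5) by (auto simp: pair_def)
  define \<tau> where "\<tau> = ln (r * s) / 2"
  have \<tau>: "\<tau> > 0" "exp (2 * \<tau>) = r * s" using hp(1,2,6) by (simp_all add: \<tau>_def)
  \<comment> \<open>On lifts, flowing by \<open>\<tau>\<close> is right multiplication of the group
    element by \<open>pgl A\<close>. This preserves the orbit, and right multiplication by
    \<open>pgl B\<close> gives surjectivity.\<close>
  have fl: "flow \<Omega> \<tau> (pgl_tact h' (gvec y x)) = pgl_tact (h' \<otimes>\<^bsub>PGL\<^esub> pgl A) (gvec y x)" if h'\<Gamma>: "h' \<in> \<Gamma>" for h'
  proof -
    obtain H H' where H: "h' = pgl H" "H ** H' = mat 1" "H' ** H = mat 1" "preserves H" "preserves H'" "invertible H"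
      using group_lift[OF \<Gamma> h'\<Gamma> ne] by blast
    have "flow \<Omega> (0 + \<tau>) (gvec (H *v y) (H *v x)) = gvec (exp (- 0) *\<^sub>R (H *v (A *v y))) (exp 0 *\<^sub>R (H *v (A *v x)))"
      by (rule hyperbolic_flow[OF h \<tau>(2) H(2-5)])
    then show ?thesis
      using pgl_tact_gvec[OF hp(5) H(6)] pgl_tact_gvec[OF hp(5) invertible_mult[OF H(6) invA]] PGL_mult[OF H(6) invA]
      by (simp add: H(1) matrix_vector_mul_assoc)
  qed
  have "flow \<Omega> \<tau> ` orbit \<Gamma> (gvec y x) = orbit \<Gamma> (gvec y x)"
  proof
    show "flow \<Omega> \<tau> ` orbit \<Gamma> (gvec y x) \<subseteq> orbit \<Gamma> (gvec y x)"
      using fl subgroup.m_closed[OF sg _ g] by (auto simp: orbit_def)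
    show "orbit \<Gamma> (gvec y x) \<subseteq> flow \<Omega> \<tau> ` orbit \<Gamma> (gvec y x)"
    proof
      fix v assume "v \<in> orbit \<Gamma> (gvec y x)"
      then obtain h' where h': "h' \<in> \<Gamma>" "v = pgl_tact h' (gvec y x)" by (auto simp: orbit_def)
      have k: "h' \<otimes>\<^bsub>PGL\<^esub> pgl B \<in> \<Gamma>" using subgroup.m_closed[OF sg h'(1) gB] .
      have "h' \<otimes>\<^bsub>PGL\<^esub> pgl B \<otimes>\<^bsub>PGL\<^esub> pgl A = h' \<otimes>\<^bsub>PGL\<^esub> (pgl B \<otimes>\<^bsub>PGL\<^esub> pgl A)" by (intro m_assoc) auto
      also have "pgl B \<otimes>\<^bsub>PGL\<^esub> pgl A = \<one>\<^bsub>PGL\<^esub>" using PGL_mult[OF invB invA] by (simp add: AB PGL_one)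
      finally have "v = flow \<Omega> \<tau> (pgl_tact (h' \<otimes>\<^bsub>PGL\<^esub> pgl B) (gvec y x))"
        using fl[OF k] h'(2) by simp
      then show "v \<in> flow \<Omega> \<tau> ` orbit \<Gamma> (gvec y x)" using k by (auto simp: orbit_def)
    qed
  qed
  moreover have "gvec y x \<in> T1 \<Omega>" using hp(5) T1_eq by blast
  ultimately have "periodic_vector \<Omega> \<Gamma> (orbit \<Gamma> (gvec y x))"
    using \<tau>(1) by (auto simp: periodic_vector_def T1M_def)
  moreover have "smooth_point \<Omega> (forward_end \<Omega> v) \<and> strongly_extremal \<Omega> (forward_end \<Omega> v) \<and>
            smooth_point \<Omega> (backward_end \<Omega> v) \<and> strongly_extremal \<Omega> (backward_end \<Omega> v)"
    if vX: "v \<in> orbit \<Gamma> (gvec y x)" for v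
  proof -
    obtain h' where h': "h' \<in> \<Gamma>" "v = pgl_tact h' (gvec y x)" using vX by (auto simp: orbit_def)
    obtain H H' where H: "h' = pgl H" "H ** H' = mat 1" "H' ** H = mat 1" "preserves H" "preserves H'" "invertible H"
      using group_lift[OF \<Gamma> h'(1) ne] by blast
    have pr: "pair (H *v y) (H *v x)" by (rule pair_preserves[OF H(4,5,3) hp(5)])
    have v: "v = gvec (H *v y) (H *v x)" using pgl_tact_gvec[OF hp(5) H(6)] h'(2) H(1) by simp
    have KC: "H *v x \<in> K - C" "H *v x \<noteq> 0" "H *v y \<in> K - C" "H *v y \<noteq> 0"
      using pr pair_nonzero[OF pr] by (auto simp: pair_def)
    show ?thesis
      unfolding v forward_end_gvec[OF pr] backward_end_gvec[OF pr] smooth_point_iff[OF KC(1,2)]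
        smooth_point_iff[OF KC(3,4)] strongly_extremal_iff[OF KC(1,2)] strongly_extremal_iff[OF KC(3,4)]
      using reg smooth_preserves[OF H(4,5,2,3)] extremal_preserves[OF H(4,5,2,3)] by blast
  qed
  ultimately show ?thesis by (simp add: rank_one_periodic_vector_def)
qed

text \<open>Periodicity yields a group element that carries \<open>v\<close> along its own geodesic,
  so both endpoints are eigenvectors, with distinct eigenvalues because the period is positive.
  \<open>fixed_smooth_extremal_attracts\<close> then applies to it and to its inverse.\<close>

theorem rank_one_periodic_hyperbolic:
  assumes \<Gamma>: "discrete_aut_group \<Omega> \<Gamma>" and X: "rank_one_periodic_vector \<Omega> \<Gamma> X"
  shows "\<exists>a b A B r s e f. X = orbit \<Gamma> (gvec a b) \<and> pgl A \<in> \<Gamma> \<and> hyperbolic A B r s b a e f \<and> extremal a \<and> extremal b"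
proof -
  have sg: "subgroup \<Gamma> PGL" using \<Gamma> by (simp add: discrete_aut_group_def)
  obtain v where v: "v \<in> T1 \<Omega>" "X = orbit \<Gamma> v"
    using X by (auto simp: rank_one_periodic_vector_def periodic_vector_def T1M_def)
  obtain a b where ab: "pair a b" "v = gvec a b" using v(1) unfolding T1_eq by blast
  obtain t where t: "t > 0" "flow \<Omega> t ` X = X"
    using X by (auto simp: rank_one_periodic_vector_def periodic_vector_def)
  have ne: "C \<noteq> {}" using ab by (auto simp: pair_def)
  have "pgl_tact (pgl (mat 1)) v = v"
    using pgl_tact_gvec[OF ab(1), of "mat 1"] ab(2) inverse_pair_invertible[of "mat 1" "mat 1 :: real^'n^'n"] by simp
  then have vX: "v \<in> X" unfolding v(2) orbit_def using subgroup_PGL_closed(4)[OF sg] by force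
  then have "flow \<Omega> t v \<in> orbit \<Gamma> v" using t(2) v(2) by blast
  then obtain g where g: "g \<in> \<Gamma>" "flow \<Omega> t v = pgl_tact g v" by (auto simp: orbit_def)
  obtain A B where A: "g = pgl A" "A ** B = mat 1" "B ** A = mat 1" "preserves A" "preserves B" "invertible A"
    using group_lift[OF \<Gamma> g(1) ne] by blast
  have "gvec (exp (- t) *\<^sub>R a) (exp t *\<^sub>R b) = gvec (A *v a) (A *v b)"
    using g(2) unfolding ab(2) A(1) flow_gvec[OF ab(1)] pgl_tact_gvec[OF ab(1) A(6)] .
  then obtain c where c: "c > 0" "A *v a = c *\<^sub>R (exp (- t) *\<^sub>R a)" "A *v b = c *\<^sub>R (exp t *\<^sub>R b)"
    using gvec_eq_iff[OF pair_scale[OF ab(1)] pair_preserves[OF A(4,5,3) ab(1)]] by auto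
  define m l where "m = c * exp (- t)" and "l = c * exp t"
  have ml: "0 < m" "m < l" using c(1) t(1) by (simp_all add: m_def l_def)
  have Aa: "A *v a = m *\<^sub>R a" and Ab: "A *v b = l *\<^sub>R b" using c by (simp_all add: m_def l_def)
  have KC: "a \<in> K - C" "a \<noteq> 0" "b \<in> K - C" "b \<noteq> 0" using ab pair_nonzero[OF ab(1)] by (auto simp: pair_def)
  have reg: "smooth a" "smooth b" "extremal a" "extremal b"
    using X vX forward_end_gvec[OF ab(1)] backward_end_gvec[OF ab(1)] smooth_point_iff strongly_extremal_iff KC
    unfolding rank_one_periodic_vector_def ab(2) by metis+
  obtain e where e: "attracts A l b e"
    using fixed_smooth_extremal_attracts[OF A(2-5) ab(1) Aa Ab ml reg(1,2,4)] by blast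
  have Ba: "B *v a = (1 / m) *\<^sub>R a" and Bb: "B *v b = (1 / l) *\<^sub>R b"
    using inverse_eigenvector[OF A(3) Aa] inverse_eigenvector[OF A(3) Ab] ml by auto
  have "pair b a" using ab(1) pair_commute by blast
  moreover have "0 < 1 / l" "1 / l < 1 / m" using ml by (simp_all add: frac_less2)
  ultimately obtain f where f: "attracts B (1 / m) a f"
    using fixed_smooth_extremal_attracts[OF A(3,2,5,4) _ Bb Ba _ _ reg(2,1,3)] by blast
  have "hyperbolic A B l (1 / m) b a e f"
    unfolding hyperbolic_def using A e f ab(1) pair_proj_neq[OF ab(1)] by (auto simp: pair_def add.commute)
  then show ?thesis using v(2) ab(2) g(1) A(1) reg by blast
qed

text \<open>The ratio of the eigenvalues at \<open>x\<close> and \<open>y\<close> does not depend on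
  the lift, and its value \<open>(r * s) powi k\<close> determines \<open>k\<close>.\<close>

lemma hyperbolic_int_pow:
  assumes h: "hyperbolic A B r s x y e f"
  shows "\<exists>M M' \<rho> \<sigma>. pgl A [^]\<^bsub>PGL\<^esub> (k::int) = pgl M \<and> M ** M' = mat 1 \<and> M' ** M = mat 1 \<and>
    preserves M \<and> preserves M' \<and> M *v x = \<rho> *\<^sub>R x \<and> M *v y = \<sigma> *\<^sub>R y \<and> \<sigma> \<noteq> 0 \<and> \<rho> / \<sigma> = (r * s) powi k"
proof -
  interpret group "PGL :: 'n pgl monoid" by (rule group_PGL)
  note hp = hyperbolic_props[OF h]
  have AB: "A ** B = mat 1" "B ** A = mat 1" and p: "preserves A" "preserves B"
    and B: "attracts B s y f" using h by (auto simp: hyperbolic_def)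
  have Bx: "B *v x = (1 / r) *\<^sub>R x" using inverse_eigenvector[OF AB(2) hp(7)] hp(1) by simp
  have By: "B *v y = s *\<^sub>R y" by (rule attracts_eigenvector[OF B])
  note inv = mpow_inverse_mult[OF AB(1)] mpow_inverse_mult[OF AB(2)]
  show ?thesis
  proof (cases k rule: int_cases2)
    case (nonneg n)
    have "pgl A [^]\<^bsub>PGL\<^esub> k = pgl (mpow A n)" using PGL_pow[OF AB, of n] by (simp add: nonneg int_pow_int)
    moreover have "r ^ n / (1 / s) ^ n = (r * s) powi k"
      using hp(2) by (simp add: nonneg power_divide power_mult_distrib)
    ultimately show ?thesis
      using inv[of n] preserves_mpow[OF p(1), of n] preserves_mpow[OF p(2), of n]
        mpow_eigenvector[OF hp(7), of n] mpow_eigenvector[OF hp(8), of n] hp(2)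
      by (intro exI[of _ "mpow A n"] exI[of _ "mpow B n"] exI[of _ "r ^ n"] exI[of _ "(1 / s) ^ n"]) simp
  next
    case (nonpos n)
    have "pgl A [^]\<^bsub>PGL\<^esub> k = inv\<^bsub>PGL\<^esub> (pgl (mpow A n))"
      using PGL_pow[OF AB, of n] by (simp add: nonpos int_pow_neg int_pow_int)
    also have "\<dots> = pgl (mpow B n)" by (rule PGL_inv[OF inv])
    finally have "pgl A [^]\<^bsub>PGL\<^esub> k = pgl (mpow B n)" .
    moreover have "(1 / r) ^ n / s ^ n = (r * s) powi k"
      using hp(1,2) by (simp add: nonpos power_int_minus power_divide power_mult_distrib field_simps)
    ultimately show ?thesis
      using inv[of n] preserves_mpow[OF p(1), of n] preserves_mpow[OF p(2), of n]
        mpow_eigenvector[OF Bx, of n] mpow_eigenvector[OF By, of n] hp(2)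
      by (intro exI[of _ "mpow B n"] exI[of _ "mpow A n"] exI[of _ "(1 / r) ^ n"] exI[of _ "s ^ n"]) simp
  qed
qed

text \<open>The function \<open>q\<close> extends this eigenvalue ratio to nearby matrices: it is
  continuous, invariant under scaling, and equal to \<open>\<rho> powi k\<close> on the
  \<open>k\<close>-th power. Preimages of intervals around these values isolate the powers.\<close>

theorem hyperbolic_cyclic_discrete:
  assumes h: "hyperbolic A B r s x y e f"
  shows "discrete_aut_group \<Omega> (generate PGL {pgl A})"
proof -
  interpret group "PGL :: 'n pgl monoid" by (rule group_PGL)
  note hp = hyperbolic_props[OF h]
  have ex: "e \<bullet> x = 1" and fy: "f \<bullet> y = 1" using h by (auto simp: hyperbolic_def attracts_def)
  define \<rho> where "\<rho> = r * s"
  have \<rho>: "\<rho> > 1" using hp(6) by (simp add: \<rho>_def)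
  have gen: "generate PGL {pgl A} = {pgl A [^]\<^bsub>PGL\<^esub> k |k::int. k \<in> UNIV}"
    by (rule generate_pow) simp
  have "generate PGL {pgl A} \<subseteq> Aut \<Omega>"
  proof
    fix g assume "g \<in> generate PGL {pgl A}"
    then obtain k :: int where k: "g = pgl A [^]\<^bsub>PGL\<^esub> k" unfolding gen by blast
    obtain M M' where "pgl A [^]\<^bsub>PGL\<^esub> k = pgl M" "M ** M' = mat 1" "M' ** M = mat 1" "preserves M" "preserves M'"
      using hyperbolic_int_pow[OF h, of k] by blast
    then show "g \<in> Aut \<Omega>" unfolding k using preserves_Aut by metis
  qed
  moreover have "discrete (generate PGL {pgl A})"
    unfolding discrete_def
  proof
    fix g assume g: "g \<in> generate PGL {pgl A}"
    then obtain k :: int where k: "g = pgl A [^]\<^bsub>PGL\<^esub> k" unfolding gen by blast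
    define q where "q M = (e \<bullet> (M *v x)) / (f \<bullet> (M *v y))" for M
    define T where "T = pgl ` {M. invertible M \<and> f \<bullet> (M *v y) \<noteq> 0 \<and> \<rho> powi (k - 1) < q M \<and> q M < \<rho> powi (k + 1)}"
    have mem: "pgl M \<in> T \<longleftrightarrow> f \<bullet> (M *v y) \<noteq> 0 \<and> \<rho> powi (k - 1) < q M \<and> q M < \<rho> powi (k + 1)"
      if M: "invertible M" for M
    proof
      assume "pgl M \<in> T"
      then obtain M' where M': "invertible M'" "pgl M' = pgl M" "f \<bullet> (M' *v y) \<noteq> 0"
        "\<rho> powi (k - 1) < q M'" "q M' < \<rho> powi (k + 1)" unfolding T_def by auto
      obtain c where c: "c \<noteq> 0" "M = c *\<^sub>R M'" using pgl_eq_iff[OF M'(1) M] M'(2) by blast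
      have "q M = q M'" using c(1) unfolding q_def c(2) by (simp add: scaleR_matrix_vector)
      then show "f \<bullet> (M *v y) \<noteq> 0 \<and> \<rho> powi (k - 1) < q M \<and> q M < \<rho> powi (k + 1)"
        using M' c by (simp add: scaleR_matrix_vector)
    qed (use M in \<open>auto simp: T_def\<close>)
    have "open T" unfolding open_pgl_def
    proof -
      have cM: "continuous_on S (\<lambda>M. M *v z)" for z and S :: "(real^'n^'n) set"
        by (intro bounded_linear.continuous_on[OF bounded_bilinear.bounded_linear_left[OF bounded_bilinear_matrix_vector_mult]]
            continuous_on_id)
      let ?V = "{M. f \<bullet> (M *v y) \<noteq> 0}"
      have oV: "open ?V" by (intro open_Collect_neq continuous_intros cM)
      have cq: "continuous_on ?V q" unfolding q_def by (intro continuous_intros cM) auto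
      have "open {M::real^'n^'n. invertible M \<and> pgl M \<in> UNIV}"
        using open_UNIV[where 'a = "'n pgl"] unfolding open_pgl_def .
      moreover have "open (q -` {\<rho> powi (k - 1)<..<\<rho> powi (k + 1)} \<inter> ?V)"
        using continuous_on_open_vimage[OF oV, THEN iffD1, OF cq] open_greaterThanLessThan by blast
      ultimately have "open ({M. invertible M \<and> pgl M \<in> UNIV} \<inter> (q -` {\<rho> powi (k - 1)<..<\<rho> powi (k + 1)} \<inter> ?V))"
        by (rule open_Int)
      moreover have "{M. invertible M \<and> pgl M \<in> T} =
        {M. invertible M \<and> pgl M \<in> UNIV} \<inter> (q -` {\<rho> powi (k - 1)<..<\<rho> powi (k + 1)} \<inter> ?V)"
        using mem by auto
      ultimately show "open {M. invertible M \<and> pgl M \<in> T}" by simp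
    qed
    have inT: "pgl A [^]\<^bsub>PGL\<^esub> j \<in> T \<longleftrightarrow> j = k" for j :: int
    proof -
      obtain M M' \<alpha> \<beta> where M: "pgl A [^]\<^bsub>PGL\<^esub> j = pgl M" "M ** M' = mat 1" "M' ** M = mat 1"
        "M *v x = \<alpha> *\<^sub>R x" "M *v y = \<beta> *\<^sub>R y" "\<beta> \<noteq> 0" "\<alpha> / \<beta> = \<rho> powi j"
        using hyperbolic_int_pow[OF h, of j] unfolding \<rho>_def by blast
      have inv: "invertible M" using inverse_pair_invertible[OF M(2,3)] by blast
      have qM: "q M = \<rho> powi j" "f \<bullet> (M *v y) \<noteq> 0" using M ex fy by (simp_all add: q_def)
      have mono: "\<rho> powi i < \<rho> powi i' \<longleftrightarrow> i < i'" for i i' :: int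
        using power_int_strict_increasing[of i i' \<rho>] power_int_increasing[of i' i \<rho>] \<rho> by (cases "i < i'") auto
      show ?thesis unfolding M(1) mem[OF inv] qM(1) mono using qM(2) by auto
    qed
    show "g isolated_in generate PGL {pgl A}"
      unfolding isolated_in_def
      using g \<open>open T\<close> inT by (intro conjI exI[of _ T]) (auto simp: gen k)
  qed
  ultimately show ?thesis
    unfolding discrete_aut_group_def using generate_is_subgroup[of "{pgl A}"] by simp
qed

theorem hyperbolic_rank_one_element:
  assumes h: "hyperbolic A B r s x y e f" and reg: "smooth x" "smooth y" "extremal x" "extremal y"
  shows "rank_one_element \<Omega> (generate PGL {pgl A}) (pgl A)"
proof -
  interpret group "PGL :: 'n pgl monoid" by (rule group_PGL)
  note hp = hyperbolic_props[OF h]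
  have AB: "A ** B = mat 1" "B ** A = mat 1" and p: "preserves A" "preserves B" using h by (auto simp: hyperbolic_def)
  have inv: "invertible A" using inverse_pair_invertible[OF AB] by blast
  have g: "pgl A \<in> generate PGL {pgl A}" by (rule generate.incl) simp
  have d: "discrete_aut_group \<Omega> (generate PGL {pgl A})" by (rule hyperbolic_cyclic_discrete[OF h])
  have "pgl A [^]\<^bsub>PGL\<^esub> n \<noteq> \<one>\<^bsub>PGL\<^esub>" if n: "n > 0" for n :: nat
  proof
    assume "pgl A [^]\<^bsub>PGL\<^esub> n = \<one>\<^bsub>PGL\<^esub>"
    then have "pgl (mpow A n) = pgl (mat 1)" by (simp add: PGL_pow[OF AB] PGL_one)
    moreover have "invertible (mpow A n)" "invertible (mat 1 :: real^'n^'n)"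
      using inverse_pair_invertible[OF mpow_inverse_mult[OF AB(1)] mpow_inverse_mult[OF AB(2)]]
        inverse_pair_invertible[of "mat 1" "mat 1 :: real^'n^'n"] by auto
    \<comment> \<open>A scalar power would have equal eigenvalues at \<open>x\<close> and
      \<open>y\<close>, contrary to \<open>r * s > 1\<close>.\<close>
    ultimately obtain c where c: "mat 1 = c *\<^sub>R mpow A n" using pgl_eq_iff by blast
    have *: "v = (c * a ^ n) *\<^sub>R v" if "A *v v = a *\<^sub>R v" for v a
      using arg_cong[OF c, of "\<lambda>M. M *v v"] mpow_eigenvector[OF that, of n] by (simp add: scaleR_matrix_vector)
    have "c * r ^ n = 1" "c * (1 / s) ^ n = 1"
      using *[OF hp(7)] *[OF hp(8)] pair_nonzero[OF hp(5)]
      by (metis scaleR_cancel_right scaleR_one)+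
    then have "r ^ n = (1 / s) ^ n" by (metis mult_cancel_left mult_zero_left zero_neq_one)
    then have "(r * s) ^ n = 1" using hp(2) by (simp add: power_mult_distrib power_divide)
    then show False using one_less_power[OF hp(6) n] by simp
  qed
  moreover have "\<exists>v\<in>T1 \<Omega>. rank_one_periodic_vector \<Omega> (generate PGL {pgl A}) (orbit (generate PGL {pgl A}) v) \<and>
        pgl_tact (pgl A) ` flow_orbit \<Omega> v = flow_orbit \<Omega> v"
  proof (intro bexI[of _ "gvec y x"] conjI)
    show "rank_one_periodic_vector \<Omega> (generate PGL {pgl A}) (orbit (generate PGL {pgl A}) (gvec y x))"
      by (rule hyperbolic_rank_one_periodic[OF d g h reg])
    show "gvec y x \<in> T1 \<Omega>" using hp(5) T1_eq by blast
    define \<tau> where "\<tau> = ln (r * s) / 2"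
    have \<tau>: "exp (2 * \<tau>) = r * s" using hp(1,2,6) by (simp add: \<tau>_def)
    have one: "mat 1 ** mat 1 = (mat 1 :: real^'n^'n)" "preserves (mat 1)" by (simp_all add: preserves_def)
    have fl: "pgl_tact (pgl A) (flow \<Omega> t (gvec y x)) = flow \<Omega> (t + \<tau>) (gvec y x)" for t
    proof -
      have "pgl_tact (pgl A) (flow \<Omega> t (gvec y x)) = gvec (exp (- t) *\<^sub>R (A *v y)) (exp t *\<^sub>R (A *v x))"
        unfolding flow_gvec[OF hp(5)]
        by (subst pgl_tact_gvec[OF pair_scale[OF hp(5)] inv]) (simp_all add: matrix_vector_mult_scaleR)
      also have "\<dots> = flow \<Omega> (t + \<tau>) (gvec y x)"
        using hyperbolic_flow[OF h \<tau> one(1,1,2,2), of t] by simp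
      finally show ?thesis .
    qed
    show "pgl_tact (pgl A) ` flow_orbit \<Omega> (gvec y x) = flow_orbit \<Omega> (gvec y x)"
    proof
      show "pgl_tact (pgl A) ` flow_orbit \<Omega> (gvec y x) \<subseteq> flow_orbit \<Omega> (gvec y x)"
        by (auto simp: flow_orbit_def fl)
      show "flow_orbit \<Omega> (gvec y x) \<subseteq> pgl_tact (pgl A) ` flow_orbit \<Omega> (gvec y x)"
      proof
        fix v assume "v \<in> flow_orbit \<Omega> (gvec y x)"
        then obtain t where "v = flow \<Omega> t (gvec y x)" by (auto simp: flow_orbit_def)
        then have "v = pgl_tact (pgl A) (flow \<Omega> (t - \<tau>) (gvec y x))" by (simp add: fl)
        then show "v \<in> pgl_tact (pgl A) ` flow_orbit \<Omega> (gvec y x)" by (simp add: flow_orbit_def)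
      qed
    qed
  qed
  ultimately show ?thesis unfolding rank_one_element_def using d g by blast
qed

theorem biproximal_near_rank_one:
  assumes G: "(\<xi>, \<eta>) \<in> Geod \<Omega>" and ext: "strongly_extremal \<Omega> \<xi>"
  shows "\<exists>U U'. open U \<and> \<xi> \<in> U \<and> open U' \<and> \<eta> \<in> U' \<and>
           (\<forall>g\<in>Aut \<Omega>. biproximal g \<and>
              (attracting_fixed_point g, attracting_fixed_point (inv\<^bsub>PGL\<^esub> g)) \<in> U \<times> U' \<longrightarrow>
              rank_one_element \<Omega> (generate PGL {g}) g)"
proof -
  obtain a b where ab: "pair a b" "\<xi> = proj b" "\<eta> = proj a" using Geod_pair[OF G] by metis
  note nz = pair_nonzero[OF ab(1)]
  have ne: "C \<noteq> {}" using ab by (auto simp: pair_def)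
  have "extremal b" using ext strongly_extremal_iff[of b] ab nz by (simp add: pair_def)
  from attracts_near_pair[OF ab(1) this] obtain \<epsilon> where \<epsilon>: "\<epsilon> > 0"
    "\<And>A B r s x y e f. A ** B = mat 1 \<Longrightarrow> B ** A = mat 1 \<Longrightarrow> preserves A \<Longrightarrow> preserves B \<Longrightarrow>
    attracts A r x e \<Longrightarrow> attracts B s y f \<Longrightarrow> norm (x - b) < \<epsilon> \<Longrightarrow> norm (y - a) < \<epsilon> \<Longrightarrow>
    hyperbolic A B r s x y e f \<and> smooth x \<and> smooth y \<and> extremal x \<and> extremal y" by metis
  define U where "U z = proj ` (ball z \<epsilon> - {0})" for z :: "real^'n"
  have U: "open (U z)" for z unfolding U_def by (intro open_proj_image open_ball)
  have zU: "proj z \<in> U z" if "z \<noteq> 0" for z using that \<epsilon>(1) by (auto simp: U_def)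
  \<comment> \<open>An attracting vector is determined only up to a factor. A point of
    \<open>U z\<close> has a lift in the ball, which is again attracting once the functional is
    rescaled.\<close>
  have near: "\<exists>x' e'. attracts A r x' e' \<and> norm (x' - z) < \<epsilon>" if at: "attracts A r x e" and xU: "proj x \<in> U z" for A r and x e z :: "real^'n"
  proof -
    have "\<exists>x'\<in>ball z \<epsilon> - {0}. proj x = proj x'" using xU unfolding U_def by blast
    then obtain x' where x': "x' \<in> ball z \<epsilon>" "x' \<noteq> 0" "proj x = proj x'" by blast
    then obtain c where "c \<noteq> 0" "x' = c *\<^sub>R x" using proj_eq_iff attracts_nonzero[OF at] by blast
    then have "attracts A r x' ((1 / c) *\<^sub>R e)" using attracts_scale_vector[OF at] by simp
    then show ?thesis using x'(1) by (auto simp: dist_norm norm_minus_commute)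
  qed
  have "rank_one_element \<Omega> (generate PGL {g}) g"
    if g: "g \<in> Aut \<Omega>" and bi: "biproximal g" and fp: "attracting_fixed_point g \<in> U b"
      "attracting_fixed_point (inv\<^bsub>PGL\<^esub> g) \<in> U a" for g
  proof -
    obtain A B where A: "g = pgl A" "A ** B = mat 1" "B ** A = mat 1" "preserves A" "preserves B"
      using Aut_lift[OF g ne] by metis
    have inv: "invertible A" "invertible B" using inverse_pair_invertible[OF A(2,3)] by auto
    have gi: "inv\<^bsub>PGL\<^esub> g = pgl B" unfolding A(1) by (rule PGL_inv[OF A(2,3)])
    obtain r x e where x: "attracts A r x e" using proximal_attracts[OF inv(1)] bi A(1) by (auto simp: biproximal_def)
    obtain s y f where y: "attracts B s y f" using proximal_attracts[OF inv(2)] bi gi by (auto simp: biproximal_def)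
    have "proj x \<in> U b" "proj y \<in> U a"
      using fp[unfolded gi] attracts_proximal(2)[OF inv(1) x] attracts_proximal(2)[OF inv(2) y] A(1) by auto
    then obtain x' e' y' f' where "attracts A r x' e'" "norm (x' - b) < \<epsilon>" "attracts B s y' f'" "norm (y' - a) < \<epsilon>"
      using near x y by metis
    then have "hyperbolic A B r s x' y' e' f' \<and> smooth x' \<and> smooth y' \<and> extremal x' \<and> extremal y'"
      using \<epsilon>(2) A(2-5) by blast
    then show ?thesis unfolding A(1) using hyperbolic_rank_one_element by blast
  qed
  then show ?thesis
    using U zU nz unfolding ab by (intro exI[of _ "U b"] exI[of _ "U a"]) auto
qed

end


subsection \<open>Density of rank-one periodic vectors\<close>

context cone
begin

lemma attracts_in_limit_set:
  assumes "invertible A" "pgl A \<in> \<Gamma>" "attracts A r x e"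
  shows "proj x \<in> limit_set \<Gamma>"
  unfolding limit_set_def using attracts_proximal[OF assms(1,3)] assms(2)
  by (intro subsetD[OF closure_subset]) force

lemma rank_one_periodic_subset_T1M_bip:
  assumes \<Gamma>: "discrete_aut_group \<Omega> \<Gamma>" and X: "rank_one_periodic_vector \<Omega> \<Gamma> X"
  shows "X \<in> T1M_bip \<Omega> \<Gamma>"
proof -
  have sg: "subgroup \<Gamma> PGL" using \<Gamma> by (simp add: discrete_aut_group_def)
  obtain a b A B r s e f where X': "X = orbit \<Gamma> (gvec a b)" and g: "pgl A \<in> \<Gamma>" and h: "hyperbolic A B r s b a e f"
    using rank_one_periodic_hyperbolic[OF \<Gamma> X] by blast
  have AB: "A ** B = mat 1" "B ** A = mat 1" and at: "attracts A r b e" "attracts B s a f"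
    using h by (auto simp: hyperbolic_def)
  have inv: "invertible A" "invertible B" using inverse_pair_invertible[OF AB] by auto
  have ab: "pair a b" using hyperbolic_props[OF h] by blast
  have "gvec a b \<in> T1 \<Omega>" using ab T1_eq by blast
  moreover have "forward_end \<Omega> (gvec a b) \<in> limit_set \<Gamma>" "backward_end \<Omega> (gvec a b) \<in> limit_set \<Gamma>"
    unfolding forward_end_gvec[OF ab] backward_end_gvec[OF ab]
    using attracts_in_limit_set[OF inv(1) g at(1)]
      attracts_in_limit_set[OF inv(2) subgroup_PGL_closed(2)[OF sg AB g] at(2)] by auto
  ultimately show ?thesis unfolding X' T1M_bip_def by blast
qed

text \<open>Otherwise the vectors that no group element moves off the kernel of \<open>e\<close>
  form an invariant subspace. It contains \<open>v\<close> but not \<open>e\<close>, so it is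
  nonzero and proper.\<close>

lemma strongly_irreducible_moves:
  fixes \<Gamma> :: "'n pgl set" and e v :: "real^'n"
  assumes sg: "subgroup \<Gamma> PGL" and si: "strongly_irreducible \<Gamma>" and e: "e \<noteq> 0" and v: "v \<noteq> 0"
  shows "\<exists>H. invertible H \<and> pgl H \<in> \<Gamma> \<and> e \<bullet> (H *v v) \<noteq> 0"
proof (rule ccontr)
  assume n: "\<not> ?thesis"
  define W where "W = {u. \<forall>H. invertible H \<longrightarrow> pgl H \<in> \<Gamma> \<longrightarrow> e \<bullet> (H *v u) = 0}"
  have W: "subspace W"
    by (rule subspaceI) (auto simp: W_def matrix_vector_right_distrib matrix_vector_mult_scaleR inner_add_right)
  have vW: "v \<in> W" using n by (auto simp: W_def)
  have "invertible (mat 1 :: real^'n^'n)"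
    using inverse_pair_invertible[of "mat 1" "mat 1 :: real^'n^'n"] by simp
  then have eW: "e \<notin> W" using subgroup_PGL_closed(4)[OF sg] e by (auto simp: W_def intro!: exI[of _ "mat 1"])
  have "proj e \<notin> projset W"
  proof
    assume "proj e \<in> projset W"
    then obtain u where "u \<in> W" "u \<noteq> 0" "proj e = proj u" by (auto simp: projset_def)
    then show False using proj_eq_iff[of u e] e eW subspace_scale[OF W] by auto
  qed
  then have "projset W \<noteq> UNIV" by blast
  moreover have "projset W \<noteq> {}" using vW v by (auto simp: projset_def)
  moreover have inv: "pgl_act g ` projset W \<subseteq> projset W" if g: "g \<in> \<Gamma>" for g
  proof
    obtain G where G: "invertible G" "g = pgl G" by (metis pgl_cases)
    fix p assume "p \<in> pgl_act g ` projset W"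
    then obtain u where u: "u \<in> W" "u \<noteq> 0" "p = pgl_act g (proj u)" by (auto simp: projset_def)
    have "G *v u \<in> W" unfolding W_def
    proof (intro CollectI allI impI)
      fix H assume H: "invertible H" "pgl H \<in> \<Gamma>"
      have "invertible (H ** G)" "pgl (H ** G) \<in> \<Gamma>"
        using subgroup_PGL_closed(1)[OF sg H(1) G(1) H(2)] g G(2) invertible_mult[OF H(1) G(1)] by auto
      then have "e \<bullet> ((H ** G) *v u) = 0" using u(1) by (simp add: W_def)
      then show "e \<bullet> (H *v (G *v u)) = 0" by (simp add: matrix_vector_mul_assoc)
    qed
    moreover have "G *v u \<noteq> 0" by (rule invertible_vector_nonzero[OF G(1) u(2)])
    ultimately show "p \<in> projset W" using u G by (auto simp: projset_def pgl_act_proj)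
  qed
  have "pgl_act g ` projset W = projset W" if g: "g \<in> \<Gamma>" for g
  proof
    show "pgl_act g ` projset W \<subseteq> projset W" by (rule inv[OF g])
    obtain G where G: "invertible G" "g = pgl G" by (metis pgl_cases)
    obtain G' where G': "G ** G' = mat 1" "G' ** G = mat 1" using G(1) by (auto simp: invertible_def)
    have iG': "invertible G'" using inverse_pair_invertible[OF G'] by blast
    have gG': "pgl G' \<in> \<Gamma>" using subgroup_PGL_closed(2)[OF sg G'] g G(2) by simp
    show "projset W \<subseteq> pgl_act g ` projset W"
    proof
      fix p assume p: "p \<in> projset W"
      then obtain u where u: "u \<in> W" "u \<noteq> 0" "p = proj u" by (auto simp: projset_def)
      have "pgl_act g (pgl_act (pgl G') p) = p"
        using u G iG' invertible_vector_nonzero[OF iG' u(2)] inverse_pair_vec[OF G'(1), of u]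
        by (simp add: pgl_act_proj)
      moreover have "pgl_act (pgl G') p \<in> projset W" using inv[OF gG'] p by blast
      ultimately show "p \<in> pgl_act g ` projset W" by (metis imageI)
    qed
  qed
  moreover have "projective_subspace (projset W)" using W by (auto simp: projective_subspace_def)
  ultimately have "\<exists>F. finite F \<and> F \<noteq> {} \<and> (\<forall>S\<in>F. projective_subspace S \<and> S \<noteq> {} \<and> S \<noteq> UNIV) \<and>
      (\<forall>g\<in>\<Gamma>. pgl_act g ` \<Union>F = \<Union>F)"
    by (intro exI[of _ "{projset W}"]) simp
  then show False using si unfolding strongly_irreducible_def by blast
qed

text \<open>Attracting points are dense in the limit set by definition. Once some group element
  moves \<open>z\<close> off the kernel of the dual eigenvector, powers of the proximal element drag
  it to the attracting point.\<close>

lemma orbit_accumulates: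
  fixes \<Gamma> :: "'n pgl set" and z :: "real^'n"
  assumes sg: "subgroup \<Gamma> PGL" and si: "strongly_irreducible \<Gamma>" and z: "z \<noteq> 0"
    and U: "open U" "p \<in> U" "p \<in> limit_set \<Gamma>"
  shows "\<exists>h\<in>\<Gamma>. pgl_act h (proj z) \<in> U"
proof -
  have "U \<inter> {attracting_fixed_point g | g. g \<in> \<Gamma> \<and> proximal g} \<noteq> {}"
    using U open_Int_closure_eq_empty[OF U(1)] unfolding limit_set_def by blast
  then obtain g where g: "g \<in> \<Gamma>" "proximal g" "attracting_fixed_point g \<in> U" by blast
  obtain A where A: "invertible A" "g = pgl A" by (metis pgl_cases)
  obtain B where AB: "A ** B = mat 1" "B ** A = mat 1" using A(1) by (auto simp: invertible_def)
  obtain r x e where at: "attracts A r x e" using proximal_attracts[OF A(1)] g(2) A(2) by blast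
  have xU: "proj x \<in> U" using attracts_proximal(2)[OF A(1) at] g(3) A(2) by simp
  have "e \<noteq> 0" and r: "r \<noteq> 0" using at by (auto simp: attracts_def)
  then obtain H where H: "invertible H" "pgl H \<in> \<Gamma>" "e \<bullet> (H *v z) \<noteq> 0"
    using strongly_irreducible_moves[OF sg si _ z] by blast
  have "(\<lambda>n. proj ((1 / r ^ n) *\<^sub>R (mpow A n *v (H *v z)))) \<longlonglongrightarrow> proj ((e \<bullet> (H *v z)) *\<^sub>R x)"
    using H(3) attracts_nonzero[OF at] by (intro tendsto_proj attracts_tendsto[OF at]) auto
  then have "\<forall>\<^sub>F n in sequentially. proj ((1 / r ^ n) *\<^sub>R (mpow A n *v (H *v z))) \<in> U"
    using xU H(3) attracts_nonzero[OF at] by (intro topological_tendstoD[OF _ U(1)]) (auto simp: proj_scale)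
  then obtain n where n: "proj ((1 / r ^ n) *\<^sub>R (mpow A n *v (H *v z))) \<in> U"
    using eventually_happens'[OF sequentially_bot] by blast
  have iM: "invertible (mpow A n)"
    using inverse_pair_invertible[OF mpow_inverse_mult[OF AB(1)] mpow_inverse_mult[OF AB(2)]] by blast
  have iMH: "invertible (mpow A n ** H)" by (rule invertible_mult[OF iM H(1)])
  have "pgl (mpow A n ** H) \<in> \<Gamma>"
    using subgroup_PGL_closed(1)[OF sg iM H(1) _ H(2)] subgroup_PGL_closed(3)[OF sg AB] g(1) A(2) by blast
  moreover have "pgl_act (pgl (mpow A n ** H)) (proj z) = proj ((1 / r ^ n) *\<^sub>R (mpow A n *v (H *v z)))"
    using pgl_act_proj[OF iMH z] proj_scale[of "1 / r ^ n" "mpow A n *v (H *v z)"] r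
      invertible_vector_nonzero[OF iMH z] by (simp add: matrix_vector_mul_assoc)
  ultimately show ?thesis using n by metis
qed

lemma orbit_near:
  assumes \<Gamma>: "discrete_aut_group \<Omega> \<Gamma>" and si: "strongly_irreducible \<Gamma>"
    and z: "z \<in> K - C" "z \<noteq> 0" and b: "b \<in> K - C" "b \<noteq> 0" "proj b \<in> limit_set \<Gamma>" and ne: "C \<noteq> {}" and \<delta>: "\<delta> > 0"
  shows "\<exists>H H' c. c > 0 \<and> pgl H \<in> \<Gamma> \<and> H ** H' = mat 1 \<and> H' ** H = mat 1 \<and> preserves H \<and> preserves H' \<and>
    norm (c *\<^sub>R (H *v z) - b) < \<delta>"
proof -
  have sg: "subgroup \<Gamma> PGL" using \<Gamma> by (simp add: discrete_aut_group_def)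
  \<comment> \<open>Intersected with a half-space of \<open>w\<close> so that the factor
    \<open>c\<close> between the two lifts is positive.\<close>
  define S where "S = ball b \<delta> \<inter> {u. w \<bullet> u > 0}"
  have oS: "open S" unfolding S_def by (intro open_Int open_ball) (simp add: open_halfspace_gt)
  have "b \<in> S - {0}" using \<delta> b K_pos by (simp add: S_def)
  then obtain h where h: "h \<in> \<Gamma>" "pgl_act h (proj z) \<in> proj ` (S - {0})"
    using orbit_accumulates[OF sg si z(2) open_proj_image[OF oS] _ b(3)] by blast
  obtain H H' where H: "h = pgl H" "H ** H' = mat 1" "H' ** H = mat 1" "preserves H" "preserves H'" "invertible H"
    using group_lift[OF \<Gamma> h(1) ne] by blast
  have Hz: "H *v z \<in> K" "H *v z \<noteq> 0"
    using preserves_K[OF H(4)] z invertible_vector_nonzero[OF H(6)] by auto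
  have "\<exists>u\<in>S - {0}. proj (H *v z) = proj u" using h(2) unfolding H(1) pgl_act_proj[OF H(6) z(2)] by blast
  then obtain u where u: "u \<in> S" "u \<noteq> 0" "proj (H *v z) = proj u" by blast
  then obtain c where c: "u = c *\<^sub>R (H *v z)" using proj_eq_iff[OF Hz(2) u(2)] by blast
  have "w \<bullet> u > 0" "w \<bullet> (H *v z) > 0" using u(1) K_pos[OF Hz] by (auto simp: S_def)
  then have "c > 0" unfolding c by (simp add: zero_less_mult_iff)
  then show ?thesis using u(1) h(1) H c by (intro exI[of _ H] exI[of _ H'] exI[of _ c]) (auto simp: S_def dist_norm norm_minus_commute)
qed

text \<open>Replacing both powers of \<open>G\<close> by the limit \<open>outer b e\<close> gives a
  matrix of rank at most one with image in the line of \<open>P b\<close>. The two nonvanishing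
  conditions say that it is not 0 and that \<open>P b\<close> is not in its kernel, so that a
  multiple of it is a projection.\<close>

lemma attracts_sandwich:
  fixes P Q R G :: "real^'n^'n"
  assumes at: "attracts G r b e" and k: "e \<bullet> (Q *v b) \<noteq> 0" "e \<bullet> (R *v (P *v b)) \<noteq> 0" and c: "c \<noteq> 0" and \<epsilon>: "\<epsilon> > 0"
  shows "\<forall>\<^sub>F n in sequentially. \<exists>\<rho> y f. attracts (P ** mpow G n ** Q ** mpow G n ** R) \<rho> y f \<and> norm (y - c *\<^sub>R (P *v b)) < \<epsilon>"
proof -
  define M where "M n = P ** mpow G n ** Q ** mpow G n ** R" for n
  define \<kappa> where "\<kappa> = (e \<bullet> (Q *v b)) * (e \<bullet> (R *v (P *v b)))"
  have \<kappa>: "\<kappa> \<noteq> 0" using k by (simp add: \<kappa>_def)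
  have r: "r \<noteq> 0" using at by (simp add: attracts_def)
  define x where "x = c *\<^sub>R (P *v b)"
  define \<phi> where "\<phi> = (1 / (c * (e \<bullet> (R *v (P *v b))))) *\<^sub>R (transpose R *v e)"
  have \<phi>: "\<phi> \<bullet> v = (e \<bullet> (R *v v)) / (c * (e \<bullet> (R *v (P *v b))))" for v
    by (simp only: \<phi>_def inner_scaleR_left inner_transpose) simp
  have \<phi>x: "\<phi> \<bullet> x = 1" unfolding \<phi> x_def using k c by (simp add: matrix_vector_mult_scaleR)
  define d where "d n = (1 / \<kappa>) * ((1 / r ^ n) * (1 / r ^ n))" for n
  have d: "d n \<noteq> 0" for n using \<kappa> r by (simp add: d_def)
  have "(\<lambda>n. (1 / r ^ n) *\<^sub>R mpow G n) \<longlonglongrightarrow> outer b e" using at by (simp add: attracts_def)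
  note lim = tendsto_matrix_vector_mult[OF this]
  have "(\<lambda>n. d n *\<^sub>R M n) \<longlonglongrightarrow> outer x \<phi>"
  proof (rule tendsto_matrixI)
    fix v
    have "(\<lambda>n. (1 / \<kappa>) *\<^sub>R (P *v (((1 / r ^ n) *\<^sub>R mpow G n) *v (Q *v (((1 / r ^ n) *\<^sub>R mpow G n) *v (R *v v))))))
      \<longlonglongrightarrow> (1 / \<kappa>) *\<^sub>R (P *v (outer b e *v (Q *v (outer b e *v (R *v v)))))"
      by (intro tendsto_scaleR tendsto_const lim tendsto_matrix_vector_mult)
    moreover have "(1 / \<kappa>) *\<^sub>R (P *v (((1 / r ^ n) *\<^sub>R mpow G n) *v (Q *v (((1 / r ^ n) *\<^sub>R mpow G n) *v (R *v v)))))
        = (d n *\<^sub>R M n) *v v" for n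
      by (simp add: M_def d_def scaleR_matrix_vector matrix_vector_mult_scaleR flip: matrix_vector_mul_assoc)
    moreover have "(1 / \<kappa>) *\<^sub>R (P *v (outer b e *v (Q *v (outer b e *v (R *v v))))) = outer x \<phi> *v v"
      unfolding outer_mult_vec \<phi> using k c
      by (simp add: x_def \<kappa>_def matrix_vector_mult_scaleR)
    ultimately show "(\<lambda>n. (d n *\<^sub>R M n) *v v) \<longlonglongrightarrow> outer x \<phi> *v v" by simp
  qed
  from attracts_near_rank_one[OF \<phi>x this \<epsilon>]
  have "\<forall>\<^sub>F n in sequentially. \<exists>\<rho> y f. attracts (M n) \<rho> y f \<and> norm (y - x) < \<epsilon>"
  proof eventually_elim
    case (elim n)
    then obtain \<rho> y f where y: "attracts (d n *\<^sub>R M n) \<rho> y f" "norm (y - x) < \<epsilon>" by blast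
    have "attracts ((1 / d n) *\<^sub>R (d n *\<^sub>R M n)) (1 / d n * \<rho>) y f"
      by (rule attracts_scale_matrix[OF y(1)]) (use d[of n] in simp)
    then show ?case using y(2) d[of n] by auto
  qed
  then show ?thesis by (simp add: M_def x_def)
qed

lemma extremal_scale: "extremal b \<Longrightarrow> c > 0 \<Longrightarrow> extremal (c *\<^sub>R b)"
  unfolding extremal_def
proof (intro ballI impI)
  fix p assume ext: "\<forall>p\<in>K. (\<forall>t\<ge>0. b + t *\<^sub>R p \<notin> C) \<longrightarrow> (\<exists>c. p = c *\<^sub>R b)" and c: "c > 0"
    and p: "p \<in> K" "\<forall>t\<ge>0. c *\<^sub>R b + t *\<^sub>R p \<notin> C"
  have "b + t *\<^sub>R p \<notin> C" if t: "t \<ge> 0" for t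
  proof
    assume "b + t *\<^sub>R p \<in> C"
    from C_scale[OF c this] have "c *\<^sub>R b + (c * t) *\<^sub>R p \<in> C" by (simp add: scaleR_add_right)
    then show False using p(2) c t by simp
  qed
  then obtain k where k: "p = k *\<^sub>R b" using ext p(1) by blast
  then have "p = (k / c) *\<^sub>R (c *\<^sub>R b)" using c by simp
  then show "\<exists>k. p = k *\<^sub>R (c *\<^sub>R b)" by blast
qed

text \<open>As \<open>h\<close> vanishes on all of \<open>a + t p\<close>, these points avoid
  \<open>C\<close>; the face of \<open>K\<close> cut out by \<open>h\<close> is therefore the ray of
  \<open>a\<close>.\<close>

lemma supports_extremal_kernel:
  assumes "supports h a" "extremal a" "p \<in> K" "h \<bullet> p = 0" shows "\<exists>c. p = c *\<^sub>R a"
proof -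
  have "a + t *\<^sub>R p \<notin> C" for t
    using supports_pos[OF assms(1), of "a + t *\<^sub>R p"] assms(1,4) by (auto simp: supports_def inner_add_right)
  then show ?thesis using assms(2,3) unfolding extremal_def by blast
qed

theorem hyperbolic_near_pair:
  assumes \<Gamma>: "discrete_aut_group \<Omega> \<Gamma>" and si: "strongly_irreducible \<Gamma>" and X0: "rank_one_periodic_vector \<Omega> \<Gamma> X0"
    and ab: "pair a b" and lim: "proj a \<in> limit_set \<Gamma>" "proj b \<in> limit_set \<Gamma>" and \<epsilon>: "\<epsilon> > 0"
  shows "\<exists>A B r s x y e f. pgl A \<in> \<Gamma> \<and> hyperbolic A B r s x y e f \<and> smooth x \<and> smooth y \<and> extremal x \<and> extremal y \<and>
    norm (x - b) < \<epsilon> \<and> norm (y - a) < \<epsilon>"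
proof -
  have sg: "subgroup \<Gamma> PGL" using \<Gamma> by (simp add: discrete_aut_group_def)
  obtain a0 b0 G G' r s e f where gG: "pgl G \<in> \<Gamma>" and h0: "hyperbolic G G' r s b0 a0 e f" and ext0: "extremal a0" "extremal b0"
    using rank_one_periodic_hyperbolic[OF \<Gamma> X0] by blast
  note hp = hyperbolic_props[OF h0]
  have G: "G ** G' = mat 1" "G' ** G = mat 1" and pG: "preserves G" "preserves G'" and at: "attracts G r b0 e" "attracts G' s a0 f"
    using h0 by (auto simp: hyperbolic_def)
  have ne: "C \<noteq> {}" using ab by (auto simp: pair_def)
  have nz: "a \<noteq> 0" "b \<noteq> 0" "a0 \<noteq> 0" "b0 \<noteq> 0" using pair_nonzero[OF ab] pair_nonzero[OF hp(5)] by auto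
  have KC: "a \<in> K - C" "b \<in> K - C" "a0 \<in> K - C" "b0 \<in> K - C" using ab hp(5) by (auto simp: pair_def)
  obtain e1 where e1: "e1 > 0" "\<And>x y. norm (x - b) < e1 \<Longrightarrow> norm (y - a) < e1 \<Longrightarrow>
    x + y \<in> C \<and> w \<bullet> x > 0 \<and> w \<bullet> y > 0 \<and> proj x \<noteq> proj y"
    using pair_near_open[OF ab] by blast
  define \<delta> where "\<delta> = min e1 (\<epsilon> / 2)"
  have \<delta>: "\<delta> > 0" using e1(1) \<epsilon> by (simp add: \<delta>_def)
  obtain H1 H1' c1 where H1: "c1 > 0" "pgl H1 \<in> \<Gamma>" "H1 ** H1' = mat 1" "H1' ** H1 = mat 1" "preserves H1" "preserves H1'"
    "norm (c1 *\<^sub>R (H1 *v b0) - b) < \<delta>"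
    using orbit_near[OF \<Gamma> si KC(4) nz(4) KC(2) nz(2) lim(2) ne \<delta>] by blast
  obtain H2 H2' c2 where H2: "c2 > 0" "pgl H2 \<in> \<Gamma>" "H2 ** H2' = mat 1" "H2' ** H2 = mat 1" "preserves H2" "preserves H2'"
    "norm (c2 *\<^sub>R (H2 *v a0) - a) < \<delta>"
    using orbit_near[OF \<Gamma> si KC(3) nz(3) KC(1) nz(1) lim(1) ne \<delta>] by blast
  \<comment> \<open>The target is replaced by this nearby pair, since \<open>b\<close> need not be
    extremal while \<open>b1\<close>, a rescaled image of \<open>b0\<close>, is.\<close>
  define b1 a1 where "b1 = c1 *\<^sub>R (H1 *v b0)" and "a1 = c2 *\<^sub>R (H2 *v a0)"
  have near1: "norm (b1 - b) < e1" "norm (b1 - b) < \<epsilon> / 2" "norm (a1 - a) < e1" "norm (a1 - a) < \<epsilon> / 2"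
    using H1(7) H2(7) by (simp_all add: b1_def a1_def \<delta>_def)
  have K1: "H1 *v b0 \<in> K - C" "H2 *v a0 \<in> K - C"
    using preserves_K_minus_C[OF H1(5,6,4) KC(4)] preserves_K_minus_C[OF H2(5,6,4) KC(3)] by auto
  have "b1 \<in> K - C" "a1 \<in> K - C" unfolding b1_def a1_def using K_minus_C_scale[OF H1(1) K1(1)] K_minus_C_scale[OF H2(1) K1(2)] by auto
  moreover have "b1 + a1 \<in> C" using e1(2)[OF near1(1,3)] by blast
  ultimately have pr1: "pair a1 b1" by (simp add: pair_def add.commute)
  have "extremal b1" unfolding b1_def by (rule extremal_scale[OF extremal_preserves[OF H1(5,6,3,4) ext0(2)] H1(1)])
  from attracts_near_pair[OF pr1 this] obtain e2 where e2: "e2 > 0"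
    "\<And>A B r s x y e f. A ** B = mat 1 \<Longrightarrow> B ** A = mat 1 \<Longrightarrow> preserves A \<Longrightarrow> preserves B \<Longrightarrow>
    attracts A r x e \<Longrightarrow> attracts B s y f \<Longrightarrow> norm (x - b1) < e2 \<Longrightarrow> norm (y - a1) < e2 \<Longrightarrow>
    hyperbolic A B r s x y e f \<and> smooth x \<and> smooth y \<and> extremal x \<and> extremal y" by metis
  have notpar: "H1 *v b0 \<noteq> c *\<^sub>R (H2 *v a0)" for c
  proof
    assume eq: "H1 *v b0 = c *\<^sub>R (H2 *v a0)"
    then have "b1 = (c1 * c / c2) *\<^sub>R a1" using H2(1) by (simp add: b1_def a1_def)
    then have "(c1 * c / c2) *\<^sub>R a1 + (-1) *\<^sub>R b1 = 0" by simp
    then show False using pair_independent[OF pr1] by fastforce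
  qed
  have "e \<noteq> 0" using at(1) by (auto simp: attracts_def)
  then have H1e: "transpose H1' *v e \<noteq> 0" by (rule transpose_mult_nonzero[OF H1(4)])
  have i2: "invertible H2" using inverse_pair_invertible[OF H2(3,4)] by blast
  have "H2 *v b0 \<noteq> 0" by (rule invertible_vector_nonzero[OF i2 nz(4)])
  then obtain F0 where F0: "invertible F0" "pgl F0 \<in> \<Gamma>" "(transpose H1' *v e) \<bullet> (F0 *v (H2 *v b0)) \<noteq> 0"
    using strongly_irreducible_moves[OF sg si H1e] by blast
  \<comment> \<open>\<open>F0\<close> is rescaled to the lift that preserves \<open>C\<close>; this
    does not affect the nonvanishing.\<close>
  obtain F F' where F: "pgl F0 = pgl F" "F ** F' = mat 1" "F' ** F = mat 1" "preserves F" "preserves F'" "invertible F"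
    using group_lift[OF \<Gamma> F0(2) ne] by blast
  obtain k where k: "k \<noteq> 0" "F = k *\<^sub>R F0" using pgl_eq_iff[OF F0(1) F(6)] F(1) by blast
  have "e \<bullet> (H1' *v (F0 *v (H2 *v b0))) \<noteq> 0" using F0(3) unfolding inner_transpose .
  then have q1: "e \<bullet> (H1' *v (F *v (H2 *v b0))) \<noteq> 0"
    using k by (simp add: scaleR_matrix_vector matrix_vector_mult_scaleR)
  \<comment> \<open>\<open>e\<close> supports \<open>K\<close> at \<open>a0\<close>, so vanishing
    would make this point of \<open>K\<close> a multiple of \<open>a0\<close>, and hence
    \<open>H1 b0\<close> a multiple of \<open>H2 a0\<close>.\<close>
  have q2: "e \<bullet> (H2' *v (H1 *v b0)) \<noteq> 0"
  proof
    assume "e \<bullet> (H2' *v (H1 *v b0)) = 0"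
    moreover have "H2' *v (H1 *v b0) \<in> K" using preserves_K[OF H2(6)] K1(1) by blast
    ultimately obtain c where "H2' *v (H1 *v b0) = c *\<^sub>R a0"
      using supports_extremal_kernel[OF hp(3) ext0(1)] by blast
    then have "H1 *v b0 = c *\<^sub>R (H2 *v a0)"
      using inverse_pair_vec[OF H2(3), of "H1 *v b0"] by (simp add: matrix_vector_mult_scaleR)
    then show False using notpar by blast
  qed
  have q3: "f \<bullet> (H1' *v (H2 *v a0)) \<noteq> 0"
  proof
    assume "f \<bullet> (H1' *v (H2 *v a0)) = 0"
    moreover have "H1' *v (H2 *v a0) \<in> K" using preserves_K[OF H1(6)] K1(2) by blast
    ultimately obtain c where c: "H1' *v (H2 *v a0) = c *\<^sub>R b0"
      using supports_extremal_kernel[OF hp(4) ext0(2)] by blast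
    then have eq: "H2 *v a0 = c *\<^sub>R (H1 *v b0)"
      using inverse_pair_vec[OF H1(3), of "H2 *v a0"] by (simp add: matrix_vector_mult_scaleR)
    have "c \<noteq> 0" using eq invertible_vector_nonzero[OF i2 nz(3)] by auto
    then have "H1 *v b0 = (1 / c) *\<^sub>R (H2 *v a0)" using eq by simp
    then show False using notpar by blast
  qed
  have i1: "invertible H1" using inverse_pair_invertible[OF H1(3,4)] by blast
  \<comment> \<open>The condition for the inverse follows from \<open>q1\<close>: vanishing would
    make \<open>H1 a0\<close> a multiple of \<open>F (H2 b0)\<close>, and applying
    \<open>H1'\<close> and then \<open>e\<close> contradicts
    \<open>e \<bullet> a0 = 0\<close>.\<close>
  have q4: "f \<bullet> (H2' *v (F' *v (H1 *v a0))) \<noteq> 0"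
  proof
    assume "f \<bullet> (H2' *v (F' *v (H1 *v a0))) = 0"
    moreover have "H2' *v (F' *v (H1 *v a0)) \<in> K"
      using preserves_K[OF H2(6) preserves_K[OF F(5) preserves_K[OF H1(5)]]] KC(3) by blast
    ultimately obtain c where c: "H2' *v (F' *v (H1 *v a0)) = c *\<^sub>R b0"
      using supports_extremal_kernel[OF hp(4) ext0(2)] by blast
    have "F' *v (H1 *v a0) = H2 *v (H2' *v (F' *v (H1 *v a0)))" by (simp only: inverse_pair_vec[OF H2(3)])
    also have "\<dots> = c *\<^sub>R (H2 *v b0)" unfolding c by (rule matrix_vector_mult_scaleR)
    finally have c': "F' *v (H1 *v a0) = c *\<^sub>R (H2 *v b0)" .
    have "H1 *v a0 = F *v (F' *v (H1 *v a0))" by (simp only: inverse_pair_vec[OF F(2)])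
    also have "\<dots> = c *\<^sub>R (F *v (H2 *v b0))" unfolding c' by (rule matrix_vector_mult_scaleR)
    finally have c'': "H1 *v a0 = c *\<^sub>R (F *v (H2 *v b0))" .
    have "c \<noteq> 0" using c'' invertible_vector_nonzero[OF i1 nz(3)] by auto
    have "a0 = H1' *v (H1 *v a0)" by (simp only: inverse_pair_vec[OF H1(4)])
    also have "\<dots> = c *\<^sub>R (H1' *v (F *v (H2 *v b0)))" unfolding c'' by (rule matrix_vector_mult_scaleR)
    finally have "e \<bullet> a0 = c * (e \<bullet> (H1' *v (F *v (H2 *v b0))))" by (metis inner_scaleR_right)
    then show False using q1 \<open>c \<noteq> 0\<close> hp(3) by (simp add: supports_def)
  qed
  define P where "P n = H1 ** mpow G n ** (H1' ** F ** H2) ** mpow G n ** H2'" for n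
  \<comment> \<open>The inverse of \<open>P n\<close> has the same form, with \<open>H1\<close> and
    \<open>H2\<close> exchanged and \<open>G'\<close>, \<open>F'\<close> in place of
    \<open>G\<close>, \<open>F\<close>, so it attracts towards \<open>a1\<close>.\<close>
  define P' where "P' n = H2 ** mpow G' n ** (H2' ** F' ** H1) ** mpow G' n ** H1'" for n
  \<comment> \<open>\<open>e2\<close> belongs to the pair \<open>a1\<close>, \<open>b1\<close>, so
    this bound can be fixed only after \<open>H1\<close> and \<open>H2\<close>.\<close>
  define \<delta>2 where "\<delta>2 = min e2 (\<epsilon> / 2)"
  have \<delta>2: "\<delta>2 > 0" using e2(1) \<epsilon> by (simp add: \<delta>2_def)
  have "\<forall>\<^sub>F n in sequentially. \<exists>\<rho> y f. attracts (P n) \<rho> y f \<and> norm (y - b1) < \<delta>2"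
    unfolding P_def b1_def
    by (rule attracts_sandwich[OF at(1) _ q2 _ \<delta>2]) (use q1 H1(1) in \<open>simp_all flip: matrix_vector_mul_assoc\<close>)
  moreover have "\<forall>\<^sub>F n in sequentially. \<exists>\<rho> y f. attracts (P' n) \<rho> y f \<and> norm (y - a1) < \<delta>2"
    unfolding P'_def a1_def
    by (rule attracts_sandwich[OF at(2) _ q3 _ \<delta>2]) (use q4 H2(1) in \<open>simp_all flip: matrix_vector_mul_assoc\<close>)
  ultimately have "\<forall>\<^sub>F n in sequentially. (\<exists>\<rho> y f. attracts (P n) \<rho> y f \<and> norm (y - b1) < \<delta>2) \<and>
      (\<exists>\<rho> y f. attracts (P' n) \<rho> y f \<and> norm (y - a1) < \<delta>2)" by (rule eventually_conj)
  then obtain n \<rho> x \<phi> \<rho>' y \<phi>' where x: "attracts (P n) \<rho> x \<phi>" "norm (x - b1) < \<delta>2"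
    and y: "attracts (P' n) \<rho>' y \<phi>'" "norm (y - a1) < \<delta>2"
    using eventually_happens'[OF sequentially_bot] by blast
  have PP: "P n ** P' n = mat 1" "P' n ** P n = mat 1"
    unfolding P_def P'_def matrix_eq
    by (simp_all only: matrix_vector_mul_assoc[symmetric] inverse_pair_vec[OF H1(3)] inverse_pair_vec[OF H1(4)]
        inverse_pair_vec[OF H2(3)] inverse_pair_vec[OF H2(4)] inverse_pair_vec[OF F(2)] inverse_pair_vec[OF F(3)]
        mpow_inverse[OF G(1)] mpow_inverse[OF G(2)] matrix_vector_mul_lid simp_thms)
  have prP: "preserves (P n)" "preserves (P' n)"
    unfolding P_def P'_def by (intro preserves_mult preserves_mpow H1 H2 F pG)+
  have iG: "invertible (mpow G n)"
    using inverse_pair_invertible[OF mpow_inverse_mult[OF G(1)] mpow_inverse_mult[OF G(2)]] by blast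
  have i': "invertible H1'" "invertible H2'"
    using inverse_pair_invertible[OF H1(3,4)] inverse_pair_invertible[OF H2(3,4)] by auto
  have "pgl F \<in> \<Gamma>" "pgl H1' \<in> \<Gamma>" "pgl H2' \<in> \<Gamma>" "pgl (mpow G n) \<in> \<Gamma>"
    using F0(2) F(1) subgroup_PGL_closed(2)[OF sg H1(3,4,2)] subgroup_PGL_closed(2)[OF sg H2(3,4,2)]
      subgroup_PGL_closed(3)[OF sg G gG] by auto
  then have gP: "pgl (P n) \<in> \<Gamma>"
    unfolding P_def by (intro subgroup_PGL_closed(1)[OF sg] invertible_mult i1 i2 i' iG F(6) H1(2) H2(2))
  have hyp: "hyperbolic (P n) (P' n) \<rho> \<rho>' x y \<phi> \<phi>' \<and> smooth x \<and> smooth y \<and> extremal x \<and> extremal y"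
    using e2(2)[OF PP prP x(1) y(1)] x(2) y(2) by (simp add: \<delta>2_def)
  have "norm (x - b) \<le> norm (x - b1) + norm (b1 - b)" "norm (y - a) \<le> norm (y - a1) + norm (a1 - a)"
    using norm_triangle_ineq[of "x - b1" "b1 - b"] norm_triangle_ineq[of "y - a1" "a1 - a"] by simp_all
  then have "norm (x - b) < \<epsilon>" "norm (y - a) < \<epsilon>" using x(2) y(2) near1 by (simp_all add: \<delta>2_def)
  then show ?thesis using gP hyp by blast
qed

theorem rank_one_periodic_dense:
  assumes \<Gamma>: "discrete_aut_group \<Omega> \<Gamma>" and si: "strongly_irreducible \<Gamma>" and X0: "rank_one_periodic_vector \<Omega> \<Gamma> X0"
    and X: "X \<in> T1M_bip \<Omega> \<Gamma>" and W: "openin (T1M_topology \<Omega> \<Gamma>) W" "X \<in> W"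
  shows "\<exists>Y\<in>W. rank_one_periodic_vector \<Omega> \<Gamma> Y"
proof -
  obtain v where v: "v \<in> T1 \<Omega>" "forward_end \<Omega> v \<in> limit_set \<Gamma>" "backward_end \<Omega> v \<in> limit_set \<Gamma>" "X = orbit \<Gamma> v"
    using X by (auto simp: T1M_bip_def)
  obtain a b where ab: "pair a b" "v = gvec a b" using v(1) unfolding T1_eq by blast
  \<comment> \<open>An open set of the quotient pulls back to the trace of an open \<open>O'\<close>
    on the unit vectors; by \<open>gvec_near\<close> it suffices to move the endpoint lifts
    slightly.\<close>
  obtain O' where O': "open O'" "{v \<in> T1 \<Omega>. orbit \<Gamma> v \<in> W} = T1 \<Omega> \<inter> O'"
    using W(1) unfolding openin_T1M_topology openin_open by blast
  have "gvec a b \<in> O'" using O'(2) v(1,4) W(2) ab(2) by blast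
  then obtain \<epsilon> where \<epsilon>: "\<epsilon> > 0"
    "\<And>a' b'. norm (a' - a) < \<epsilon> \<Longrightarrow> norm (b' - b) < \<epsilon> \<Longrightarrow> pair a' b' \<Longrightarrow> gvec a' b' \<in> O'"
    using gvec_near[OF O'(1) _ ab(1)] by blast
  have lim: "proj a \<in> limit_set \<Gamma>" "proj b \<in> limit_set \<Gamma>"
    using v(2,3) unfolding ab(2) forward_end_gvec[OF ab(1)] backward_end_gvec[OF ab(1)] by auto
  obtain A B r s x y e f where A: "pgl A \<in> \<Gamma>" and h: "hyperbolic A B r s x y e f"
    and reg: "smooth x" "smooth y" "extremal x" "extremal y" and near: "norm (x - b) < \<epsilon>" "norm (y - a) < \<epsilon>"
    using hyperbolic_near_pair[OF \<Gamma> si X0 ab(1) lim \<epsilon>(1)] by blast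
  have yx: "pair y x" using hyperbolic_props[OF h] by blast
  have "gvec y x \<in> T1 \<Omega> \<inter> O'" using \<epsilon>(2)[OF near(2,1) yx] yx T1_eq by blast
  then have "orbit \<Gamma> (gvec y x) \<in> W" using O'(2) by blast
  then show ?thesis using hyperbolic_rank_one_periodic[OF \<Gamma> A h reg] by blast
qed

end

theorem proposition3p4:
  fixes \<Omega> :: "('n::finite) projective set"
  assumes "open \<Omega>" and "properly_convex \<Omega>"
  shows
    "(\<forall>\<xi> \<eta>. (\<xi>, \<eta>) \<in> Geod \<Omega> \<and> strongly_extremal \<Omega> \<xi> \<longrightarrow>
        (\<exists>U U'. open U \<and> \<xi> \<in> U \<and> open U' \<and> \<eta> \<in> U' \<and>
           (\<forall>g\<in>Aut \<Omega>. biproximal g \<and>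
              (attracting_fixed_point g, attracting_fixed_point (inv\<^bsub>PGL\<^esub> g)) \<in> U \<times> U' \<longrightarrow>
              rank_one_element \<Omega> (generate PGL {g}) g)))
     \<and> (\<forall>\<Gamma>. discrete_aut_group \<Omega> \<Gamma> \<and> strongly_irreducible \<Gamma> \<and> rank_one_manifold \<Omega> \<Gamma> \<longrightarrow>
        {X. rank_one_periodic_vector \<Omega> \<Gamma> X} \<subseteq> T1M_bip \<Omega> \<Gamma> \<and>
        subtopology (T1M_topology \<Omega> \<Gamma>) (T1M_bip \<Omega> \<Gamma>) closure_of {X. rank_one_periodic_vector \<Omega> \<Gamma> X}
          = T1M_bip \<Omega> \<Gamma> \<and>
        T1M_bip \<Omega> \<Gamma> \<noteq> {})"
proof -
  obtain C w where C: "cone C w" and \<Omega>: "\<Omega> = proj ` C"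
    using properly_convex_cone[OF assms] by metis
  interpret cone C w by (rule C)
  have \<Omega>': "\<Omega> = cone.\<Omega> C" unfolding \<Omega> \<Omega>_def ..
  show ?thesis unfolding \<Omega>'
  proof (intro conjI allI impI, goal_cases)
    case (1 \<xi> \<eta>)
    then show ?case using biproximal_near_rank_one by blast
  next
    case (2 \<Gamma>)
    then show ?case using rank_one_periodic_subset_T1M_bip by blast
  next
    case (3 \<Gamma>)
    then obtain X0 where \<Gamma>: "discrete_aut_group (cone.\<Omega> C) \<Gamma>" "strongly_irreducible \<Gamma>"
      and X0: "rank_one_periodic_vector (cone.\<Omega> C) \<Gamma> X0" by (auto simp: rank_one_manifold_def)
    let ?T = "T1M_topology (cone.\<Omega> C) \<Gamma>" and ?B = "T1M_bip (cone.\<Omega> C) \<Gamma>"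
    have sub: "{X. rank_one_periodic_vector (cone.\<Omega> C) \<Gamma> X} \<subseteq> ?B"
      using rank_one_periodic_subset_T1M_bip[OF \<Gamma>(1)] by blast
    have top: "?B \<subseteq> topspace ?T"
      using quotient_imp_surjective_map[OF quotient_map_T1M[of "cone.\<Omega> C" \<Gamma>]] by (auto simp: T1M_bip_def)
    show ?case
    proof
      show "subtopology ?T ?B closure_of {X. rank_one_periodic_vector (cone.\<Omega> C) \<Gamma> X} \<subseteq> ?B"
        using closure_of_subset_topspace[of "subtopology ?T ?B"] by fastforce
      show "?B \<subseteq> subtopology ?T ?B closure_of {X. rank_one_periodic_vector (cone.\<Omega> C) \<Gamma> X}"
      proof
        fix X assume X: "X \<in> ?B"
        show "X \<in> subtopology ?T ?B closure_of {X. rank_one_periodic_vector (cone.\<Omega> C) \<Gamma> X}"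
          unfolding in_closure_of
        proof (intro conjI allI impI, goal_cases)
          case 1
          then show ?case using X top by auto
        next
          case (2 V)
          then obtain W where W: "openin ?T W" "V = W \<inter> ?B" by (auto simp: openin_subtopology)
          then obtain Y where "Y \<in> W" "rank_one_periodic_vector (cone.\<Omega> C) \<Gamma> Y"
            using rank_one_periodic_dense[OF \<Gamma> X0 X W(1)] 2 by blast
          then show ?case using sub W(2) by blast
        qed
      qed
    qed
  next
    case (4 \<Gamma>)
    then show ?case using rank_one_periodic_subset_T1M_bip by (auto simp: rank_one_manifold_def)
  qed
qed

end
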